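(* Let $\theta$ be a primitive substitution on a finite alphabet $\mathcal{A}$, with $\theta$-matrix $M$ having Perron–Frobenius eigenvalue $\lambda>1$, and let $u$ be any fixed point of $\theta$. Let $f:\mathcal{A}\to\mathbb{C}$ be a left eigenfunction of $M$ with eigenvalue $\lambda_f$, $|\lambda_f|=1$, which is not a coboundary; if $\lambda_f\in\mathbb{R}$, assume $f$ is real-valued. Let $K_N$ be uniformly distributed on $\{1,\dots,N\}$. If $\lambda_f\ne1$, then as $N\to\infty$ $$\frac{S_f(u_{\le K_N})}{\sqrt{\log_\lambda(N)}}\Rightarrow Z_f .$$ If $\lambda_f=1$, then as $N\to\infty$ $$\frac{S_f(u_{\le K_N})-\log_\lambda(N)\,D_f}{\sqrt{\log_\lambda(N)}}\Rightarrow Z_f .$$ Here $\Rightarrow$ denotes convergence in distribution.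
   Context: $\mathcal{A}^*$ is the set of finite words over $\mathcal{A}$. A substitution is a map $\theta:\mathcal{A}\to\mathcal{A}^*$, extended to finite words and to $\mathcal{A}^{\mathbb{N}}$ by concatenation. The $\theta$-matrix $M$ has $M_{a,b}$ = number of occurrences of $a$ in $\theta(b)$; $\theta$ is primitive if some power $M^k$, $k>0$, has all entries positive. A fixed point of $\theta$ is $u\in\mathcal{A}^{\mathbb{N}}$ with $\theta^k(u)=u$ for some $k\in\mathbb{N}$. For a word or sequence $w$, $w_j$ is its $j$-th letter, $w_{<k}=w_1\cdots w_{k-1}$ (empty for $k=1$), $w_{\le k}=w_1\cdots w_k$. $S_f(a_1\cdots a_k)=f(a_1)+\cdots+f(a_k)$. A left eigenfunction is a nonzero $f$ with $\sum_a f(a)M_{a,b}=\lambda_f f(b)$ for all $b$. Here $f$ is called a coboundary if $\{S_f(u_{\le n})\}_{n\ge1}$ is bounded. $\mathcal{X}=\{(a,j):a\in\mathcal{A},1\le j\le|\theta(a)|\}$. Let $\rho,\sigma$ be positive right and left Perron–Frobenius eigenvectors of $M$ with $\sum_a\sigma(a)\rho(a)=1$; put $\hat\rho(b,k)=\rho(b)$, $\hat\sigma(b,k)=\lambda^{-1}\sigma(\theta(b)_k)$, and let $\mathfrak{m}(x)=\hat\sigma(x)\hat\rho(x)$, a probability measure on $\mathcal{X}$. Let $\mathfrak{p}((a,j),(b,k))=\dfrac{\mathbf{1}\{a=\theta(b)_k\}\,\hat\rho(b,k)}{\lambda\,\hat\rho(a,j)}$, a stochastic matrix on $\mathcal{X}$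 with invariant measure $\mathfrak{m}$. Let $$D_f=\sum_{(a,j)\in\mathcal{X}}\mathfrak{m}(a,j)\,S_f(\theta(a)_{<j}),\qquad g(a,j)=S_f(\theta(a)_{<j})-D_f .$$ Let $(X_1,X_2,\dots)$ be the stationary Markov chain on $\mathcal{X}$ with initial law $\mathfrak{m}$ and transition matrix $\mathfrak{p}$, and $$V_f=\mathbb{E}|g(X_1)|^2+\sum_{k=2}^\infty2\,\mathbb{E}\,\mathrm{Re}\bigl[\overline{\lambda_f}^{\,k-1}g(X_1)\overline{g(X_k)}\bigr].$$ $Z_f$ is the following random variable: if $\lambda_f\notin\mathbb{R}$, $Z_f=X+iY$ with $X,Y$ independent centered real normal variables, $\mathbb{E}X^2=\mathbb{E}Y^2=V_f/2$ (so $\mathbb{E}|Z_f|^2=V_f$); if $\lambda_f\in\mathbb{R}$ and $f$ is real, $Z_f$ is a centered real normal variable with variance $V_f$. *)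

theory Defs
  imports "HOL-Probability.Probability" "HOL-Library.Stream"
begin

text \<open>
  Letters are the elements of a finite type, a substitution is a function
  \<open>\<theta> :: 'a \<Rightarrow> 'a list\<close>, and infinite words are streams.
\<close>

definition subst_matrix :: "('a::finite \<Rightarrow> 'a list) \<Rightarrow> real^'a^'a" where
  "subst_matrix \<theta> = (\<chi> a b. real (count_list (\<theta> b) a))"

definition matrix_power :: "real^'n^'n \<Rightarrow> nat \<Rightarrow> real^'n^'n" where
  "matrix_power A k = (((**) A) ^^ k) (mat 1)"

definition primitive_subst :: "('a::finite \<Rightarrow> 'a list) \<Rightarrow> bool" where
  "primitive_subst \<theta> \<longleftrightarrow>
     (\<exists>k>0. \<forall>a b. 0 < matrix_power (subst_matrix \<theta>) k $ a $ b)"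

text \<open>The Perron--Frobenius eigenvalue: an eigenvalue which dominates the modulus of every
  complex eigenvalue.\<close>

definition perron_frobenius_eigenvalue :: "real^'n^'n \<Rightarrow> real \<Rightarrow> bool" where
  "perron_frobenius_eigenvalue A l \<longleftrightarrow>
     (\<exists>v. v \<noteq> 0 \<and> A *v v = l *s v) \<and>
     (\<forall>\<mu>::complex. \<forall>w. w \<noteq> 0 \<and> (\<chi> i j. complex_of_real (A $ i $ j)) *v w = \<mu> *s w
        \<longrightarrow> cmod \<mu> \<le> l)"

text \<open>\<open>flat\<close> is infinite concatenation provided that no \<open>\<theta> a\<close> is empty, which primitivity
  guarantees.\<close>

definition subst_seq :: "('a \<Rightarrow> 'a list) \<Rightarrow> 'a stream \<Rightarrow> 'a stream" where
  "subst_seq \<theta> u = flat (smap \<theta> u)"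

definition subst_fixed_point :: "('a \<Rightarrow> 'a list) \<Rightarrow> 'a stream \<Rightarrow> bool" where
  "subst_fixed_point \<theta> u \<longleftrightarrow> (\<exists>k>0. (subst_seq \<theta> ^^ k) u = u)"

definition word_sum :: "('a \<Rightarrow> complex) \<Rightarrow> 'a list \<Rightarrow> complex" where
  "word_sum f w = sum_list (map f w)"

definition left_eigenfunction :: "real^'a^'a \<Rightarrow> ('a::finite \<Rightarrow> complex) \<Rightarrow> complex \<Rightarrow> bool" where
  "left_eigenfunction A f \<mu> \<longleftrightarrow>
     (\<exists>a. f a \<noteq> 0) \<and> (\<forall>b. (\<Sum>a\<in>UNIV. f a * complex_of_real (A $ a $ b)) = \<mu> * f b)"

definition coboundary :: "'a stream \<Rightarrow> ('a \<Rightarrow> complex) \<Rightarrow> bool" where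
  "coboundary u f \<longleftrightarrow> bounded ((\<lambda>n. word_sum f (stake n u)) ` {1..})"

text \<open>Positions \<open>j\<close> in \<open>(a, j)\<close> count from 1, so the \<open>j\<close>-th letter of \<open>\<theta> a\<close> is
  \<open>\<theta> a ! (j - 1)\<close> and \<open>\<theta>(a)\<^sub><\<^sub>j\<close> is \<open>take (j - 1) (\<theta> a)\<close>.\<close>

definition chain_states :: "('a \<Rightarrow> 'a list) \<Rightarrow> ('a \<times> nat) set" where
  "chain_states \<theta> = {(a, j). 1 \<le> j \<and> j \<le> length (\<theta> a)}"

definition rho_hat :: "real^'a \<Rightarrow> 'a::finite \<times> nat \<Rightarrow> real" where
  "rho_hat \<rho> = (\<lambda>(b, k). \<rho> $ b)"

definition sigma_hat :: "('a::finite \<Rightarrow> 'a list) \<Rightarrow> real \<Rightarrow> real^'a \<Rightarrow> 'a \<times> nat \<Rightarrow> real" where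
  "sigma_hat \<theta> l \<sigma> = (\<lambda>(b, k). \<sigma> $ (\<theta> b ! (k - 1)) / l)"

definition chain_law ::
  "('a::finite \<Rightarrow> 'a list) \<Rightarrow> real \<Rightarrow> real^'a \<Rightarrow> real^'a \<Rightarrow> 'a \<times> nat \<Rightarrow> real" where
  "chain_law \<theta> l \<rho> \<sigma> x = sigma_hat \<theta> l \<sigma> x * rho_hat \<rho> x"

definition chain_trans ::
  "('a::finite \<Rightarrow> 'a list) \<Rightarrow> real \<Rightarrow> real^'a \<Rightarrow> 'a \<times> nat \<Rightarrow> 'a \<times> nat \<Rightarrow> real" where
  "chain_trans \<theta> l \<rho> x y =
     (if fst x = \<theta> (fst y) ! (snd y - 1) then rho_hat \<rho> y / (l * rho_hat \<rho> x) else 0)"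

definition drift ::
  "('a::finite \<Rightarrow> 'a list) \<Rightarrow> real \<Rightarrow> real^'a \<Rightarrow> real^'a \<Rightarrow> ('a \<Rightarrow> complex) \<Rightarrow> complex" where
  "drift \<theta> l \<rho> \<sigma> f =
     (\<Sum>(a, j)\<in>chain_states \<theta>.
        complex_of_real (chain_law \<theta> l \<rho> \<sigma> (a, j)) * word_sum f (take (j - 1) (\<theta> a)))"

definition centered_prefix_sum ::
  "('a::finite \<Rightarrow> 'a list) \<Rightarrow> real \<Rightarrow> real^'a \<Rightarrow> real^'a \<Rightarrow> ('a \<Rightarrow> complex) \<Rightarrow> 'a \<times> nat \<Rightarrow> complex"
  where
  "centered_prefix_sum \<theta> l \<rho> \<sigma> f =
     (\<lambda>(a, j). word_sum f (take (j - 1) (\<theta> a)) - drift \<theta> l \<rho> \<sigma> f)"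

text \<open>A Markov chain \<open>X 1, X 2, \<dots>\<close> with values in \<open>S\<close>; the value \<open>X 0\<close> plays no role.\<close>

definition markov_chain ::
  "'w measure \<Rightarrow> 's set \<Rightarrow> ('s \<Rightarrow> real) \<Rightarrow> ('s \<Rightarrow> 's \<Rightarrow> real) \<Rightarrow> (nat \<Rightarrow> 'w \<Rightarrow> 's) \<Rightarrow> bool" where
  "markov_chain P S m p X \<longleftrightarrow>
     prob_space P \<and>
     (\<forall>n\<ge>1. X n \<in> measurable P (count_space S)) \<and>
     (\<forall>x\<in>S. \<P>(\<omega> in P. X 1 \<omega> = x) = m x) \<and>
     (\<forall>n\<ge>1. \<forall>x. \<forall>y\<in>S.
        (\<forall>i\<in>{1..n}. x i \<in> S) \<and> \<P>(\<omega> in P. \<forall>i\<in>{1..n}. X i \<omega> = x i) \<noteq> 0 \<longrightarrow>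
        \<P>(\<omega> in P. X (Suc n) \<omega> = y \<bar> \<forall>i\<in>{1..n}. X i \<omega> = x i) = p (x n) y)"

text \<open>The series over \<open>k \<ge> 2\<close> is shifted to start at 0.\<close>

definition asymptotic_variance ::
  "'w measure \<Rightarrow> (nat \<Rightarrow> 'w \<Rightarrow> 's) \<Rightarrow> ('s \<Rightarrow> complex) \<Rightarrow> complex \<Rightarrow> real" where
  "asymptotic_variance P X g \<mu> =
     (LINT \<omega>|P. (cmod (g (X 1 \<omega>)))\<^sup>2) +
     (\<Sum>k. 2 * (LINT \<omega>|P. Re (cnj \<mu> ^ (k + 1) * g (X 1 \<omega>) * cnj (g (X (k + 2) \<omega>)))))"

text \<open>\<open>normal_density 0 0\<close> is the zero function, so variance 0 is treated separately.\<close>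

definition centered_normal :: "real \<Rightarrow> real measure" where
  "centered_normal v =
     (if v = 0 then return borel 0 else density lborel (normal_density 0 (sqrt v)))"

text \<open>The law of the limit variable; independence of real and imaginary part is expressed by
  the product measure.\<close>

definition limit_law :: "complex \<Rightarrow> real \<Rightarrow> complex measure" where
  "limit_law \<mu> v =
     (if \<mu> \<in> \<real> then distr (centered_normal v) borel complex_of_real
      else distr (centered_normal (v / 2) \<Otimes>\<^sub>M centered_normal (v / 2)) borel
             (\<lambda>(x, y). Complex x y))"

definition weakly_converges ::
  "(nat \<Rightarrow> 'b::topological_space measure) \<Rightarrow> 'b measure \<Rightarrow> bool" where
  "weakly_converges \<mu> \<nu> \<longleftrightarrow>
     (\<forall>\<phi>::'b \<Rightarrow> real. continuous_on UNIV \<phi> \<and> bounded (range \<phi>) \<longrightarrow>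
        (\<lambda>n. LINT z|\<mu> n. \<phi> z) \<longlonglongrightarrow> (LINT z|\<nu>. \<phi> z))"

text \<open>The law of \<open>Y K\<close> for \<open>K\<close> uniformly distributed on \<open>{1..N}\<close> (meaningful for \<open>N \<ge> 1\<close>).\<close>

definition uniform_law :: "nat \<Rightarrow> (nat \<Rightarrow> complex) \<Rightarrow> complex measure" where
  "uniform_law N Y = distr (measure_pmf (pmf_of_set {1..N})) borel Y"

end

theory Submission
  imports Defs "HOL-Real_Asymp.Real_Asymp"
begin

text \<open>
  A left eigenfunction \<open>f\<close> turns substitution into rotation: \<open>S\<^sub>f (\<theta> w) = \<lambda>\<^sub>f S\<^sub>f w\<close>.  A position
  inside the block \<open>\<theta>\<^sup>n a\<close> is reached by descending \<open>n\<close> times from a letter to one of the letters of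
  its image, and the sum of \<open>f\<close> up to that position collects at each level a sum of \<open>f\<close> over a
  proper prefix of some \<open>\<theta> b\<close>, rotated by a power of \<open>\<lambda>\<^sub>f\<close>.  If the position is uniform in a long
  block, the descent is nearly a Markov chain which moves from \<open>a\<close> to its \<open>k\<close>-th child with
  probability \<open>\<sigma>(\<theta>(a)\<^sub>k) / (\<lambda> \<sigma>(a))\<close>.  As a prefix of length \<open>N\<close> has about \<open>log\<^sub>\<lambda> N\<close> levels, the theorem
  is a central limit theorem for an additive functional of this chain, with a rotating summand.

  The proof works with characteristic functions.  The normalised sum of \<open>exp (i Re (z S\<^sub>f))\<close> over
  the prefixes of \<open>\<theta>\<^sup>n a\<close> satisfies an exact recursion in \<open>n\<close>, an average over the children with
  phase factors (\<open>block_mean_Suc\<close>).  Two correctors make the recursion almost scalar.  The first is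
  Gordin's: adding to the summand a difference of values of a solution \<open>\<eta>\<close> of a Poisson equation
  gives increments \<open>\<xi>\<close> whose mean vanishes at every letter.  The second solves a Poisson equation for the conditional
  second moment of \<open>\<xi>\<close>, which depends on the letter and on the direction of \<open>z\<close>.  After both
  corrections one level multiplies the characteristic function by a number independent of the
  letter, up to \<open>O(|z|\<^sup>3)\<close> (\<open>one_level_estimate\<close>).  For \<open>|z|\<close> of order \<open>n\<^sup>-\<^sup>1\<^sup>/\<^sup>2\<close> the errors of
  \<open>n\<close> levels vanish in the limit (\<open>block_mean_asymptotics\<close>).  Poisson equations can be solved because
  primitivity makes the averaging operator over children contract functions of mean zero, and
  constants are harmless whenever the operator is multiplied by a number other than 1.

  The quadratic form \<open>(Re (z \<xi>))\<^sup>2 = |z|\<^sup>2|\<xi>|\<^sup>2 / 2 + Re (z\<^sup>2\<xi>\<^sup>2) / 2\<close> explains the two shapes of the limit: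
  the last term is rotated by \<open>\<lambda>\<^sub>f\<^sup>2\<close> from level to level, so it averages out if \<open>\<lambda>\<^sub>f\<close> is not real, and
  an isotropic normal law remains.  For \<open>\<lambda>\<^sub>f = 1\<close> the mean of the summand adds up
  to the drift, for \<open>\<lambda>\<^sub>f \<noteq> 1\<close> the rotation cancels it.

  An arbitrary prefix of the fixed point is, up to a remainder of length \<open>\<epsilon>N\<close>, the image
  under \<open>\<theta>\<^sup>n\<close> of a word whose length is bounded in terms of \<open>\<epsilon>\<close>, so the
  result for blocks carries over (\<open>prefix_mean_asymptotics\<close>).  The second moment of \<open>\<xi>\<close> is the series that defines
  \<open>V\<^sub>f\<close>, since the chain on pairs \<open>(a, j)\<close> is the time reversal of the descent
  (\<open>asymptotic_variance_eq\<close>).  Finally, convergence of characteristic functions on the plane implies weak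
  convergence (\<open>weakly_converges_if_cchar_converges\<close>).
\<close>

section \<open>Characteristic functions and weak convergence in the plane\<close>

text \<open>
  The real frequency vector is encoded as the complex number \<open>z\<close>: \<open>Re (z * w)\<close> is the inner product of \<open>w\<close>
  with \<open>cnj z\<close>.
\<close>

definition cchar :: "complex measure \<Rightarrow> complex \<Rightarrow> complex" where
  "cchar M z = (CLINT w|M. iexp (Re (z * w)))"

lemma iexp_add: "iexp (x + y) = iexp x * iexp y"
  by (simp add: exp_add algebra_simps)

lemma iexp_diff: "iexp (x - y) = iexp x * cnj (iexp y)"
  by (simp add: exp_cnj exp_diff exp_minus divide_inverse algebra_simps)

lemma integrable_bounded_continuous:
  fixes \<phi> :: "'b::topological_space \<Rightarrow> 'c::{banach, second_countable_topology}"
  assumes "prob_space M" and "sets M = sets borel"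
    and "continuous_on UNIV \<phi>" and "\<And>x. norm (\<phi> x) \<le> B"
  shows "integrable M \<phi>"
proof -
  interpret prob_space M by fact
  have "\<phi> \<in> borel_measurable M"
    using borel_measurable_continuous_onI[OF assms(3)] measurable_cong_sets[OF assms(2) refl] by blast
  then show ?thesis
    using assms(4) by (intro integrable_const_bound[of _ B]) auto
qed

text \<open>
  Real trigonometric polynomials with arbitrary real frequencies. They are the functions whose
  integrals are controlled by the characteristic function, and they form an algebra.
\<close>

inductive trig_function :: "(complex \<Rightarrow> real) \<Rightarrow> bool" where
  base: "trig_function (\<lambda>w. Re (c * iexp (Re (z * w))))"
| add: "trig_function p \<Longrightarrow> trig_function q \<Longrightarrow> trig_function (\<lambda>w. p w + q w)"

lemma trig_function_base_mult:
  assumes "trig_function p"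
  shows "trig_function (\<lambda>w. Re (c * iexp (Re (z * w))) * p w)"
  using assms
proof induction
  case (base d y)
  have "Re (c * iexp (Re (z * w))) * Re (d * iexp (Re (y * w)))
      = Re (c * d / 2 * iexp (Re ((z + y) * w))) + Re (c * cnj d / 2 * iexp (Re ((z - y) * w)))" for w
  proof -
    define a b where "a = c * iexp (Re (z * w))" and "b = d * iexp (Re (y * w))"
    have "c * d / 2 * iexp (Re ((z + y) * w)) = a * b / 2"
      unfolding distrib_right plus_complex.sel iexp_add by (simp add: a_def b_def)
    moreover have "c * cnj d / 2 * iexp (Re ((z - y) * w)) = a * cnj b / 2"
      unfolding left_diff_distrib minus_complex.sel iexp_diff by (simp add: a_def b_def)
    moreover have "Re a * Re b = Re (a * b / 2) + Re (a * cnj b / 2)"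
      by (simp add: field_simps)
    ultimately show ?thesis
      unfolding a_def b_def by (simp only:)
  qed
  then show ?case
    by (simp only:) (intro trig_function.intros)
next
  case (add p q)
  have "trig_function (\<lambda>w. Re (c * iexp (Re (z * w))) * p w + Re (c * iexp (Re (z * w))) * q w)"
    by (intro trig_function.add add.IH)
  then show ?case
    by (simp only: distrib_left)
qed

lemma trig_function_mult:
  assumes "trig_function p" "trig_function q"
  shows "trig_function (\<lambda>w. p w * q w)"
  using assms
proof (induction rule: trig_function.induct)
  case (base c z)
  then show ?case by (rule trig_function_base_mult)
next
  case (add p p')
  have "trig_function (\<lambda>w. p w * q w + p' w * q w)"
    by (intro trig_function.add add.IH add.prems)
  then show ?case
    by (simp only: distrib_right)
qed

lemma trig_function_const: "trig_function (\<lambda>_. c)"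
  using trig_function.base[of "of_real c" 0] by simp

lemma trig_function_continuous: "trig_function p \<Longrightarrow> continuous_on S p"
  by (induction rule: trig_function.induct) (auto intro!: continuous_intros)

lemma trig_function_bounded: "trig_function p \<Longrightarrow> \<exists>B. \<forall>w. \<bar>p w\<bar> \<le> B"
proof (induction rule: trig_function.induct)
  case (base c z)
  have "\<bar>Re (c * iexp (Re (z * w)))\<bar> \<le> norm c" for w
    using abs_Re_le_cmod[of "c * iexp (Re (z * w))"] by (simp add: norm_mult)
  then show ?case by blast
next
  case (add p q)
  then obtain B B' where "\<And>w. \<bar>p w\<bar> \<le> B" "\<And>w. \<bar>q w\<bar> \<le> B'" by blast
  then have "\<bar>p w + q w\<bar> \<le> B + B'" for w
    by (meson abs_triangle_ineq add_mono order_trans)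
  then show ?case by blast
qed

lemma trig_function_polynomial:
  assumes "real_polynomial_function (q :: real \<Rightarrow> real)" and "trig_function p"
  shows "trig_function (\<lambda>w. q (p w))"
  using assms(1)
proof induction
  case (linear h)
  then obtain c where "h = (\<lambda>x. x * c)"
    by (auto simp: real_bounded_linear)
  then show ?case
    using trig_function_mult[OF assms(2) trig_function_const[of c]] by simp
next
  case (const c)
  then show ?case by (rule trig_function_const)
next
  case (add f g)
  then show ?case by (intro trig_function.add)
next
  case (mult f g)
  then show ?case by (intro trig_function_mult)
qed

text \<open>
  Stone-Weierstrass approximates only on the compact set. The global bound by \<open>B + e\<close>, needed to
  neglect the complement of \<open>K\<close>, comes from composing the approximation with a polynomial which is
  close to the truncation at \<open>\<plusminus>B\<close> on the whole range of the approximation.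
\<close>

lemma trig_function_approximation:
  assumes "compact K" and "continuous_on UNIV \<phi>" and B: "\<And>w. \<bar>\<phi> w\<bar> \<le> B" and "e > 0"
  obtains p where "trig_function p" "\<And>w. \<bar>p w\<bar> \<le> B + e" "\<And>w. w \<in> K \<Longrightarrow> \<bar>\<phi> w - p w\<bar> < e"
proof -
  \<comment> \<open>A frequency for which the phases at the two points differ by exactly one radian.\<close>
  have sep: "\<exists>p. trig_function p \<and> p x \<noteq> p y" if "x \<noteq> y" for x y
  proof -
    define z where "z = cnj (x - y) / of_real ((cmod (x - y))\<^sup>2)"
    have "z * (x - y) = 1"
      using that complex_norm_square[of "x - y"] by (simp add: z_def mult.commute)
    then have "Re (z * x) = Re (z * y) + 1"
      by (simp add: algebra_simps complex_eq_iff)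
    then have "iexp (Re (z * x)) = iexp (Re (z * y)) * iexp 1"
      unfolding iexp_add[symmetric] by (simp only:)
    moreover have "iexp 1 \<noteq> 1"
    proof
      assume "iexp 1 = 1"
      then obtain n :: int where "1 = of_int (2 * n) * pi"
        by (auto simp: exp_eq_1)
      then have eq: "1 = 2 * real_of_int n * pi" by simp
      have "pi > 3" using pi_gt3 .
      show False
      proof (cases "n \<le> 0")
        case True
        then have "2 * real_of_int n * pi \<le> 0" by (simp add: mult_le_0_iff)
        then show False using eq by linarith
      next
        case False
        then have "real_of_int n \<ge> 1" by simp
        then have "real_of_int n * pi \<ge> 1 * pi" by (intro mult_right_mono) auto
        then show False using eq \<open>pi > 3\<close> by linarith
      qed
    qed
    ultimately have ne: "iexp (Re (z * x)) \<noteq> iexp (Re (z * y))"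
      by (metis exp_not_eq_zero mult_cancel_left1)
    show ?thesis
    proof (cases "Re (iexp (Re (z * x))) = Re (iexp (Re (z * y)))")
      case False
      then show ?thesis
        using trig_function.base[of 1 z] by (intro exI[of _ "\<lambda>w. Re (1 * iexp (Re (z * w)))"]) simp
    next
      case True
      then have "Im (iexp (Re (z * x))) \<noteq> Im (iexp (Re (z * y)))"
        using ne complex_eqI by blast
      then show ?thesis
        using trig_function.base[of \<i> z] by (intro exI[of _ "\<lambda>w. Re (\<i> * iexp (Re (z * w)))"]) simp
    qed
  qed
  have "continuous_on K \<phi>"
    using assms(2) continuous_on_subset by blast
  then have "\<exists>g. trig_function g \<and> (\<forall>w\<in>K. \<bar>\<phi> w - g w\<bar> < e / 2)"
    using sep \<open>e > 0\<close>
    by (intro Stone_Weierstrass_HOL assms(1))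
       (auto intro: trig_function_const trig_function_continuous trig_function.add trig_function_mult)
  then obtain g where g: "trig_function g" "\<And>w. w \<in> K \<Longrightarrow> \<bar>\<phi> w - g w\<bar> < e / 2"
    by blast
  obtain R where R: "\<And>w. \<bar>g w\<bar> \<le> R"
    using trig_function_bounded[OF g(1)] by blast
  define clamp where "clamp = (\<lambda>x::real. max (- B) (min B x))"
  have "continuous_on {-R..R} clamp"
    unfolding clamp_def by (intro continuous_intros)
  then obtain q where q: "real_polynomial_function q" "\<And>x. x \<in> {-R..R} \<Longrightarrow> \<bar>clamp x - q x\<bar> < e / 2"
    using Stone_Weierstrass_real_polynomial_function[of "{-R..R}" clamp "e / 2"] \<open>e > 0\<close> by auto
  have B0: "B \<ge> 0"
    using B[of 0] by linarith
  have close: "\<bar>clamp (g w) - q (g w)\<bar> < e / 2" for w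
    using R[of w] by (intro q(2)) auto
  show ?thesis
  proof (rule that[of "\<lambda>w. q (g w)"])
    show "trig_function (\<lambda>w. q (g w))"
      using q(1) g(1) by (rule trig_function_polynomial)
    show "\<bar>q (g w)\<bar> \<le> B + e" for w
      using close[of w] B0 \<open>e > 0\<close> unfolding clamp_def by linarith
    show "\<bar>\<phi> w - q (g w)\<bar> < e" if "w \<in> K" for w
      using close[of w] g(2)[OF that] B[of w] unfolding clamp_def by linarith
  qed
qed

text \<open>
  A characteristic function on the plane contains those of all one-dimensional marginals, so the
  continuity theorem on the line applies to each coordinate; this gives tightness.
\<close>

lemma marginal_convergence:
  fixes M :: "nat \<Rightarrow> complex measure" and \<nu> :: "complex measure" and l :: "complex \<Rightarrow> real"
  assumes M: "\<And>n. prob_space (M n)" "\<And>n. sets (M n) = sets borel"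
    and \<nu>: "prob_space \<nu>" "sets \<nu> = sets borel"
    and conv: "\<And>z. (\<lambda>n. cchar (M n) z) \<longlonglongrightarrow> cchar \<nu> z"
    and l: "\<And>w. l w = Re (c * w)"
    and \<psi>: "continuous_on UNIV \<psi>" "\<And>x. norm (\<psi> x :: real) \<le> B"
  shows "(\<lambda>n. LINT w|M n. \<psi> (l w)) \<longlonglongrightarrow> (LINT w|\<nu>. \<psi> (l w))"
proof -
  have l_borel: "l \<in> borel_measurable borel"
    unfolding l[abs_def] by (intro borel_measurable_continuous_onI continuous_intros)
  have dist: "real_distribution (distr N borel l)" and "char (distr N borel l) t = cchar N (of_real t * c)"
    and int: "(LINT x|distr N borel l. \<psi> x) = (LINT w|N. \<psi> (l w))"
    if "prob_space N" "sets N = sets borel" for N t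
  proof -
    have [measurable]: "l \<in> borel_measurable N"
      using l_borel that(2) measurable_cong_sets by blast
    show "real_distribution (distr N borel l)"
      using that by (intro prob_space.real_distribution_distr) auto
    have [measurable]: "\<psi> \<in> borel_measurable borel"
      using \<psi>(1) by (rule borel_measurable_continuous_onI)
    show "char (distr N borel l) t = cchar N (of_real t * c)"
      by (simp add: char_def cchar_def integral_distr l algebra_simps)
    show "(LINT x|distr N borel l. \<psi> x) = (LINT w|N. \<psi> (l w))"
      by (simp add: integral_distr)
  qed
  note dists = this
  have "weak_conv_m (\<lambda>n. distr (M n) borel l) (distr \<nu> borel l)"
    using dists M \<nu> conv by (intro levy_continuity) auto
  then have "(\<lambda>n. LINT x|distr (M n) borel l. \<psi> x) \<longlonglongrightarrow> (LINT x|distr \<nu> borel l. \<psi> x)"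
    using dists(1) M \<nu> \<psi>
    by (intro weak_conv_imp_integral_bdd_continuous_conv[of _ _ _ B])
       (auto simp: continuous_on_eq_continuous_at)
  then show ?thesis
    using dists(3) M \<nu> by simp
qed

lemma tail_integral_small:
  fixes \<nu> :: "complex measure" and l :: "complex \<Rightarrow> real"
  assumes \<nu>: "prob_space \<nu>" "sets \<nu> = sets borel" and l: "continuous_on UNIV l" and "e > 0"
  shows "\<exists>R\<ge>0. \<forall>R'\<ge>R. (LINT w|\<nu>. max 0 (min 1 (\<bar>l w\<bar> - R'))) < e"
proof -
  interpret prob_space \<nu> by fact
  define tail where "tail = (\<lambda>R w. max 0 (min 1 (\<bar>l w\<bar> - R)))"
  have cont: "continuous_on UNIV (tail R)" for R
    unfolding tail_def by (intro continuous_intros l)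
  have int: "integrable \<nu> (tail R)" for R
    using \<nu> cont by (intro integrable_bounded_continuous[of _ _ 1]) (auto simp: tail_def)
  have "(\<lambda>n. LINT w|\<nu>. tail (real n) w) \<longlonglongrightarrow> (LINT w|\<nu>. 0)"
  proof (rule integral_dominated_convergence[of _ _ _ "\<lambda>_. 1"])
    show "AE w in \<nu>. (\<lambda>n. tail (real n) w) \<longlonglongrightarrow> 0"
    proof (rule AE_I2)
      fix w
      obtain n0 where "\<bar>l w\<bar> \<le> real n0"
        using real_arch_simple by blast
      then have "\<forall>n\<ge>n0. tail (real n) w = 0"
        by (auto simp: tail_def)
      then show "(\<lambda>n. tail (real n) w) \<longlonglongrightarrow> 0"
        by (intro tendsto_eventually) (auto simp: eventually_sequentially)
    qed
    show "AE w in \<nu>. norm (tail (real n) w) \<le> 1" for n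
      by (auto simp: tail_def)
  qed (use int in auto)
  then have "(\<lambda>n. LINT w|\<nu>. tail (real n) w) \<longlonglongrightarrow> 0"
    by simp
  then have "\<forall>\<^sub>F n in sequentially. (LINT w|\<nu>. tail (real n) w) < e"
    using \<open>e > 0\<close> by (rule order_tendstoD)
  then obtain n where n: "(LINT w|\<nu>. tail (real n) w) < e"
    by (auto simp: eventually_sequentially)
  have "(LINT w|\<nu>. tail R w) < e" if "R \<ge> real n" for R
    using n integral_mono[OF int[of R] int[of "real n"]] that by (force simp: tail_def)
  then show ?thesis
    unfolding tail_def by (intro exI[of _ "real n"]) auto
qed

text \<open>
  On a large square the test function is close to a trigonometric polynomial. Off the square
  both are bounded, and the mass there is controlled by the two marginals.
\<close>

theorem weakly_converges_if_cchar_converges: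
  fixes M :: "nat \<Rightarrow> complex measure" and \<nu> :: "complex measure"
  assumes M: "\<And>n. prob_space (M n)" "\<And>n. sets (M n) = sets borel"
    and \<nu>: "prob_space \<nu>" "sets \<nu> = sets borel"
    and conv: "\<And>z. (\<lambda>n. cchar (M n) z) \<longlonglongrightarrow> cchar \<nu> z"
  shows "weakly_converges M \<nu>"
  unfolding weakly_converges_def
proof (intro allI impI)
  fix \<phi> :: "complex \<Rightarrow> real"
  assume "continuous_on UNIV \<phi> \<and> bounded (range \<phi>)"
  then obtain B where cont: "continuous_on UNIV \<phi>" and B: "\<And>w. \<bar>\<phi> w\<bar> \<le> B"
    by (auto simp: bounded_iff)
  have B0: "B \<ge> 0"
    using B[of 0] by linarith
  have trig_conv: "(\<lambda>n. LINT w|M n. p w) \<longlonglongrightarrow> (LINT w|\<nu>. p w)" if "trig_function p" for p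
    using that
  proof induction
    case (base c z)
    have "(LINT w|N. Re (c * iexp (Re (z * w)))) = Re (c * cchar N z)"
      if "prob_space N" "sets N = sets borel" for N
    proof -
      have "integrable N (\<lambda>w. c * iexp (Re (z * w)))"
        using that by (intro integrable_bounded_continuous[of _ _ "norm c"])
          (auto simp: norm_mult intro!: continuous_intros)
      from integral_Re[OF this] show ?thesis
        by (simp only: cchar_def integral_mult_right_zero)
    qed
    then show ?case
      using M \<nu> conv by (simp add: tendsto_intros)
  next
    case (add p q)
    have int: "integrable N h" if "trig_function h" "prob_space N" "sets N = sets borel" for N h
      using trig_function_bounded[OF that(1)] trig_function_continuous[OF that(1), of UNIV]
        integrable_bounded_continuous[OF that(2,3), of h] unfolding real_norm_def by blast
    show ?case
      using add M \<nu> by (simp add: int tendsto_add)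
  qed
  show "(\<lambda>n. LINT w|M n. \<phi> w) \<longlonglongrightarrow> (LINT w|\<nu>. \<phi> w)"
  proof (rule LIMSEQ_I)
    fix e :: real assume "e > 0"
    define d where "d = min 1 (e / (8 * B + 20))"
    have d: "d > 0" "d \<le> 1" "d * (8 * B + 20) \<le> e"
    proof -
      have pos: "8 * B + 20 > 0"
        using B0 by simp
      then show "d > 0" "d \<le> 1"
        using \<open>e > 0\<close> by (auto simp: d_def)
      have "d \<le> e / (8 * B + 20)"
        by (simp add: d_def)
      then show "d * (8 * B + 20) \<le> e"
        using pos by (simp add: pos_le_divide_eq)
    qed
    obtain R1 R2 where R12: "R1 \<ge> 0" "R2 \<ge> 0"
      "\<And>R. R \<ge> R1 \<Longrightarrow> (LINT w|\<nu>. max 0 (min 1 (\<bar>Re w\<bar> - R))) < d"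
      "\<And>R. R \<ge> R2 \<Longrightarrow> (LINT w|\<nu>. max 0 (min 1 (\<bar>Im w\<bar> - R))) < d"
      using tail_integral_small[OF \<nu> continuous_on_Re[OF continuous_on_id] \<open>d > 0\<close>]
        tail_integral_small[OF \<nu> continuous_on_Im[OF continuous_on_id] \<open>d > 0\<close>] by auto
    define R where "R = max R1 R2"
    define t1 t2 where "t1 = (\<lambda>w. max 0 (min 1 (\<bar>Re w\<bar> - R)))" and "t2 = (\<lambda>w. max 0 (min 1 (\<bar>Im w\<bar> - R)))"
    have small: "(LINT w|\<nu>. t1 w) < d" "(LINT w|\<nu>. t2 w) < d"
      using R12 by (auto simp: t1_def t2_def R_def)
    have tail_cont: "continuous_on UNIV (\<lambda>x::real. max 0 (min 1 (\<bar>x\<bar> - R)))"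
      by (intro continuous_intros)
    have t_conv: "(\<lambda>n. LINT w|M n. t1 w) \<longlonglongrightarrow> (LINT w|\<nu>. t1 w)" "(\<lambda>n. LINT w|M n. t2 w) \<longlonglongrightarrow> (LINT w|\<nu>. t2 w)"
      unfolding t1_def t2_def
      using tail_cont marginal_convergence[OF M \<nu> conv, of Re 1 "\<lambda>x. max 0 (min 1 (\<bar>x\<bar> - R))" 1]
        marginal_convergence[OF M \<nu> conv, of Im "- \<i>" "\<lambda>x. max 0 (min 1 (\<bar>x\<bar> - R))" 1]
      by auto
    define K where "K = cbox (Complex (- (R + 1)) (- (R + 1))) (Complex (R + 1) (R + 1))"
    have "compact K"
      unfolding K_def by (rule compact_cbox)
    obtain p where p: "trig_function p" "\<And>w. \<bar>p w\<bar> \<le> B + d" "\<And>w. w \<in> K \<Longrightarrow> \<bar>\<phi> w - p w\<bar> < d"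
      using trig_function_approximation[OF \<open>compact K\<close> cont B \<open>d > 0\<close>] by blast
    have ptw: "\<bar>\<phi> w - p w\<bar> \<le> d + (2 * B + 1) * (t1 w + t2 w)" for w
    proof (cases "w \<in> K")
      case True
      have "t1 w \<ge> 0" "t2 w \<ge> 0"
        by (auto simp: t1_def t2_def)
      then have "(2 * B + 1) * (t1 w + t2 w) \<ge> 0"
        using B0 by simp
      then show ?thesis
        using p(3)[OF True] by linarith
    next
      case False
      then have "\<bar>Re w\<bar> > R + 1 \<or> \<bar>Im w\<bar> > R + 1"
        by (auto simp: K_def in_cbox_complex_iff)
      then have "t1 w = 1 \<or> t2 w = 1" "t1 w \<ge> 0" "t2 w \<ge> 0"
        by (auto simp: t1_def t2_def)
      then have "t1 w + t2 w \<ge> 1"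
        by auto
      then have "(2 * B + 1) * 1 \<le> (2 * B + 1) * (t1 w + t2 w)"
        using B0 by (intro mult_left_mono) auto
      moreover have "\<bar>\<phi> w - p w\<bar> \<le> 2 * B + d"
        using B[of w] p(2)[of w] by linarith
      moreover have "d > 0"
        by fact
      ultimately show ?thesis
        using B0 mult_1_right[of "2 * B + 1"] by linarith
    qed
    have approx: "\<bar>(LINT w|N. \<phi> w) - (LINT w|N. p w)\<bar>
        \<le> d + (2 * B + 1) * ((LINT w|N. t1 w) + (LINT w|N. t2 w))"
      if N: "prob_space N" "sets N = sets borel" for N
    proof -
      interpret N: prob_space N by fact
      have i1: "integrable N \<phi>" "integrable N p"
        using integrable_bounded_continuous[OF N cont] integrable_bounded_continuous[OF N trig_function_continuous[OF p(1)]]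
          B p(2) by auto
      have i2: "integrable N t1" "integrable N t2"
        unfolding t1_def t2_def
        by (rule integrable_bounded_continuous[OF N, of _ 1]; auto intro!: continuous_intros)+
      have "\<bar>(LINT w|N. \<phi> w) - (LINT w|N. p w)\<bar> = \<bar>LINT w|N. \<phi> w - p w\<bar>"
        using i1 by simp
      also have "\<dots> \<le> (LINT w|N. \<bar>\<phi> w - p w\<bar>)"
        by (rule integral_abs_bound)
      also have "\<dots> \<le> (LINT w|N. d + (2 * B + 1) * (t1 w + t2 w))"
        using i1 i2 ptw by (intro integral_mono) auto
      also have "\<dots> = d + (2 * B + 1) * ((LINT w|N. t1 w) + (LINT w|N. t2 w))"
        using i2 by (simp add: N.prob_space)
      finally show ?thesis .
    qed
    have ev: "\<forall>\<^sub>F n in sequentially. \<bar>(LINT w|M n. p w) - (LINT w|\<nu>. p w)\<bar> < d"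
      "\<forall>\<^sub>F n in sequentially. (LINT w|M n. t1 w) < d" "\<forall>\<^sub>F n in sequentially. (LINT w|M n. t2 w) < d"
      using tendstoD[OF trig_conv[OF p(1)] \<open>d > 0\<close>] order_tendstoD(2)[OF t_conv(1) small(1)]
        order_tendstoD(2)[OF t_conv(2) small(2)] by (simp_all add: dist_real_def)
    have "\<forall>\<^sub>F n in sequentially. norm ((LINT w|M n. \<phi> w) - (LINT w|\<nu>. \<phi> w)) < e"
      using ev
    proof eventually_elim
      case (elim n)
      have "(2 * B + 1) * ((LINT w|M n. t1 w) + (LINT w|M n. t2 w)) \<le> (2 * B + 1) * (2 * d)"
        using elim B0 by (intro mult_left_mono) auto
      moreover have "(2 * B + 1) * ((LINT w|\<nu>. t1 w) + (LINT w|\<nu>. t2 w)) \<le> (2 * B + 1) * (2 * d)"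
        using small B0 by (intro mult_left_mono) auto
      ultimately have "\<bar>(LINT w|M n. \<phi> w) - (LINT w|\<nu>. \<phi> w)\<bar> < 2 * d + 2 * ((2 * B + 1) * (2 * d)) + d"
        using approx[OF M(1)[of n] M(2)[of n]] approx[OF \<nu>] elim(1) by linarith
      also have "\<dots> \<le> e"
        using d(1,3) by (simp add: algebra_simps)
      finally show ?case by simp
    qed
    then show "\<exists>no. \<forall>n\<ge>no. norm ((LINT w|M n. \<phi> w) - (LINT w|\<nu>. \<phi> w)) < e"
      by (simp add: eventually_sequentially)
  qed
qed

section \<open>Characteristic functions of the normal limit laws and of uniform laws\<close>

lemma prob_space_centered_normal: "prob_space (centered_normal v)" if "v \<ge> 0"
  using that prob_space_normal_density[of "sqrt v" 0]
  by (auto simp: centered_normal_def intro!: prob_space_return)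

lemma sets_centered_normal [simp, measurable_cong]: "sets (centered_normal v) = sets borel"
  by (simp add: centered_normal_def)

text \<open>
  The formula covers the degenerate law at 0 as well, which occurs as a limit when the
  variance vanishes.
\<close>

lemma char_centered_normal:
  assumes "v \<ge> 0"
  shows "char (centered_normal v) t = exp (of_real (- v * t\<^sup>2 / 2))"
proof (cases "v = 0")
  case True
  then show ?thesis
    by (simp add: char_def centered_normal_def integral_return)
next
  case False
  define s where "s = sqrt v"
  have s: "s > 0" "s\<^sup>2 = v"
    using assms False by (auto simp: s_def)
  have "char (centered_normal v) t = (CLINT x|lborel. normal_density 0 s x *\<^sub>R iexp (t * x))"
    using False by (simp add: char_def centered_normal_def s_def[symmetric] integral_density)
  also have "\<dots> = \<bar>s\<bar> *\<^sub>R (CLINT x|lborel. normal_density 0 s (0 + s * x) *\<^sub>R iexp (t * (0 + s * x)))"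
    using s by (intro lborel_integral_real_affine) auto
  also have "\<dots> = (CLINT x|lborel. std_normal_density x *\<^sub>R iexp (t * s * x))"
  proof -
    have "\<bar>s\<bar> * normal_density 0 s (0 + s * x) = std_normal_density x" for x
      using s by (simp add: normal_density_def real_sqrt_mult power_mult_distrib flip: s(2))
    then show ?thesis
      by (simp add: integral_scaleR_right[symmetric] mult.assoc del: integral_scaleR_right)
  qed
  also have "\<dots> = char std_normal_distribution (t * s)"
    by (simp add: char_def integral_density)
  also have "\<dots> = exp (of_real (- v * t\<^sup>2 / 2))"
    using s by (simp add: char_std_normal_distribution power_mult_distrib mult.commute flip: exp_of_real of_real_power)
  finally show ?thesis .
qed

lemma limit_law_prob_space:
  assumes "v \<ge> 0"
  shows "prob_space (limit_law \<mu> v)" "sets (limit_law \<mu> v) = sets borel"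
proof -
  interpret P: prob_space "centered_normal v"
    using assms by (rule prob_space_centered_normal)
  interpret Q: prob_space "centered_normal (v / 2)"
    using assms by (intro prob_space_centered_normal) simp
  interpret QQ: pair_prob_space "centered_normal (v / 2)" "centered_normal (v / 2)" ..
  have m: "(\<lambda>(x, y). Complex x y) \<in> borel_measurable (borel \<Otimes>\<^sub>M borel)"
    unfolding borel_prod split_beta
    by (intro borel_measurable_continuous_onI) (auto simp: Complex_eq intro!: continuous_intros)
  show "sets (limit_law \<mu> v) = sets borel"
    by (simp add: limit_law_def)
  show "prob_space (limit_law \<mu> v)"
  proof (cases "\<mu> \<in> \<real>")
    case True
    then show ?thesis
      unfolding limit_law_def by (simp add: P.prob_space_distr)
  next
    case False
    have "(\<lambda>(x, y). Complex x y) \<in> borel_measurable (centered_normal (v / 2) \<Otimes>\<^sub>M centered_normal (v / 2))"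
      using m by (simp cong: measurable_cong_sets)
    then show ?thesis
      using False unfolding limit_law_def by (simp add: QQ.prob_space_distr)
  qed
qed

lemma cchar_limit_law_real:
  assumes "v \<ge> 0" and "\<mu> \<in> \<real>"
  shows "cchar (limit_law \<mu> v) z = exp (of_real (- v * (Re z)\<^sup>2 / 2))"
proof -
  have "cchar (limit_law \<mu> v) z = char (centered_normal v) (Re z)"
    using assms(2) by (simp add: cchar_def limit_law_def char_def integral_distr)
  then show ?thesis
    using char_centered_normal[OF assms(1)] by simp
qed

lemma cchar_limit_law_nonreal:
  assumes "v \<ge> 0" and "\<mu> \<notin> \<real>"
  shows "cchar (limit_law \<mu> v) z = exp (of_real (- v * (cmod z)\<^sup>2 / 4))"
proof -
  let ?N = "centered_normal (v / 2)"
  interpret Q: prob_space ?N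
    using assms by (intro prob_space_centered_normal) simp
  interpret QQ: pair_prob_space ?N ?N ..
  have m [measurable]: "(\<lambda>(x, y). Complex x y) \<in> borel_measurable (borel \<Otimes>\<^sub>M borel)"
    unfolding borel_prod split_beta
    by (intro borel_measurable_continuous_onI) (auto simp: Complex_eq intro!: continuous_intros)
  have split: "iexp (Re (z * Complex x y)) = iexp (Re z * x) * iexp (- Im z * y)" for x y
    unfolding iexp_add[symmetric] by simp
  have "cchar (limit_law \<mu> v) z = (CLINT p|?N \<Otimes>\<^sub>M ?N. iexp (Re (z * (case p of (x, y) \<Rightarrow> Complex x y))))"
    using assms(2) unfolding cchar_def limit_law_def by (simp add: integral_distr)
  also have "\<dots> = (CLINT p|?N \<Otimes>\<^sub>M ?N. (\<lambda>(x, y). iexp (Re z * x) * iexp (- Im z * y)) p)"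
    by (intro Bochner_Integration.integral_cong refl) (auto simp only: split split_beta fst_conv snd_conv)
  also have "\<dots> = (CLINT x|?N. CLINT y|?N. iexp (Re z * x) * iexp (- Im z * y))"
  proof (rule QQ.integral_fst[symmetric])
    show "integrable (?N \<Otimes>\<^sub>M ?N) (\<lambda>(x, y). iexp (Re z * x) * iexp (- Im z * y))"
      by (rule QQ.integrable_const_bound[of _ 1]) (auto simp: norm_mult split_beta)
  qed
  also have "\<dots> = char ?N (Re z) * char ?N (- Im z)"
    by (simp add: char_def)
  also have "\<dots> = exp (of_real (- (v / 2) * (Re z)\<^sup>2 / 2)) * exp (of_real (- (v / 2) * (- Im z)\<^sup>2 / 2))"
    using assms(1) char_centered_normal[of "v / 2"] by simp
  also have "\<dots> = exp (of_real (- v * (cmod z)\<^sup>2 / 4))"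
    unfolding exp_add[symmetric] of_real_add[symmetric] cmod_power2
    by (simp add: field_simps)
  finally show ?thesis .
qed

lemma prob_space_uniform_law: "prob_space (uniform_law N Y)"
  and sets_uniform_law [simp]: "sets (uniform_law N Y) = sets borel"
  by (auto simp: uniform_law_def intro!: prob_space.prob_space_distr measure_pmf.prob_space_axioms)

lemma cchar_uniform_law:
  assumes "N \<ge> 1"
  shows "cchar (uniform_law N Y) z = (\<Sum>k\<in>{1..N}. iexp (Re (z * Y k))) / of_nat N"
  using assms unfolding cchar_def uniform_law_def
proof (subst integral_distr)
  show "(CLINT k|measure_pmf (pmf_of_set {1..N}). iexp (Re (z * Y k))) = (\<Sum>k\<in>{1..N}. iexp (Re (z * Y k))) / of_nat N"
    unfolding sum_divide_distrib using assms
    by (subst integral_measure_pmf[of "{1..N}"])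
       (auto simp: scaleR_conv_of_real divide_inverse simp del: times_complex.sel intro!: sum.cong)
qed auto

section \<open>The descending chain and its Poisson equations\<close>

lemma sum_list_map_count_list:
  fixes h :: "'a::finite \<Rightarrow> 'b::comm_semiring_1"
  shows "sum_list (map h w) = (\<Sum>b\<in>UNIV. of_nat (count_list w b) * h b)"
proof (induction w)
  case (Cons a w)
  have "(\<Sum>b\<in>UNIV. of_nat (count_list (a # w) b) * h b)
      = (\<Sum>b\<in>UNIV. (if b = a then h b else 0) + of_nat (count_list w b) * h b)"
    by (intro sum.cong) (auto simp: algebra_simps)
  then show ?case
    by (simp add: sum.distrib sum.delta Cons.IH)
qed simp

lemma sum_nth_count_list:
  fixes h :: "'a::finite \<Rightarrow> 'b::comm_semiring_1"
  shows "(\<Sum>k<length w. h (w ! k)) = (\<Sum>b\<in>UNIV. of_nat (count_list w b) * h b)"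
  using sum_list_map_count_list[of h w] sum_list_sum_nth[of "map h w"]
  by (simp add: atLeast0LessThan)

text \<open>
  The positive left and right eigenvectors provide the transition probabilities and the
  stationary law of the descending chain.
\<close>

locale pf_substitution =
  fixes \<theta> :: "'a::finite \<Rightarrow> 'a list" and lam :: real and \<rho> \<sigma> :: "real^'a"
  assumes primitive: "primitive_subst \<theta>"
    and lam_gt_1: "lam > 1"
    and rho_pos: "\<And>a. \<rho> $ a > 0"
    and right_eigen: "subst_matrix \<theta> *v \<rho> = lam *s \<rho>"
    and sigma_pos: "\<And>a. \<sigma> $ a > 0"
    and left_eigen: "\<sigma> v* subst_matrix \<theta> = lam *s \<sigma>"
    and normalized: "(\<Sum>a\<in>UNIV. \<sigma> $ a * \<rho> $ a) = 1"
begin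

lemma lam_pos: "lam > 0"
  using lam_gt_1 by simp

text \<open>
  The \<open>k\<close>-th letter of \<open>\<theta> a\<close>, counted from 0, is chosen with the asymptotic proportion of
  \<open>\<theta>\<^sup>n a\<close> that its descendants occupy.
\<close>

definition child_prob :: "'a \<Rightarrow> nat \<Rightarrow> real" where
  "child_prob a k = \<sigma> $ (\<theta> a ! k) / (lam * \<sigma> $ a)"

definition child_mean :: "'a \<Rightarrow> (nat \<Rightarrow> complex) \<Rightarrow> complex" where
  "child_mean a h = (\<Sum>k<length (\<theta> a). of_real (child_prob a k) * h k)"

definition step_mean :: "('a \<Rightarrow> complex) \<Rightarrow> 'a \<Rightarrow> complex" where
  "step_mean \<psi> a = child_mean a (\<lambda>k. \<psi> (\<theta> a ! k))"

definition stat_mean :: "('a \<Rightarrow> complex) \<Rightarrow> complex" where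
  "stat_mean \<psi> = (\<Sum>a\<in>UNIV. of_real (\<sigma> $ a * \<rho> $ a) * \<psi> a)"

lemma step_mean_eq: "step_mean \<psi> a = (\<Sum>k<length (\<theta> a). of_real (child_prob a k) * \<psi> (\<theta> a ! k))"
  by (simp add: step_mean_def child_mean_def)

lemma sum_sigma_children: "(\<Sum>k<length (\<theta> a). \<sigma> $ (\<theta> a ! k)) = lam * \<sigma> $ a"
proof -
  have "(\<sigma> v* subst_matrix \<theta>) $ a = lam * \<sigma> $ a"
    by (simp add: left_eigen)
  then show ?thesis
    by (simp add: sum_nth_count_list[where h = "\<lambda>b. \<sigma> $ b"] vector_matrix_mult_def subst_matrix_def mult.commute)
qed

lemma sum_rho_parents: "(\<Sum>b\<in>UNIV. real (count_list (\<theta> b) a) * \<rho> $ b) = lam * \<rho> $ a"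
proof -
  have "(subst_matrix \<theta> *v \<rho>) $ a = lam * \<rho> $ a"
    by (simp add: right_eigen)
  then show ?thesis
    by (simp add: matrix_vector_mult_def subst_matrix_def)
qed

lemma child_prob_nonneg: "child_prob a k \<ge> 0"
  using sigma_pos lam_pos by (simp add: child_prob_def less_imp_le)

lemma sum_child_prob: "(\<Sum>k<length (\<theta> a). child_prob a k) = 1"
  using sigma_pos[of a] lam_pos
  by (simp add: child_prob_def sum_divide_distrib[symmetric] sum_sigma_children)

lemma subst_nonempty: "\<theta> a \<noteq> []"
  using sum_child_prob[of a] by auto

lemma child_mean_bound:
  assumes "\<And>k. k < length (\<theta> a) \<Longrightarrow> norm (h k) \<le> B"
  shows "norm (child_mean a h) \<le> B"
proof -
  have "norm (child_mean a h) \<le> (\<Sum>k<length (\<theta> a). child_prob a k * B)"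
    unfolding child_mean_def
    by (rule sum_norm_le) (auto simp: norm_mult child_prob_nonneg intro!: mult_left_mono assms)
  then show ?thesis
    by (simp add: sum_distrib_right[symmetric] sum_child_prob)
qed

lemma child_mean_const [simp]: "child_mean a (\<lambda>k. c) = c"
  by (simp add: child_mean_def sum_distrib_right[symmetric] sum_child_prob flip: of_real_sum)

lemma child_mean_add: "child_mean a (\<lambda>k. h k + h' k) = child_mean a h + child_mean a h'"
  by (simp add: child_mean_def algebra_simps sum.distrib)

lemma child_mean_diff: "child_mean a (\<lambda>k. h k - h' k) = child_mean a h - child_mean a h'"
  by (simp add: child_mean_def algebra_simps sum_subtractf)

lemma child_mean_cmult: "child_mean a (\<lambda>k. c * h k) = c * child_mean a h"
  by (simp add: child_mean_def algebra_simps sum_distrib_left)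

lemma step_mean_const [simp]: "step_mean (\<lambda>a. c) = (\<lambda>a. c)"
  by (simp add: step_mean_def fun_eq_iff)

lemma step_mean_power_const [simp]: "(step_mean ^^ n) (\<lambda>a. c) = (\<lambda>a. c)"
  by (induction n) auto

lemma step_mean_diff: "step_mean (\<lambda>a. \<psi> a - \<phi> a) = (\<lambda>a. step_mean \<psi> a - step_mean \<phi> a)"
  by (simp add: step_mean_def child_mean_diff fun_eq_iff)

lemma step_mean_power_diff:
  "(step_mean ^^ n) (\<lambda>a. \<psi> a - \<phi> a) = (\<lambda>a. (step_mean ^^ n) \<psi> a - (step_mean ^^ n) \<phi> a)"
  by (induction n) (auto simp: step_mean_diff)

lemma step_mean_power_bound:
  assumes "\<And>a. norm (\<psi> a) \<le> B"
  shows "norm ((step_mean ^^ n) \<psi> a) \<le> B"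
proof (induction n arbitrary: a)
  case (Suc n)
  then show ?case by (auto simp: step_mean_def intro!: child_mean_bound)
qed (use assms in auto)

lemma step_mean_matrix:
  "of_real (lam * \<sigma> $ a) * step_mean \<psi> a
     = (\<Sum>b\<in>UNIV. of_real (subst_matrix \<theta> $ b $ a * \<sigma> $ b) * \<psi> b)"
proof -
  have "of_real (lam * \<sigma> $ a) * step_mean \<psi> a
      = (\<Sum>k<length (\<theta> a). of_real (\<sigma> $ (\<theta> a ! k)) * \<psi> (\<theta> a ! k))"
    using sigma_pos[of a] lam_pos
    by (simp add: step_mean_def child_mean_def child_prob_def sum_distrib_left)
  also have "\<dots> = (\<Sum>b\<in>UNIV. of_nat (count_list (\<theta> a) b) * (of_real (\<sigma> $ b) * \<psi> b))"
    by (rule sum_nth_count_list[where h = "\<lambda>b. of_real (\<sigma> $ b) * \<psi> b"])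
  finally show ?thesis
    by (simp add: subst_matrix_def mult.assoc)
qed

text \<open>
  Conjugating the averaging operator by \<open>\<sigma>\<close> gives the transposed substitution matrix divided by \<open>lam\<close>; this
  is how primitivity enters.
\<close>

lemma step_mean_power_matrix:
  "of_real (lam ^ n * \<sigma> $ a) * (step_mean ^^ n) \<psi> a
     = (\<Sum>b\<in>UNIV. of_real (matrix_power (subst_matrix \<theta>) n $ b $ a * \<sigma> $ b) * \<psi> b)"
proof (induction n arbitrary: \<psi>)
  case 0
  have "(\<Sum>b\<in>UNIV. of_real (mat 1 $ b $ a * \<sigma> $ b) * \<psi> b)
      = (\<Sum>b\<in>UNIV. if b = a then of_real (\<sigma> $ b) * \<psi> b else 0)"
    by (intro sum.cong) (auto simp: mat_def)
  then show ?case
    by (simp add: matrix_power_def)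
next
  case (Suc n)
  let ?M = "subst_matrix \<theta>" and ?N = "matrix_power (subst_matrix \<theta>) n"
  have "of_real (lam ^ Suc n * \<sigma> $ a) * (step_mean ^^ Suc n) \<psi> a
      = of_real lam * (of_real (lam ^ n * \<sigma> $ a) * (step_mean ^^ n) (step_mean \<psi>) a)"
    by (simp add: funpow_swap1)
  also have "\<dots> = (\<Sum>b\<in>UNIV. of_real (?N $ b $ a) * (of_real (lam * \<sigma> $ b) * step_mean \<psi> b))"
    unfolding Suc.IH sum_distrib_left by (intro sum.cong) (simp_all add: mult_ac)
  also have "\<dots> = (\<Sum>b\<in>UNIV. \<Sum>c\<in>UNIV. of_real (?M $ c $ b * ?N $ b $ a * \<sigma> $ c) * \<psi> c)"
    unfolding step_mean_matrix by (simp add: sum_distrib_left mult_ac)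
  also have "\<dots> = (\<Sum>c\<in>UNIV. \<Sum>b\<in>UNIV. of_real (?M $ c $ b * ?N $ b $ a * \<sigma> $ c) * \<psi> c)"
    by (rule sum.swap)
  also have "\<dots> = (\<Sum>c\<in>UNIV. of_real (matrix_power ?M (Suc n) $ c $ a * \<sigma> $ c) * \<psi> c)"
    by (simp add: matrix_power_def matrix_matrix_mult_def sum_distrib_right)
  finally show ?case .
qed

lemma stat_mean_step: "stat_mean (step_mean \<psi>) = stat_mean \<psi>"
proof -
  have "of_real lam * stat_mean (step_mean \<psi>)
      = (\<Sum>a\<in>UNIV. of_real (\<rho> $ a) * (of_real (lam * \<sigma> $ a) * step_mean \<psi> a))"
    by (simp add: stat_mean_def sum_distrib_left mult_ac)
  also have "\<dots> = (\<Sum>a\<in>UNIV. \<Sum>b\<in>UNIV. of_real (\<rho> $ a * subst_matrix \<theta> $ b $ a * \<sigma> $ b) * \<psi> b)"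
    unfolding step_mean_matrix by (simp add: sum_distrib_left mult_ac)
  also have "\<dots> = (\<Sum>b\<in>UNIV. \<Sum>a\<in>UNIV. of_real (\<rho> $ a * subst_matrix \<theta> $ b $ a * \<sigma> $ b) * \<psi> b)"
    by (rule sum.swap)
  also have "\<dots> = (\<Sum>b\<in>UNIV. of_real ((\<Sum>a\<in>UNIV. real (count_list (\<theta> a) b) * \<rho> $ a) * \<sigma> $ b) * \<psi> b)"
    unfolding of_real_mult of_real_sum sum_distrib_right
    by (intro sum.cong) (simp_all add: subst_matrix_def mult_ac)
  also have "\<dots> = of_real lam * stat_mean \<psi>"
    unfolding sum_rho_parents by (simp add: stat_mean_def sum_distrib_left mult_ac)
  finally show ?thesis
    using lam_pos by simp
qed

lemma stat_mean_step_power: "stat_mean ((step_mean ^^ n) \<psi>) = stat_mean \<psi>"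
  by (induction n) (auto simp: stat_mean_step)

lemma stat_mean_const [simp]: "stat_mean (\<lambda>a. c) = c"
  by (simp add: stat_mean_def sum_distrib_right[symmetric] normalized flip: of_real_sum of_real_mult)

lemma stat_mean_add: "stat_mean (\<lambda>a. \<psi> a + \<phi> a) = stat_mean \<psi> + stat_mean \<phi>"
  by (simp add: stat_mean_def algebra_simps sum.distrib)

lemma stat_mean_diff: "stat_mean (\<lambda>a. \<psi> a - \<phi> a) = stat_mean \<psi> - stat_mean \<phi>"
  by (simp add: stat_mean_def algebra_simps sum_subtractf)

lemma stat_mean_cmult: "stat_mean (\<lambda>a. c * \<psi> a) = c * stat_mean \<psi>"
  by (simp add: stat_mean_def algebra_simps sum_distrib_left)

lemma stat_mean_cnj: "stat_mean (\<lambda>a. cnj (\<psi> a)) = cnj (stat_mean \<psi>)"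
  by (simp add: stat_mean_def)

text \<open>
  Some power of the transition kernel has entries \<open>p a b \<ge> 2 d\<close>. Subtracting \<open>d\<close> times the
  stationary law from each row does not change the value on functions of stationary mean zero, leaves
  nonnegative entries, and lowers each row sum to \<open>1 - d\<close>.
\<close>

lemma doeblin_contraction:
  "\<exists>K>0. \<exists>r. 0 < r \<and> r < 1 \<and>
     (\<forall>\<psi> B a. stat_mean \<psi> = 0 \<and> (\<forall>b. norm (\<psi> b) \<le> B) \<longrightarrow> norm ((step_mean ^^ K) \<psi> a) \<le> r * B)"
proof -
  obtain K where K: "K > 0" and pos: "\<And>a b. 0 < matrix_power (subst_matrix \<theta>) K $ a $ b"
    using primitive by (auto simp: primitive_subst_def)
  define p where "p = (\<lambda>a b. matrix_power (subst_matrix \<theta>) K $ b $ a * \<sigma> $ b / (lam ^ K * \<sigma> $ a))"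
  have ppos: "p a b > 0" for a b
    using pos sigma_pos lam_pos by (simp add: p_def)
  have rep: "(step_mean ^^ K) \<psi> a = (\<Sum>b\<in>UNIV. of_real (p a b) * \<psi> b)" for \<psi> a
  proof -
    have "of_real (lam ^ K * \<sigma> $ a) * (step_mean ^^ K) \<psi> a
        = of_real (lam ^ K * \<sigma> $ a) * (\<Sum>b\<in>UNIV. of_real (p a b) * \<psi> b)"
      unfolding step_mean_power_matrix sum_distrib_left
      using sigma_pos[of a] lam_pos by (intro sum.cong) (simp_all add: p_def)
    then show ?thesis
      using sigma_pos[of a] lam_pos by simp
  qed
  have psum: "(\<Sum>b\<in>UNIV. p a b) = 1" for a
  proof -
    have "complex_of_real (\<Sum>b\<in>UNIV. p a b) = 1"
      using rep[of "\<lambda>_. 1" a] by simp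
    then show ?thesis
      using of_real_eq_1_iff by blast
  qed
  define d where "d = Min (range (\<lambda>(a, b). p a b)) / 2"
  have dmin: "2 * d \<le> p a b" for a b
  proof -
    have "p a b \<in> range (\<lambda>(a, b). p a b)"
      by (rule range_eqI[of _ _ "(a, b)"]) simp
    then have "Min (range (\<lambda>(a, b). p a b)) \<le> p a b"
      by (intro Min_le) auto
    then show ?thesis
      by (simp add: d_def)
  qed
  have "Min (range (\<lambda>(a, b). p a b)) \<in> range (\<lambda>(a, b). p a b)"
    by (rule Min_in) auto
  then have dpos: "d > 0"
    using ppos by (auto simp: d_def)
  have pi_le: "\<sigma> $ b * \<rho> $ b \<le> 1" for b
    using member_le_sum[of b UNIV "\<lambda>b. \<sigma> $ b * \<rho> $ b"] sigma_pos rho_pos normalized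
    by (simp add: less_imp_le)
  have p_le: "p a b \<le> 1" for a b
    using member_le_sum[of b UNIV "p a"] ppos psum[of a] by (simp add: less_imp_le)
  have d1: "d < 1"
    using dmin[of undefined undefined] p_le[of undefined undefined] dpos by linarith
  have "norm ((step_mean ^^ K) \<psi> a) \<le> (1 - d) * B"
    if m: "stat_mean \<psi> = 0" and B: "\<And>b. norm (\<psi> b) \<le> B" for \<psi> B a
  proof -
    have "(step_mean ^^ K) \<psi> a = (\<Sum>b\<in>UNIV. of_real (p a b) * \<psi> b) - of_real d * stat_mean \<psi>"
      by (simp add: rep m)
    also have "\<dots> = (\<Sum>b\<in>UNIV. of_real (p a b - d * (\<sigma> $ b * \<rho> $ b)) * \<psi> b)"
      by (simp add: stat_mean_def sum_distrib_left sum_subtractf algebra_simps)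
    also have "norm \<dots> \<le> (\<Sum>b\<in>UNIV. (p a b - d * (\<sigma> $ b * \<rho> $ b)) * B)"
    proof (rule sum_norm_le)
      fix b
      have "d * (\<sigma> $ b * \<rho> $ b) \<le> d"
        using pi_le[of b] dpos by (intro mult_left_le) auto
      then have "p a b - d * (\<sigma> $ b * \<rho> $ b) \<ge> 0"
        using dmin[of a b] dpos by linarith
      then show "norm (of_real (p a b - d * (\<sigma> $ b * \<rho> $ b)) * \<psi> b)
          \<le> (p a b - d * (\<sigma> $ b * \<rho> $ b)) * B"
        unfolding norm_mult norm_of_real using B by (simp add: mult_left_mono)
    qed
    also have "\<dots> = (1 - d) * B"
      by (simp add: sum_distrib_right[symmetric] sum_subtractf psum sum_distrib_left[symmetric] normalized)
    finally show ?thesis .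
  qed
  then show ?thesis
    using K dpos d1 by (intro exI[of _ K] conjI exI[of _ "1 - d"]) auto
qed

text \<open>
  Iterating the contraction over multiples of \<open>K\<close>; the factor \<open>C\<close> pays for the remaining fewer
  than \<open>K\<close> steps.
\<close>

lemma step_mean_geometric_decay:
  obtains C r where "C > 0" "0 < r" "r < 1"
    "\<And>\<psi> B n a. stat_mean \<psi> = 0 \<Longrightarrow> (\<And>b. norm (\<psi> b) \<le> B) \<Longrightarrow>
        norm ((step_mean ^^ n) \<psi> a) \<le> C * B * r ^ n"
proof -
  obtain K s where K: "K > 0" and s: "0 < s" "s < 1" and contr:
    "\<And>\<psi> B a. stat_mean \<psi> = 0 \<Longrightarrow> (\<And>b. norm (\<psi> b) \<le> B) \<Longrightarrow> norm ((step_mean ^^ K) \<psi> a) \<le> s * B"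
    using doeblin_contraction by metis
  define r where "r = root K s"
  have r: "0 < r" "r < 1" and rK: "r ^ K = s"
    using K s by (auto simp: r_def)
  have iter: "norm ((step_mean ^^ (K * j)) \<psi> a) \<le> s ^ j * B"
    if "stat_mean \<psi> = 0" "\<And>b. norm (\<psi> b) \<le> B" for \<psi> B j a
  proof (induction j arbitrary: a)
    case (Suc j)
    have "norm ((step_mean ^^ K) ((step_mean ^^ (K * j)) \<psi>) a) \<le> s * (s ^ j * B)"
      using Suc that by (intro contr) (auto simp: stat_mean_step_power)
    then show ?case
      by (simp add: funpow_add algebra_simps)
  qed (use that in auto)
  have "norm ((step_mean ^^ n) \<psi> a) \<le> inverse s * B * r ^ n"
    if m: "stat_mean \<psi> = 0" and B: "\<And>b. norm (\<psi> b) \<le> B" for \<psi> B n a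
  proof -
    have B0: "B \<ge> 0"
      using B[of undefined] norm_ge_zero order_trans by blast
    have "(step_mean ^^ n) \<psi> = (step_mean ^^ (n mod K)) ((step_mean ^^ (K * (n div K))) \<psi>)"
      by (simp add: funpow_add[symmetric, THEN fun_cong, unfolded o_def])
    then have "norm ((step_mean ^^ n) \<psi> a) \<le> s ^ (n div K) * B"
      using iter[OF m B] by (simp add: step_mean_power_bound)
    also have "s ^ (n div K) \<le> inverse s * r ^ n"
    proof -
      have "n \<le> K * (n div K) + K"
        using K by (metis add_le_cancel_left div_mult_mod_eq less_imp_le_nat mod_less_divisor mult.commute)
      then have "r ^ (K * (n div K) + K) \<le> r ^ n"
        using r by (intro power_decreasing) auto
      moreover have "r ^ (K * (n div K) + K) = s * s ^ (n div K)"
        by (simp add: power_add power_mult rK)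
      ultimately show ?thesis
        using s by (simp add: field_simps)
    qed
    finally show ?thesis
      using B0 by (simp add: mult_right_mono mult_ac)
  qed
  then show ?thesis
    using that[of "inverse s" r] s r by auto
qed

lemma step_mean_tendsto: "(\<lambda>n. (step_mean ^^ n) \<psi> a) \<longlonglongrightarrow> stat_mean \<psi>"
proof -
  obtain C r where *: "C > 0" "0 < r" "r < 1"
    and decay: "\<And>\<psi> B n a. stat_mean \<psi> = 0 \<Longrightarrow> (\<And>b. norm (\<psi> b) \<le> B) \<Longrightarrow>
        norm ((step_mean ^^ n) \<psi> a) \<le> C * B * r ^ n"
    by (fact step_mean_geometric_decay)
  define B where "B = Max (range (\<lambda>b. norm (\<psi> b - stat_mean \<psi>)))"
  have "norm ((step_mean ^^ n) (\<lambda>b. \<psi> b - stat_mean \<psi>) a) \<le> C * B * r ^ n" for n a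
    by (rule decay) (auto simp: stat_mean_diff B_def)
  then have "\<forall>\<^sub>F n in sequentially. norm ((step_mean ^^ n) (\<lambda>b. \<psi> b - stat_mean \<psi>) a) \<le> C * B * r ^ n"
    by simp
  moreover have "(\<lambda>n. C * B * r ^ n) \<longlonglongrightarrow> 0"
    using * by (intro tendsto_mult_right_zero LIMSEQ_power_zero) auto
  ultimately have "(\<lambda>n. (step_mean ^^ n) (\<lambda>b. \<psi> b - stat_mean \<psi>) a) \<longlonglongrightarrow> 0"
    by (rule Lim_null_comparison)
  then show ?thesis
    unfolding step_mean_power_diff step_mean_power_const by (rule LIM_zero_cancel)
qed

text \<open>
  The Neumann series for the inverse of \<open>1 - z Q\<close>, where \<open>Q\<close> is \<open>step_mean\<close>.
\<close>

definition poisson_series :: "complex \<Rightarrow> ('a \<Rightarrow> complex) \<Rightarrow> 'a \<Rightarrow> complex" where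
  "poisson_series z \<psi> a = (\<Sum>n. z ^ n * (step_mean ^^ n) \<psi> a)"

lemma summable_poisson_series:
  assumes "stat_mean \<psi> = 0" and "norm z = 1"
  shows "summable (\<lambda>n. z ^ n * (step_mean ^^ n) \<psi> a)"
proof -
  obtain C r where *: "C > 0" "0 < r" "r < 1"
    and decay: "\<And>\<psi> B n a. stat_mean \<psi> = 0 \<Longrightarrow> (\<And>b. norm (\<psi> b) \<le> B) \<Longrightarrow>
        norm ((step_mean ^^ n) \<psi> a) \<le> C * B * r ^ n"
    by (fact step_mean_geometric_decay)
  define B where "B = Max (range (\<lambda>b. norm (\<psi> b)))"
  have "norm ((step_mean ^^ n) \<psi> a) \<le> C * B * r ^ n" for n
    using assms by (intro decay) (auto simp: B_def)
  then show ?thesis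
    using * assms(2)
    by (intro summable_comparison_test'[OF summable_mult[OF summable_geometric[of r]], of 0 _ "C * B"])
       (simp_all add: norm_mult norm_power)
qed

lemma poisson_series_eq:
  assumes "stat_mean \<psi> = 0" and "norm z = 1"
  shows "poisson_series z \<psi> a - z * step_mean (poisson_series z \<psi>) a = \<psi> a"
proof -
  note summ = summable_poisson_series[OF assms]
  have "z * step_mean (poisson_series z \<psi>) a
      = (\<Sum>k<length (\<theta> a). \<Sum>n. z * of_real (child_prob a k) * (z ^ n * (step_mean ^^ n) \<psi> (\<theta> a ! k)))"
    unfolding step_mean_eq[of "poisson_series z \<psi>"] poisson_series_def sum_distrib_left mult.assoc[symmetric]
    by (intro sum.cong refl) (simp only: suminf_mult[OF summ, symmetric] mult.assoc)
  also have "\<dots> = (\<Sum>n. \<Sum>k<length (\<theta> a). z * of_real (child_prob a k) * (z ^ n * (step_mean ^^ n) \<psi> (\<theta> a ! k)))"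
    by (rule suminf_sum[symmetric]) (intro summable_mult summ)
  also have "\<dots> = (\<Sum>n. z ^ Suc n * (step_mean ^^ Suc n) \<psi> a)"
    by (simp add: step_mean_eq sum_distrib_left mult_ac)
  also have "\<dots> = poisson_series z \<psi> a - \<psi> a"
    unfolding poisson_series_def using suminf_split_head[OF summ[of a]] by simp
  finally show ?thesis by simp
qed

text \<open>
  The constant part of the right-hand side is invariant under averaging, so it only requires
  division by \<open>1 - z\<close>.
\<close>

lemma poisson_solution:
  assumes "norm z = 1" and "stat_mean \<psi> = 0 \<or> z \<noteq> 1"
  shows "\<exists>h. \<forall>a. h a - z * step_mean h a = \<psi> a"
proof (cases "stat_mean \<psi> = 0")
  case True
  then show ?thesis using poisson_series_eq assms(1) by blast
next
  case False
  define m where "m = stat_mean \<psi>"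
  define \<eta> where "\<eta> = poisson_series z (\<lambda>a. \<psi> a - m)"
  have eq: "\<eta> a - z * step_mean \<eta> a = \<psi> a - m" for a
    unfolding \<eta>_def using assms(1) by (intro poisson_series_eq) (auto simp: stat_mean_diff m_def)
  define c where "c = m / (1 - z)"
  have c: "c - z * c = m"
  proof -
    have "c - z * c = (1 - z) * c"
      by (simp add: algebra_simps)
    then show ?thesis
      using False assms(2) by (simp add: c_def)
  qed
  have "(\<eta> a + c) - z * step_mean (\<lambda>a. \<eta> a + c) a = \<psi> a" for a
  proof -
    have "(\<eta> a + c) - z * step_mean (\<lambda>a. \<eta> a + c) a
        = (\<eta> a - z * step_mean \<eta> a) + (c - z * c)"
      by (simp add: step_mean_def child_mean_add algebra_simps)
    then show ?thesis
      by (simp only: eq c) simp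
  qed
  then show ?thesis
    by (intro exI[of _ "\<lambda>a. \<eta> a + c"]) blast
qed

end

section \<open>Exponential sums over substitution blocks\<close>

lemma word_sum_append [simp]: "word_sum f (v @ w) = word_sum f v + word_sum f w"
  by (simp add: word_sum_def)

lemma word_sum_Nil [simp]: "word_sum f [] = 0"
  by (simp add: word_sum_def)

lemma word_sum_Cons [simp]: "word_sum f (a # w) = f a + word_sum f w"
  by (simp add: word_sum_def)

text \<open>
  The sum runs over the proper prefixes, including the empty one, so that the sums over two
  consecutive words combine with a single phase factor.
\<close>

definition phase_sum :: "('a \<Rightarrow> complex) \<Rightarrow> complex \<Rightarrow> 'a list \<Rightarrow> complex" where
  "phase_sum f z w = (\<Sum>k<length w. iexp (Re (z * word_sum f (take k w))))"

lemma phase_sum_Nil [simp]: "phase_sum f z [] = 0"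
  by (simp add: phase_sum_def)

lemma phase_sum_single [simp]: "phase_sum f z [a] = 1"
  by (simp add: phase_sum_def)

lemma phase_sum_0: "phase_sum f 0 w = of_nat (length w)"
  by (simp add: phase_sum_def)

lemma norm_phase_sum: "norm (phase_sum f z w) \<le> real (length w)"
  unfolding phase_sum_def by (rule order_trans[OF sum_norm_le[of _ _ "\<lambda>_. 1"]]) auto

lemma phase_sum_snoc: "phase_sum f z (w @ [a]) = phase_sum f z w + iexp (Re (z * word_sum f w))"
  by (simp add: phase_sum_def del: times_complex.sel)

lemma phase_sum_append:
  "phase_sum f z (v @ w) = phase_sum f z v + iexp (Re (z * word_sum f v)) * phase_sum f z w"
proof (induction w rule: rev_induct)
  case (snoc a w)
  have "iexp (Re (z * word_sum f (v @ w))) = iexp (Re (z * word_sum f v)) * iexp (Re (z * word_sum f w))"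
    unfolding iexp_add[symmetric] by (simp add: algebra_simps)
  then show ?case
    unfolding append_assoc[symmetric] phase_sum_snoc snoc.IH by (simp only: distrib_left add.assoc)
qed simp

lemma phase_sum_continuous: "continuous_on UNIV (\<lambda>z. phase_sum f z w)"
  unfolding phase_sum_def by (intro continuous_intros)

context pf_substitution
begin

definition inflate :: "'a list \<Rightarrow> 'a list" where
  "inflate w = concat (map \<theta> w)"

text \<open>
  Unlike the length, this weight is multiplied by exactly \<open>lam\<close> under substitution.
\<close>

definition weight :: "'a list \<Rightarrow> real" where
  "weight w = (\<Sum>b\<leftarrow>w. \<sigma> $ b)"

lemma weight_append [simp]: "weight (v @ w) = weight v + weight w"
  by (simp add: weight_def)

lemma weight_Cons [simp]: "weight (a # w) = \<sigma> $ a + weight w"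
  by (simp add: weight_def)

lemma weight_Nil [simp]: "weight [] = 0"
  by (simp add: weight_def)

lemma weight_nonneg: "weight w \<ge> 0"
  by (induction w) (use sigma_pos less_imp_le in \<open>auto intro!: add_nonneg_nonneg\<close>)

lemma inflate_power_append:
  "(inflate ^^ n) (v @ w) = (inflate ^^ n) v @ (inflate ^^ n) w"
  by (induction n) (auto simp: inflate_def)

lemma inflate_power_Nil [simp]: "(inflate ^^ n) [] = []"
  by (induction n) (auto simp: inflate_def)

lemma inflate_power_Suc_single: "(inflate ^^ Suc n) [a] = (inflate ^^ n) (\<theta> a)"
  by (simp add: funpow_Suc_right inflate_def del: funpow.simps)

lemma weight_subst: "weight (\<theta> a) = lam * \<sigma> $ a"
  using sum_sigma_children[of a] by (simp add: weight_def sum_list_sum_nth atLeast0LessThan)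

lemma weight_inflate: "weight (inflate w) = lam * weight w"
  by (induction w) (auto simp: inflate_def weight_subst algebra_simps)

lemma weight_inflate_power: "weight ((inflate ^^ n) w) = lam ^ n * weight w"
  by (induction n) (auto simp: weight_inflate)

definition sigma_inv :: real where "sigma_inv = Max (range (\<lambda>a. 1 / \<sigma> $ a))"
definition sigma_max :: real where "sigma_max = Max (range (($) \<sigma>))"

lemma sigma_inv: "1 / \<sigma> $ a \<le> sigma_inv"
  by (simp add: sigma_inv_def)

lemma sigma_max: "\<sigma> $ a \<le> sigma_max"
  by (simp add: sigma_max_def)

lemma sigma_inv_pos: "sigma_inv > 0"
  using sigma_inv[of undefined] sigma_pos[of undefined] by (smt (verit) divide_pos_pos)

lemma sigma_max_pos: "sigma_max > 0"
  using sigma_max[of undefined] sigma_pos[of undefined] by linarith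

lemma length_le_weight: "real (length w) \<le> sigma_inv * weight w"
proof (induction w)
  case (Cons a w)
  have "1 \<le> sigma_inv * \<sigma> $ a"
    using sigma_inv[of a] sigma_pos[of a] by (simp add: pos_divide_le_eq)
  then show ?case
    using Cons by (simp add: algebra_simps)
qed simp

lemma weight_le_length: "weight w \<le> sigma_max * real (length w)"
proof (induction w)
  case (Cons a w)
  then show ?case
    using sigma_max[of a] by (simp add: algebra_simps)
qed simp

end

locale unimodular_eigenfunction = pf_substitution \<theta> lam \<rho> \<sigma>
  for \<theta> :: "'a::finite \<Rightarrow> 'a list" and lam :: real and \<rho> \<sigma> :: "real^'a" +
  fixes f :: "'a \<Rightarrow> complex" and lf :: complex
  assumes eigen: "word_sum f (\<theta> b) = lf * f b"
    and norm_lf: "norm lf = 1"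
begin

lemma lf_cnj: "lf * cnj lf = 1"
  using norm_lf complex_norm_square[of lf] by simp

lemma word_sum_inflate_power: "word_sum f ((inflate ^^ n) w) = lf ^ n * word_sum f w"
proof (induction n)
  case (Suc n)
  have "word_sum f (inflate v) = lf * word_sum f v" for v
    by (induction v) (auto simp: inflate_def eigen algebra_simps)
  then show ?case
    using Suc by simp
qed simp

text \<open>
  The word \<open>w\<close> inflated \<open>n\<close> times is a concatenation of blocks, and the sum of \<open>f\<close> over the blocks
  in front of the \<open>k\<close>-th one is \<open>lf\<^sup>n\<close> times the sum over the first \<open>k\<close> letters of \<open>w\<close>.
\<close>

lemma phase_sum_inflate_power:
  "phase_sum f z ((inflate ^^ n) w)
     = (\<Sum>k<length w. iexp (Re (z * lf ^ n * word_sum f (take k w))) * phase_sum f z ((inflate ^^ n) [w ! k]))"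
proof (induction w rule: rev_induct)
  case (snoc a w)
  have "(\<Sum>k<length w. iexp (Re (z * lf ^ n * word_sum f (take k (w @ [a])))) * phase_sum f z ((inflate ^^ n) [(w @ [a]) ! k]))
      = (\<Sum>k<length w. iexp (Re (z * lf ^ n * word_sum f (take k w))) * phase_sum f z ((inflate ^^ n) [w ! k]))"
    by (intro sum.cong) (auto simp: nth_append)
  then show ?case
    by (simp only: inflate_power_append phase_sum_append snoc word_sum_inflate_power length_append_singleton
        sum.lessThan_Suc nth_append_length mult.assoc) simp
qed simp

definition block_mean :: "nat \<Rightarrow> complex \<Rightarrow> 'a \<Rightarrow> complex" where
  "block_mean n z a = phase_sum f z ((inflate ^^ n) [a]) / of_real (lam ^ n * \<sigma> $ a)"

lemma phase_sum_block:
  "phase_sum f z ((inflate ^^ n) [a]) = of_real (lam ^ n * \<sigma> $ a) * block_mean n z a"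
  using sigma_pos[of a] lam_pos by (simp add: block_mean_def)

lemma block_mean_0: "block_mean 0 z a = of_real (1 / \<sigma> $ a)"
  by (simp add: block_mean_def)

text \<open>
  The basic recursion: reading \<open>\<theta>\<^sup>n\<^sup>+\<^sup>1 a\<close> as \<open>\<theta>\<^sup>n (\<theta> a)\<close> makes the new level the outermost one, so
  each step applies the averaging operator to the previous level, twisted by the phases of the
  prefixes of \<open>\<theta> a\<close>.
\<close>

lemma block_mean_Suc:
  "block_mean (Suc n) z a
     = child_mean a (\<lambda>k. iexp (Re (z * lf ^ n * word_sum f (take k (\<theta> a)))) * block_mean n z (\<theta> a ! k))"
proof -
  have "block_mean (Suc n) z a
      = (\<Sum>k<length (\<theta> a). iexp (Re (z * lf ^ n * word_sum f (take k (\<theta> a)))) * phase_sum f z ((inflate ^^ n) [\<theta> a ! k]))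
          / of_real (lam ^ Suc n * \<sigma> $ a)"
    unfolding block_mean_def inflate_power_Suc_single phase_sum_inflate_power[of z n "\<theta> a"] ..
  also have "\<dots> = child_mean a (\<lambda>k. iexp (Re (z * lf ^ n * word_sum f (take k (\<theta> a)))) * block_mean n z (\<theta> a ! k))"
    unfolding child_mean_def sum_divide_distrib
  proof (rule sum.cong)
    fix k
    show "iexp (Re (z * lf ^ n * word_sum f (take k (\<theta> a)))) * phase_sum f z ((inflate ^^ n) [\<theta> a ! k]) / of_real (lam ^ Suc n * \<sigma> $ a)
        = of_real (child_prob a k) * (iexp (Re (z * lf ^ n * word_sum f (take k (\<theta> a)))) * block_mean n z (\<theta> a ! k))"
      unfolding phase_sum_block child_prob_def using lam_pos sigma_pos[of a] by (simp del: times_complex.sel)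
  qed simp
  finally show ?thesis .
qed

lemma norm_block_mean: "norm (block_mean n z a) \<le> sigma_inv"
proof (induction n arbitrary: a)
  case 0
  then show ?case
    using sigma_inv[of a] sigma_pos[of a] by (simp add: block_mean_0 norm_divide)
next
  case (Suc n)
  show ?case
    unfolding block_mean_Suc by (rule child_mean_bound) (simp add: norm_mult Suc)
qed

lemma block_mean_zero_frequency: "block_mean n 0 a = (step_mean ^^ n) (\<lambda>a. of_real (1 / \<sigma> $ a)) a"
  by (induction n arbitrary: a) (simp_all add: block_mean_0 block_mean_Suc step_mean_def)

text \<open>
  The stationary mean of \<open>1 / \<sigma>\<close>, so that \<open>\<theta>\<^sup>n a\<close> has length about \<open>block_limit * lam\<^sup>n * \<sigma>(a)\<close>.
\<close>

definition block_limit :: complex where "block_limit = of_real (\<Sum>a\<in>UNIV. \<rho> $ a)"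

lemma block_mean_zero_tendsto: "(\<lambda>n. block_mean n 0 a) \<longlonglongrightarrow> block_limit"
proof -
  have "stat_mean (\<lambda>a. of_real (1 / \<sigma> $ a)) = block_limit"
    unfolding stat_mean_def block_limit_def of_real_sum
  proof (rule sum.cong)
    fix a
    show "of_real (\<sigma> $ a * \<rho> $ a) * of_real (1 / \<sigma> $ a) = complex_of_real (\<rho> $ a)"
      using sigma_pos[of a] by simp
  qed simp
  then show ?thesis
    unfolding block_mean_zero_frequency using step_mean_tendsto by metis
qed

lemma block_mean_near_zero:
  assumes "e > 0"
  shows "\<exists>d>0. \<forall>z a. norm z \<le> d \<longrightarrow> norm (block_mean n z a - block_mean n 0 a) \<le> e"
proof -
  have "\<exists>d>0. \<forall>z. norm z \<le> d \<longrightarrow> norm (block_mean n z a - block_mean n 0 a) \<le> e" for a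
  proof -
    have "continuous_on UNIV (\<lambda>z. block_mean n z a)"
      unfolding block_mean_def using sigma_pos[of a] lam_pos
      by (intro continuous_on_divide phase_sum_continuous continuous_on_const) auto
    then obtain d where "d > 0" "\<And>z. dist z 0 < d \<Longrightarrow> dist (block_mean n z a) (block_mean n 0 a) < e"
      using assms unfolding continuous_on_iff by blast
    then show ?thesis
      by (intro exI[of _ "d / 2"]) (auto simp: dist_norm less_imp_le)
  qed
  then obtain d where d: "\<And>a. d a > 0" "\<And>a z. norm z \<le> d a \<Longrightarrow> norm (block_mean n z a - block_mean n 0 a) \<le> e"
    by metis
  have "Min (range d) > 0"
    using d(1) by (subst Min_gr_iff) auto
  moreover have "Min (range d) \<le> d a" for a
    by (rule Min_le) auto
  ultimately show ?thesis
    using d(2) by (meson order_trans)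
qed

end

section \<open>Correctors and the one-level estimate\<close>

text \<open>
  For \<open>\<alpha>\<close> of order \<open>r\<close> and \<open>\<beta>\<close> of order \<open>r\<^sup>2\<close>, the only second-order terms of the exponential are
  \<open>\<beta>\<close> and \<open>-\<alpha>\<^sup>2 / 2\<close>.
\<close>

lemma exp_third_order_bound:
  fixes \<alpha> \<beta> B r :: real
  assumes \<alpha>: "\<bar>\<alpha>\<bar> \<le> B * r" and \<beta>: "\<bar>\<beta>\<bar> \<le> B * r\<^sup>2" and r: "0 \<le> r" "r \<le> 1"
  shows "norm (exp (\<i> * of_real \<alpha> + of_real \<beta>) - (1 + \<i> * of_real \<alpha> + of_real (\<beta> - \<alpha>\<^sup>2 / 2)))
     \<le> (4 * exp B * B ^ 3 + 2 * B\<^sup>2) * r ^ 3"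
proof -
  have r2: "r\<^sup>2 \<le> r"
    using r power_decreasing[of 1 2 r] by auto
  show ?thesis
  proof (cases "r = 0")
    case True
    then show ?thesis using \<alpha> \<beta> by simp
  next
    case False
    then have "r > 0" using r by simp
    then have B0: "B \<ge> 0"
      using \<alpha> by (smt (verit) mult_neg_pos)
    have \<beta>1: "\<bar>\<beta>\<bar> \<le> B" and \<beta>r: "\<bar>\<beta>\<bar> \<le> B * r"
      using \<beta> r r2 B0 mult_left_mono[OF r2 B0] mult_left_mono[OF r(2) B0] by auto
    define A where "A = \<i> * complex_of_real \<alpha> + of_real \<beta>"
    have nA: "norm A \<le> 2 * B * r"
      unfolding A_def using \<alpha> \<beta>r by (intro order_trans[OF norm_triangle_ineq]) (simp add: norm_mult)
    have "norm (exp A - (\<Sum>k\<le>2. A ^ k / fact k)) \<le> exp \<bar>Re A\<bar> * norm A ^ Suc 2 / fact 2"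
      by (rule Taylor_exp)
    also have "\<dots> \<le> exp B * (2 * B * r) ^ 3 / 2"
    proof -
      have "exp \<bar>Re A\<bar> \<le> exp B"
        using \<beta>1 by (simp add: A_def)
      moreover have "norm A ^ 3 \<le> (2 * B * r) ^ 3"
        using nA by (intro power_mono) auto
      ultimately have "exp \<bar>Re A\<bar> * norm A ^ 3 \<le> exp B * (2 * B * r) ^ 3"
        by (intro mult_mono) auto
      moreover have "Suc 2 = 3" "fact 2 = (2::real)"
        by simp_all
      ultimately show ?thesis
        by (simp only: divide_right_mono)
    qed
    finally have T: "norm (exp A - (1 + A + A\<^sup>2 / 2)) \<le> 4 * exp B * B ^ 3 * r ^ 3"
      by (simp add: numeral_2_eq_2 power_mult_distrib algebra_simps)
    have A2: "A\<^sup>2 / 2 = of_real (- \<alpha>\<^sup>2 / 2) + (\<i> * of_real (\<alpha> * \<beta>) + of_real (\<beta>\<^sup>2 / 2))"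
      by (simp add: A_def power2_eq_square field_simps)
    have "norm (\<i> * of_real (\<alpha> * \<beta>) + complex_of_real (\<beta>\<^sup>2 / 2)) \<le> \<bar>\<alpha>\<bar> * \<bar>\<beta>\<bar> + \<bar>\<beta>\<bar> * \<bar>\<beta>\<bar> / 2"
      by (intro order_trans[OF norm_triangle_ineq]) (simp add: norm_mult power2_eq_square abs_mult)
    also have "\<dots> \<le> (B * r) * (B * r\<^sup>2) + (B * r) * (B * r\<^sup>2) / 2"
      using \<alpha> \<beta> \<beta>r B0 r by (intro add_mono divide_right_mono mult_mono) auto
    also have "\<dots> \<le> 2 * B\<^sup>2 * r ^ 3"
    proof -
      have "0 \<le> B\<^sup>2 * r ^ 3"
        using r by simp
      moreover have "(B * r) * (B * r\<^sup>2) = B\<^sup>2 * r ^ 3"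
        by (simp add: power2_eq_square power3_eq_cube)
      ultimately show ?thesis
        by linarith
    qed
    finally have R: "norm (\<i> * of_real (\<alpha> * \<beta>) + complex_of_real (\<beta>\<^sup>2 / 2)) \<le> 2 * B\<^sup>2 * r ^ 3" .
    have "exp A - (1 + \<i> * of_real \<alpha> + of_real (\<beta> - \<alpha>\<^sup>2 / 2))
        = (exp A - (1 + A + A\<^sup>2 / 2)) + (\<i> * of_real (\<alpha> * \<beta>) + complex_of_real (\<beta>\<^sup>2 / 2))"
      unfolding A2 by (simp add: A_def)
    also have "norm \<dots> \<le> 4 * exp B * B ^ 3 * r ^ 3 + 2 * B\<^sup>2 * r ^ 3"
      using T R by (intro order_trans[OF norm_triangle_ineq]) simp
    finally show ?thesis
      by (simp add: A_def algebra_simps)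
  qed
qed

lemma finite_bound: "\<exists>B\<ge>0. \<forall>a. norm (k (a::'a::finite) :: 'b::real_normed_vector) \<le> B"
proof (intro exI conjI allI)
  have *: "norm (k a) \<le> Max (range (\<lambda>a. norm (k a)))" for a
    by (rule Max_ge) auto
  then show "norm (k a) \<le> Max (range (\<lambda>a. norm (k a)))" for a .
  show "0 \<le> Max (range (\<lambda>a. norm (k a)))"
    using *[of undefined] norm_ge_zero order_trans by blast
qed

context pf_substitution
begin

lemma child_mean_Re: "child_mean a (\<lambda>k. of_real (Re (h k))) = of_real (Re (child_mean a h))"
  by (simp add: child_mean_def Re_sum)

lemma step_mean_real: "(\<And>b. \<psi> b \<in> \<real>) \<Longrightarrow> (step_mean ^^ n) \<psi> a \<in> \<real>"
proof (induction n arbitrary: a)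
  case (Suc n)
  then show ?case
    by (auto simp: step_mean_eq intro!: sum_in_Reals Reals_mult)
qed auto

lemma poisson_series_real:
  assumes "stat_mean \<psi> = 0" "norm z = 1" "z \<in> \<real>" "\<And>b. \<psi> b \<in> \<real>"
  shows "poisson_series z \<psi> a \<in> \<real>"
proof -
  have "(\<lambda>n. z ^ n * (step_mean ^^ n) \<psi> a) sums poisson_series z \<psi> a"
    unfolding poisson_series_def using summable_poisson_series[OF assms(1,2)] by (rule summable_sums)
  then have "(\<lambda>n. Im (z ^ n * (step_mean ^^ n) \<psi> a)) sums Im (poisson_series z \<psi> a)"
    by (rule sums_Im)
  moreover have "Im (z ^ n * (step_mean ^^ n) \<psi> a) = 0" for n
    using step_mean_real[of \<psi> n a] assms(3,4) by (auto elim!: Reals_cases simp: simp flip: of_real_power of_real_mult)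
  ultimately have "Im (poisson_series z \<psi> a) = 0"
    using sums_unique2[of "\<lambda>_. 0" "Im (poisson_series z \<psi> a)" 0] by simp
  then show ?thesis
    by (simp add: complex_is_Real_iff)
qed

end

locale real_or_rotating_eigenfunction = unimodular_eigenfunction \<theta> lam \<rho> \<sigma> f lf
  for \<theta> :: "'a::finite \<Rightarrow> 'a list" and lam :: real and \<rho> \<sigma> :: "real^'a"
    and f :: "'a \<Rightarrow> complex" and lf :: complex +
  assumes real_if_real: "lf \<in> \<real> \<Longrightarrow> f a \<in> \<real>"
begin

abbreviation prefix_sum :: "'a \<Rightarrow> nat \<Rightarrow> complex" where
  "prefix_sum a k \<equiv> word_sum f (take k (\<theta> a))"

definition mean_drift :: complex where "mean_drift = stat_mean (\<lambda>a. child_mean a (prefix_sum a))"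

definition mean_prefix :: "'a \<Rightarrow> complex" where
  "mean_prefix a = child_mean a (prefix_sum a) - mean_drift"

text \<open>
  The first corrector. In terms of the descending chain started at \<open>a\<close>, it is the expected
  total of all centred future summands, rotated back to the current level.
\<close>

definition eta :: "'a \<Rightarrow> complex" where
  "eta = poisson_series (cnj lf) mean_prefix"

text \<open>
  The martingale increment: the summand corrected by a rotated difference of \<open>eta\<close>.
\<close>

definition xi :: "'a \<Rightarrow> nat \<Rightarrow> complex" where
  "xi a k = prefix_sum a k - mean_drift + cnj lf * eta (\<theta> a ! k) - eta a"

definition asym_var :: real where
  "asym_var = (\<Sum>a\<in>UNIV. \<sigma> $ a * \<rho> $ a * (\<Sum>k<length (\<theta> a). child_prob a k * (cmod (xi a k))\<^sup>2))"

definition drift_per_level :: complex where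
  "drift_per_level = (if lf = 1 then mean_drift else 0)"

text \<open>
  The factor reflects the limit law: for real \<open>lf\<close> the variance sits in one real direction, otherwise
  it is shared equally by the real and the imaginary part.
\<close>

definition rate :: real where
  "rate = (if lf \<in> \<real> then asym_var / 2 else asym_var / 4)"

text \<open>
  For real \<open>lf\<close> all sums are real and real frequencies suffice; for other \<open>lf\<close> all frequencies are
  needed. In both cases the set of frequencies is invariant under multiplication by \<open>lf\<close>.
\<close>

definition admissible :: "complex \<Rightarrow> bool" where
  "admissible z \<longleftrightarrow> (lf \<in> \<real> \<longrightarrow> z \<in> \<real>)"

definition level_factor :: "complex \<Rightarrow> complex" where
  "level_factor z = iexp (Re (z * drift_per_level)) * of_real (exp (- rate * (cmod z)\<^sup>2))"

lemma asym_var_nonneg: "asym_var \<ge> 0"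
  unfolding asym_var_def using sigma_pos rho_pos child_prob_nonneg
  by (auto intro!: sum_nonneg mult_nonneg_nonneg simp: less_imp_le)

lemma rate_nonneg: "rate \<ge> 0"
  using asym_var_nonneg by (simp add: rate_def)

lemma stat_mean_mean_prefix: "stat_mean mean_prefix = 0"
  unfolding mean_prefix_def[abs_def] by (simp add: stat_mean_diff mean_drift_def)

lemma eta_eq: "eta a - cnj lf * step_mean eta a = mean_prefix a"
  unfolding eta_def using stat_mean_mean_prefix norm_lf by (intro poisson_series_eq) auto

lemma child_mean_xi: "child_mean a (xi a) = 0"
proof -
  have "child_mean a (xi a) = child_mean a (prefix_sum a) - mean_drift + cnj lf * step_mean eta a - eta a"
    unfolding xi_def[abs_def] step_mean_def by (simp add: child_mean_add child_mean_diff child_mean_cmult)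
  also have "\<dots> = 0"
    using eta_eq[of a] by (simp add: mean_prefix_def algebra_simps)
  finally show ?thesis .
qed

lemma word_sum_real: "lf \<in> \<real> \<Longrightarrow> word_sum f w \<in> \<real>"
  by (induction w) (auto intro: real_if_real Reals_add)

lemma mean_drift_real:
  assumes "lf \<in> \<real>"
  shows "mean_drift \<in> \<real>"
  unfolding mean_drift_def stat_mean_def child_mean_def using word_sum_real[OF assms]
  by (auto intro!: sum_in_Reals Reals_mult simp del: of_real_mult)

lemma xi_real:
  assumes "lf \<in> \<real>"
  shows "xi a k \<in> \<real>"
proof -
  have pr: "prefix_sum b j \<in> \<real>" for b j
    using word_sum_real[OF assms] .
  have cm: "child_mean b (prefix_sum b) \<in> \<real>" for b
    unfolding child_mean_def by (auto intro!: sum_in_Reals Reals_mult pr)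
  have Dr: "mean_drift \<in> \<real>"
    using mean_drift_real[OF assms] .
  have lr: "cnj lf \<in> \<real>"
    using assms by (auto elim!: Reals_cases)
  have "eta b \<in> \<real>" for b
    unfolding eta_def using stat_mean_mean_prefix norm_lf lr
    by (intro poisson_series_real) (auto simp: mean_prefix_def intro!: Reals_diff cm Dr)
  then show ?thesis
    unfolding xi_def by (intro Reals_diff Reals_add Reals_mult pr Dr lr)
qed

text \<open>
  The conditional second moment of \<open>Re (y \<xi>)\<close> has a part proportional to \<open>|y|\<^sup>2\<close> and a part proportional
  to \<open>y\<^sup>2\<close>. The first is centred by \<open>rate\<close> and then removed by a Poisson equation with multiplier 1.
  The second leads to the multiplier \<open>cnj lf\<^sup>2\<close>, which differs from 1 for non-real \<open>lf\<close>, so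
  no constant remains. For real \<open>lf\<close>, both \<open>y\<close> and \<open>\<xi>\<close> are real, and everything is
  put into the first part.
\<close>

lemma second_order_corrector:
  "\<exists>\<kappa> B. B \<ge> 0 \<and> (\<forall>y a. \<bar>\<kappa> y a\<bar> \<le> B * (cmod y)\<^sup>2) \<and>
     (\<forall>y a. admissible y \<longrightarrow>
        child_mean a (\<lambda>k. of_real (rate * (cmod y)\<^sup>2 - \<kappa> (cnj lf * y) (\<theta> a ! k) + \<kappa> y a
           - (Re (y * xi a k))\<^sup>2 / 2)) = 0)"
proof -
  define c1 c2 where "c1 = (\<lambda>a k. complex_of_real ((cmod (xi a k))\<^sup>2 / (if lf \<in> \<real> then 2 else 4)))"
    and "c2 = (\<lambda>a k. if lf \<in> \<real> then 0 else (xi a k)\<^sup>2 / 4)"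
  have quad: "(Re (y * xi a k))\<^sup>2 / 2 = Re (of_real ((cmod y)\<^sup>2) * c1 a k + y\<^sup>2 * c2 a k)"
    if "admissible y" for y a k
  proof (cases "lf \<in> \<real>")
    case True
    then have "y \<in> \<real>"
      using that by (simp add: admissible_def)
    then obtain s where "y = complex_of_real s"
      by (auto elim: Reals_cases)
    moreover obtain t where "xi a k = complex_of_real t"
      using xi_real[OF True, of a k] by (rule Reals_cases)
    ultimately show ?thesis
      using True by (simp add: c1_def c2_def power_mult_distrib flip: of_real_power of_real_mult)
  next
    case False
    define w where "w = y * xi a k"
    have c: "of_real ((cmod y)\<^sup>2) * c1 a k = of_real ((cmod w)\<^sup>2 / 4)" "y\<^sup>2 * c2 a k = w\<^sup>2 / 4"
      using False by (simp_all add: c1_def c2_def w_def norm_mult power_mult_distrib)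
    have "Re (of_real ((cmod w)\<^sup>2 / 4) + w\<^sup>2 / 4) = ((Re w)\<^sup>2 + (Im w)\<^sup>2) / 4 + ((Re w)\<^sup>2 - (Im w)\<^sup>2) / 4"
      unfolding cmod_power2 by (simp add: power2_eq_square)
    then show ?thesis
      unfolding c w_def[symmetric] by (simp add: field_simps)
  qed
  have "stat_mean (\<lambda>a. child_mean a (c1 a)) = of_real rate"
    unfolding stat_mean_def child_mean_def c1_def rate_def asym_var_def
    by (simp add: sum_divide_distrib sum_distrib_left)
  then have "stat_mean (\<lambda>a. child_mean a (c1 a) - of_real rate) = 0"
    by (simp add: stat_mean_diff)
  then obtain k1 where k1: "\<And>a. k1 a - 1 * step_mean k1 a = child_mean a (c1 a) - of_real rate"
    using poisson_solution[of 1 "\<lambda>a. child_mean a (c1 a) - of_real rate"] by auto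
  have "\<exists>k2. \<forall>a. k2 a - (cnj lf)\<^sup>2 * step_mean k2 a = child_mean a (c2 a)"
  proof (cases "lf \<in> \<real>")
    case True
    then show ?thesis
      by (intro exI[of _ "\<lambda>_. 0"]) (simp add: c2_def)
  next
    case False
    have "(cnj lf)\<^sup>2 \<noteq> 1"
    proof
      assume "(cnj lf)\<^sup>2 = 1"
      then have "cnj lf = 1 \<or> cnj lf = - 1"
        by (simp add: power2_eq_1_iff)
      then have "lf = 1 \<or> lf = - 1"
        by (metis complex_cnj_cnj complex_cnj_minus complex_cnj_one)
      then show False using False by auto
    qed
    then show ?thesis
      using norm_lf by (intro poisson_solution) (auto simp: norm_power)
  qed
  then obtain k2 where k2: "\<And>a. k2 a - (cnj lf)\<^sup>2 * step_mean k2 a = child_mean a (c2 a)"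
    by blast
  define \<kappa> where "\<kappa> = (\<lambda>y a. Re (of_real ((cmod y)\<^sup>2) * k1 a + y\<^sup>2 * k2 a))"
  obtain B1 B2 where B: "B1 \<ge> 0" "B2 \<ge> 0" "\<And>a. norm (k1 a) \<le> B1" "\<And>a. norm (k2 a) \<le> B2"
    using finite_bound[of k1] finite_bound[of k2] by blast
  have bound: "\<bar>\<kappa> y a\<bar> \<le> (B1 + B2) * (cmod y)\<^sup>2" for y a
  proof -
    have "\<bar>\<kappa> y a\<bar> \<le> norm (of_real ((cmod y)\<^sup>2) * k1 a + y\<^sup>2 * k2 a)"
      unfolding \<kappa>_def by (rule abs_Re_le_cmod)
    also have "\<dots> \<le> (cmod y)\<^sup>2 * norm (k1 a) + (cmod y)\<^sup>2 * norm (k2 a)"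
      by (intro order_trans[OF norm_triangle_ineq]) (simp add: norm_mult norm_power)
    also have "\<dots> \<le> (cmod y)\<^sup>2 * B1 + (cmod y)\<^sup>2 * B2"
      using B by (intro add_mono mult_left_mono) auto
    finally show ?thesis by (simp add: algebra_simps)
  qed
  have zero: "child_mean a (\<lambda>k. of_real (rate * (cmod y)\<^sup>2 - \<kappa> (cnj lf * y) (\<theta> a ! k) + \<kappa> y a
           - (Re (y * xi a k))\<^sup>2 / 2)) = 0" if y: "admissible y" for y a
  proof -
    let ?n = "complex_of_real ((cmod y)\<^sup>2)"
    define h where "h = (\<lambda>k. ?n * (of_real rate - k1 (\<theta> a ! k) + k1 a - c1 a k)
        + y\<^sup>2 * (k2 a - (cnj lf)\<^sup>2 * k2 (\<theta> a ! k) - c2 a k))"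
    have "rate * (cmod y)\<^sup>2 - \<kappa> (cnj lf * y) (\<theta> a ! k) + \<kappa> y a - (Re (y * xi a k))\<^sup>2 / 2 = Re (h k)" for k
    proof -
      have "h k = of_real (rate * (cmod y)\<^sup>2)
          - (?n * k1 (\<theta> a ! k) + (cnj lf * y)\<^sup>2 * k2 (\<theta> a ! k))
          + (?n * k1 a + y\<^sup>2 * k2 a) - (?n * c1 a k + y\<^sup>2 * c2 a k)"
        by (simp add: h_def algebra_simps power_mult_distrib)
      then show ?thesis
        unfolding quad[OF y] \<kappa>_def using norm_lf
        by (simp only: minus_complex.sel plus_complex.sel Re_complex_of_real norm_mult complex_mod_cnj mult_1)
    qed
    then have "child_mean a (\<lambda>k. of_real (rate * (cmod y)\<^sup>2 - \<kappa> (cnj lf * y) (\<theta> a ! k) + \<kappa> y a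
           - (Re (y * xi a k))\<^sup>2 / 2)) = of_real (Re (child_mean a h))"
      by (simp only: child_mean_Re)
    also have "child_mean a h = ?n * (of_real rate - step_mean k1 a + k1 a - child_mean a (c1 a))
        + y\<^sup>2 * (k2 a - (cnj lf)\<^sup>2 * step_mean k2 a - child_mean a (c2 a))"
      unfolding h_def step_mean_def
      by (simp only: child_mean_add child_mean_diff child_mean_cmult child_mean_const)
    also have "\<dots> = 0"
      unfolding k2 using k1[of a] by (simp add: algebra_simps)
    finally show ?thesis by simp
  qed
  show ?thesis
    using B bound zero by (intro exI[of _ \<kappa>] exI[of _ "B1 + B2"]) auto
qed

lemma admissible_mult: "admissible z \<Longrightarrow> admissible (z * lf ^ n)"
  by (simp add: admissible_def Reals_mult Reals_power)

lemma norm_level_factor: "norm (level_factor z) \<le> 1"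
  using rate_nonneg by (simp add: level_factor_def norm_mult)

lemma level_factor_rotate: "level_factor (z * lf ^ n) = level_factor z"
  using norm_lf by (simp add: level_factor_def drift_per_level_def norm_mult norm_power del: times_complex.sel)

text \<open>
  The function \<open>corr\<close> is an approximate eigenfunction of the twisted averaging operator. Its
  exponent holds both correctors, so that dividing the twisted average by \<open>level_factor y * corr (y * lf)\<close> leaves the mean of
  \<open>exp (i \<alpha> + \<beta>)\<close> with \<open>\<alpha>\<close> of mean zero and \<open>\<beta> - \<alpha>\<^sup>2 / 2\<close> of mean zero, which is
  \<open>1 + O(|y|\<^sup>3)\<close>.
\<close>

lemma one_level_estimate:
  "\<exists>corr C. C \<ge> 0 \<and>
     (\<forall>y a. admissible y \<and> cmod y \<le> 1 \<longrightarrow>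
        norm (child_mean a (\<lambda>k. iexp (Re (y * prefix_sum a k)) * corr y (\<theta> a ! k))
              - level_factor y * corr (y * lf) a) \<le> C * cmod y ^ 3) \<and>
     (\<forall>e>0. \<exists>d>0. \<forall>y a. cmod y \<le> d \<longrightarrow> norm (corr y a - 1) \<le> e)"
proof -
  obtain \<kappa> B0 where B0: "B0 \<ge> 0" "\<And>y a. \<bar>\<kappa> y a\<bar> \<le> B0 * (cmod y)\<^sup>2"
    and \<kappa>: "\<And>y a. admissible y \<Longrightarrow> child_mean a (\<lambda>k. of_real (rate * (cmod y)\<^sup>2
        - \<kappa> (cnj lf * y) (\<theta> a ! k) + \<kappa> y a - (Re (y * xi a k))\<^sup>2 / 2)) = 0"
    using second_order_corrector by blast
  \<comment> \<open>Shifting \<open>eta\<close> by \<open>e0\<close> absorbs the mean of the summand if \<open>lf \<noteq> 1\<close>; for \<open>lf = 1\<close> a constant shift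
has no effect and the mean remains as drift.\<close>
  define e0 where "e0 = (if lf = 1 then 0 else mean_drift / (1 - cnj lf))"
  have lf1: "cnj lf \<noteq> 1" if "lf \<noteq> 1"
    using that by (metis complex_cnj_cnj complex_cnj_one)
  have e0: "e0 - cnj lf * e0 = mean_drift - drift_per_level"
  proof (cases "lf = 1")
    case False
    have "e0 - cnj lf * e0 = (1 - cnj lf) * e0"
      by (simp add: algebra_simps)
    then show ?thesis
      using False lf1 by (simp add: e0_def drift_per_level_def)
  next
    case True
    show ?thesis
      unfolding e0_def drift_per_level_def if_P[OF True] by simp
  qed
  define corr where "corr = (\<lambda>y a. iexp (Re (cnj lf * y * (eta a + e0))) * of_real (exp (- \<kappa> (cnj lf * y) a)))"
  obtain B1 where B1: "B1 \<ge> 0" "\<And>p. p \<in> (SIGMA a:UNIV. {..<length (\<theta> a)}) \<Longrightarrow> norm (case p of (a, k) \<Rightarrow> xi a k) \<le> B1"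
  proof
    let ?S = "(\<lambda>p. norm (case p of (a, k) \<Rightarrow> xi a k)) ` (SIGMA a:UNIV. {..<length (\<theta> a)})"
    have fin: "finite ?S" by auto
    show "0 \<le> Max (insert 0 ?S)"
      using fin by (intro Max_ge) auto
    show "norm (case p of (a, k) \<Rightarrow> xi a k) \<le> Max (insert 0 ?S)"
      if "p \<in> (SIGMA a:UNIV. {..<length (\<theta> a)})" for p
      using fin that by (intro Max_ge) auto
  qed
  define B where "B = B1 + rate + 2 * B0"
  define C where "C = exp B0 * (4 * exp B * B ^ 3 + 2 * B\<^sup>2)"
  have Bpos: "B \<ge> 0"
    using B0 B1 rate_nonneg by (simp add: B_def)
  have main: "norm (child_mean a (\<lambda>k. iexp (Re (y * prefix_sum a k)) * corr y (\<theta> a ! k))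
              - level_factor y * corr (y * lf) a) \<le> C * cmod y ^ 3"
    if y: "admissible y" "cmod y \<le> 1" for y a
  proof -
    define \<alpha> where "\<alpha> = (\<lambda>k. Re (y * xi a k))"
    define \<beta> where "\<beta> = (\<lambda>k. rate * (cmod y)\<^sup>2 - \<kappa> (cnj lf * y) (\<theta> a ! k) + \<kappa> y a)"
    have cl: "cnj lf * (y * lf) = y"
      using lf_cnj by (simp add: algebra_simps)
    have factor: "iexp (Re (y * prefix_sum a k)) * corr y (\<theta> a ! k)
        = level_factor y * corr (y * lf) a * exp (\<i> * of_real (\<alpha> k) + of_real (\<beta> k))" for k
    proof -
      have "y * prefix_sum a k + cnj lf * y * (eta (\<theta> a ! k) + e0)
          = y * drift_per_level + y * (eta a + e0) + y * xi a k"
      proof -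
        have "y * prefix_sum a k + cnj lf * y * (eta (\<theta> a ! k) + e0)
            - (y * drift_per_level + y * (eta a + e0) + y * xi a k)
            = y * ((mean_drift - drift_per_level) - (e0 - cnj lf * e0))"
          by (simp add: xi_def algebra_simps)
        then show ?thesis
          unfolding e0 by simp
      qed
      then have arg: "Re (y * prefix_sum a k) + Re (cnj lf * y * (eta (\<theta> a ! k) + e0))
          = Re (y * drift_per_level) + Re (y * (eta a + e0)) + \<alpha> k"
        unfolding \<alpha>_def by (simp only: plus_complex.sel[symmetric])
      have "iexp (Re (y * prefix_sum a k)) * corr y (\<theta> a ! k)
          = iexp (Re (y * prefix_sum a k) + Re (cnj lf * y * (eta (\<theta> a ! k) + e0)))
            * of_real (exp (- \<kappa> (cnj lf * y) (\<theta> a ! k)))"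
        unfolding corr_def iexp_add by (simp only: mult.assoc)
      also have "of_real (exp (- \<kappa> (cnj lf * y) (\<theta> a ! k)))
          = complex_of_real (exp (- rate * (cmod y)\<^sup>2) * exp (- \<kappa> y a) * exp (\<beta> k))"
        unfolding exp_add[symmetric] by (simp add: \<beta>_def)
      also have "iexp (Re (y * prefix_sum a k) + Re (cnj lf * y * (eta (\<theta> a ! k) + e0))) * \<dots>
          = level_factor y * corr (y * lf) a * (iexp (\<alpha> k) * of_real (exp (\<beta> k)))"
        unfolding arg iexp_add level_factor_def corr_def cl by (simp only: of_real_mult mult_ac)
      finally show ?thesis
        by (simp only: exp_add exp_of_real)
    qed
    have n1: "norm (corr (y * lf) a) \<le> exp B0"
    proof -
      have "- \<kappa> y a \<le> B0 * (cmod y)\<^sup>2"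
        using B0(2)[of y a] by linarith
      also have "\<dots> \<le> B0 * 1"
        using B0(1) y(2) by (intro mult_left_mono power_le_one) auto
      finally show ?thesis
        unfolding corr_def cl by (simp add: norm_mult)
    qed
    have bound: "norm (exp (\<i> * of_real (\<alpha> k) + of_real (\<beta> k)) - (1 + \<i> * of_real (\<alpha> k) + of_real (\<beta> k - (\<alpha> k)\<^sup>2 / 2)))
        \<le> (4 * exp B * B ^ 3 + 2 * B\<^sup>2) * cmod y ^ 3" if k: "k < length (\<theta> a)" for k
    proof (rule exp_third_order_bound)
      have "\<bar>\<alpha> k\<bar> \<le> cmod (y * xi a k)"
        unfolding \<alpha>_def by (rule abs_Re_le_cmod)
      also have "\<dots> \<le> cmod y * B1"
        unfolding norm_mult using B1(2)[of "(a, k)"] k by (intro mult_left_mono) auto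
      also have "\<dots> \<le> cmod y * B"
        using B0 rate_nonneg by (intro mult_left_mono) (auto simp: B_def)
      finally show "\<bar>\<alpha> k\<bar> \<le> B * cmod y"
        by (simp add: mult.commute)
      have "\<bar>\<kappa> (cnj lf * y) (\<theta> a ! k)\<bar> \<le> B0 * (cmod y)\<^sup>2"
        using B0(2)[of "cnj lf * y"] norm_lf by (simp add: norm_mult)
      moreover have "\<bar>\<kappa> y a\<bar> \<le> B0 * (cmod y)\<^sup>2"
        by (rule B0(2))
      moreover have "rate * (cmod y)\<^sup>2 \<ge> 0"
        using rate_nonneg by simp
      ultimately have "\<bar>\<beta> k\<bar> \<le> (rate + 2 * B0) * (cmod y)\<^sup>2"
        unfolding \<beta>_def distrib_right by linarith
      also have "\<dots> \<le> B * (cmod y)\<^sup>2"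
        using B1 by (intro mult_right_mono) (auto simp: B_def)
      finally show "\<bar>\<beta> k\<bar> \<le> B * (cmod y)\<^sup>2" .
    qed (use y in auto)
    have "child_mean a (\<lambda>k. of_real (\<alpha> k)) = 0"
    proof -
      have "child_mean a (\<lambda>k. of_real (\<alpha> k)) = of_real (Re (y * child_mean a (xi a)))"
        unfolding \<alpha>_def child_mean_Re child_mean_cmult ..
      then show ?thesis
        by (simp add: child_mean_xi)
    qed
    moreover have "child_mean a (\<lambda>k. of_real (\<beta> k - (\<alpha> k)\<^sup>2 / 2)) = 0"
      unfolding \<alpha>_def \<beta>_def by (rule \<kappa>[OF y(1)])
    ultimately have "child_mean a (\<lambda>k. 1 + \<i> * of_real (\<alpha> k) + of_real (\<beta> k - (\<alpha> k)\<^sup>2 / 2)) = 1"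
      by (simp only: child_mean_add child_mean_cmult child_mean_const mult_zero_right add_0_right)
    then have "child_mean a (\<lambda>k. exp (\<i> * of_real (\<alpha> k) + of_real (\<beta> k))) - 1
        = child_mean a (\<lambda>k. exp (\<i> * of_real (\<alpha> k) + of_real (\<beta> k)) - (1 + \<i> * of_real (\<alpha> k) + of_real (\<beta> k - (\<alpha> k)\<^sup>2 / 2)))"
      by (simp only: child_mean_diff)
    also have "norm \<dots> \<le> (4 * exp B * B ^ 3 + 2 * B\<^sup>2) * cmod y ^ 3"
      by (rule child_mean_bound) (rule bound)
    finally have E: "norm (child_mean a (\<lambda>k. exp (\<i> * of_real (\<alpha> k) + of_real (\<beta> k))) - 1)
        \<le> (4 * exp B * B ^ 3 + 2 * B\<^sup>2) * cmod y ^ 3" .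
    have "child_mean a (\<lambda>k. iexp (Re (y * prefix_sum a k)) * corr y (\<theta> a ! k)) - level_factor y * corr (y * lf) a
        = level_factor y * corr (y * lf) a * (child_mean a (\<lambda>k. exp (\<i> * of_real (\<alpha> k) + of_real (\<beta> k))) - 1)"
      unfolding factor child_mean_cmult by (simp add: algebra_simps)
    also have "norm \<dots> \<le> (1 * exp B0) * ((4 * exp B * B ^ 3 + 2 * B\<^sup>2) * cmod y ^ 3)"
      unfolding norm_mult by (intro mult_mono norm_level_factor n1 E mult_nonneg_nonneg) auto
    finally show ?thesis
      by (simp add: C_def mult.assoc)
  qed
  have small: "\<exists>d>0. \<forall>y a. cmod y \<le> d \<longrightarrow> norm (corr y a - 1) \<le> e" if "e > 0" for e
  proof -
    obtain Be where Be: "Be \<ge> 0" "\<And>a. norm (eta a + e0) \<le> Be"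
      using finite_bound[of "\<lambda>a. eta a + e0"] by blast
    define h where "h = (\<lambda>r::real. Be * r + exp (B0 * r\<^sup>2) * (B0 * r\<^sup>2))"
    have "isCont h 0"
      unfolding h_def by (intro continuous_intros)
    then have "\<forall>\<^sub>F r in at 0. h r < e"
      using that order_tendstoD(2)[of h "h 0" "at 0" e] by (simp add: isCont_def h_def)
    then obtain d where d: "d > 0" "\<And>r. r \<noteq> 0 \<Longrightarrow> dist r 0 < d \<Longrightarrow> h r < e"
      unfolding eventually_at by blast
    have hd: "h r \<le> e" if "0 \<le> r" "r \<le> d / 2" for r
      using d that \<open>e > 0\<close> by (cases "r = 0") (auto simp: h_def less_imp_le dist_real_def)
    have "norm (corr y a - 1) \<le> h (cmod y)" for y a
    proof -
      define t u where "t = Re (cnj lf * y * (eta a + e0))" and "u = - \<kappa> (cnj lf * y) a"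
      have "\<bar>t\<bar> \<le> cmod (cnj lf * y * (eta a + e0))"
        unfolding t_def by (rule abs_Re_le_cmod)
      also have "\<dots> \<le> cmod y * Be"
        using norm_lf Be by (simp add: norm_mult mult_left_mono)
      finally have t: "\<bar>t\<bar> \<le> Be * cmod y"
        by (simp add: mult.commute)
      have u: "\<bar>u\<bar> \<le> B0 * (cmod y)\<^sup>2"
        using B0(2)[of "cnj lf * y" a] norm_lf by (simp add: norm_mult u_def)
      have "norm (iexp t - 1) \<le> \<bar>t\<bar>"
        using iexp_approx1[of t 0] by simp
      moreover have "\<bar>exp u - 1\<bar> \<le> exp \<bar>u\<bar> * \<bar>u\<bar>"
        using Taylor_exp_field[of u 0] by simp
      moreover have "exp \<bar>u\<bar> * \<bar>u\<bar> \<le> exp (B0 * (cmod y)\<^sup>2) * (B0 * (cmod y)\<^sup>2)"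
        using u by (intro mult_mono) auto
      moreover have "corr y a - 1 = iexp t * of_real (exp u - 1) + (iexp t - 1)"
        by (simp add: corr_def t_def u_def algebra_simps)
      then have "norm (corr y a - 1) \<le> \<bar>exp u - 1\<bar> + norm (iexp t - 1)"
        by (simp only: norm_triangle_ineq[THEN order_trans] norm_mult norm_exp_i_times mult_1 norm_of_real order_refl)
      ultimately show ?thesis
        using t unfolding h_def by linarith
    qed
    then have "norm (corr y a - 1) \<le> e" if "cmod y \<le> d / 2" for y a
      using hd[OF norm_ge_zero that] order_trans by blast
    then show ?thesis
      using d(1) by (intro exI[of _ "d / 2"]) auto
  qed
  have "C \<ge> 0"
    using Bpos by (simp add: C_def)
  then show ?thesis
    using main small by blast
qed

end

section \<open>Asymptotics of exponential sums over blocks\<close>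

context real_or_rotating_eigenfunction
begin

text \<open>
  Up to level \<open>m\<close> the frequency is negligible and the blocks have almost their limiting density. From
  there on the approximate eigenfunction is propagated; averaging does not increase the
  error, and each level adds \<open>O(|z|\<^sup>3)\<close>. The error \<open>e\<close> absorbs the first \<open>m\<close> levels.
\<close>

lemma block_mean_asymptotics:
  assumes "e > 0"
  shows "\<exists>m d C. d > 0 \<and> C \<ge> 0 \<and> (\<forall>n\<ge>m. \<forall>z a. admissible z \<and> cmod z \<le> d \<longrightarrow>
      norm (block_mean n z a - block_limit * level_factor z ^ n) \<le> e + C * (real n * cmod z ^ 3))"
proof -
  obtain corr C where C: "C \<ge> 0"
    and step: "\<And>y a. admissible y \<Longrightarrow> cmod y \<le> 1 \<Longrightarrow>
        norm (child_mean a (\<lambda>k. iexp (Re (y * prefix_sum a k)) * corr y (\<theta> a ! k))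
              - level_factor y * corr (y * lf) a) \<le> C * cmod y ^ 3"
    and corr: "\<And>e. e > 0 \<Longrightarrow> \<exists>d>0. \<forall>y a. cmod y \<le> d \<longrightarrow> norm (corr y a - 1) \<le> e"
    using one_level_estimate by blast
  define c where "c = norm block_limit"
  define e' where "e' = e / (2 + 3 * c)"
  have c0: "c \<ge> 0" and e': "e' > 0" "e' * (2 + 3 * c) = e"
  proof -
    show c0: "c \<ge> 0"
      by (simp add: c_def)
    then have "2 + 3 * c > 0"
      by simp
    then show "e' > 0" "e' * (2 + 3 * c) = e"
      using assms by (simp_all add: e'_def)
  qed
  have "\<forall>\<^sub>F n in sequentially. \<forall>a. norm (block_mean n 0 a - block_limit) < e'"
    using tendstoD[OF block_mean_zero_tendsto e'(1)] by (auto simp: eventually_all_finite dist_norm)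
  then obtain m where m: "\<And>a. norm (block_mean m 0 a - block_limit) < e'"
    by (auto simp: eventually_sequentially)
  obtain d1 where d1: "d1 > 0" "\<And>z a. cmod z \<le> d1 \<Longrightarrow> norm (block_mean m z a - block_mean m 0 a) \<le> e'"
    using block_mean_near_zero[OF e'(1), of m] by blast
  obtain d2 where d2: "d2 > 0" "\<And>y a. cmod y \<le> d2 \<Longrightarrow> norm (corr y a - 1) \<le> e'"
    using corr[OF e'(1)] by blast
  have "continuous_on UNIV (\<lambda>z. level_factor z ^ m)"
    unfolding level_factor_def by (intro continuous_intros)
  then obtain d3 where d3: "d3 > 0" "\<And>z. dist z 0 < d3 \<Longrightarrow> dist (level_factor z ^ m) (level_factor 0 ^ m) < e'"
    using e'(1) unfolding continuous_on_iff by blast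
  define d where "d = min (min d1 d2) (min (d3 / 2) 1)"
  have d: "d > 0" "d \<le> d1" "d \<le> d2" "d < d3" "d \<le> 1"
    using d1 d2 d3 by (auto simp: d_def)
  have "norm (block_mean n z a - block_limit * level_factor z ^ n) \<le> e + c * C * (real n * cmod z ^ 3)"
    if n: "n \<ge> m" and z: "admissible z" "cmod z \<le> d" for n z a
  proof -
    define L where "L = level_factor z"
    have normy: "cmod (z * lf ^ i) = cmod z" for i
      using norm_lf by (simp add: norm_mult norm_power)
    have L1: "norm (L ^ i) \<le> 1" for i
      unfolding L_def norm_power using norm_level_factor by (simp add: power_le_one)
    have corr1: "norm (corr (z * lf ^ i) b - 1) \<le> e'" for i b
      using d2(2)[of "z * lf ^ i"] z(2) d by (simp add: normy)
    have main: "norm (block_mean (m + j) z b - block_limit * L ^ j * corr (z * lf ^ (m + j)) b)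
        \<le> (2 + c) * e' + real j * (c * C * cmod z ^ 3)" for j b
    proof (induction j arbitrary: b)
      case 0
      have "norm (block_mean m z b - block_limit * corr (z * lf ^ m) b)
          = norm ((block_mean m z b - block_mean m 0 b) + (block_mean m 0 b - block_limit)
               - block_limit * (corr (z * lf ^ m) b - 1))"
        by (simp add: algebra_simps)
      also have "\<dots> \<le> norm (block_mean m z b - block_mean m 0 b) + norm (block_mean m 0 b - block_limit)
               + norm (block_limit * (corr (z * lf ^ m) b - 1))"
        by (meson add_right_mono norm_triangle_ineq norm_triangle_ineq4 order_trans)
      also have "\<dots> \<le> e' + e' + c * e'"
        unfolding norm_mult c_def[symmetric] using d1(2)[of z b] z(2) d m[of b] c0 corr1
        by (intro add_mono mult_left_mono) (auto simp: less_imp_le)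
      finally show ?case
        by (simp add: algebra_simps)
    next
      case (Suc j)
      define y where "y = z * lf ^ (m + j)"
      have y: "admissible y" "cmod y = cmod z" "z * lf ^ (m + Suc j) = y * lf" "level_factor y = L"
        using z(1) by (auto simp: y_def admissible_mult normy L_def level_factor_rotate)
      define err where "err = (\<lambda>k. iexp (Re (y * prefix_sum b k))
          * (block_mean (m + j) z (\<theta> b ! k) - block_limit * L ^ j * corr y (\<theta> b ! k)))"
      have "block_mean (m + Suc j) z b
          = child_mean b (\<lambda>k. err k + block_limit * L ^ j * (iexp (Re (y * prefix_sum b k)) * corr y (\<theta> b ! k)))"
        unfolding add_Suc_right block_mean_Suc y_def[symmetric] err_def
        by (intro arg_cong[of _ _ "child_mean b"]) (simp add: fun_eq_iff algebra_simps)
      also have "\<dots> = child_mean b err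
          + block_limit * L ^ j * child_mean b (\<lambda>k. iexp (Re (y * prefix_sum b k)) * corr y (\<theta> b ! k))"
        by (simp only: child_mean_add child_mean_cmult)
      finally have "block_mean (m + Suc j) z b - block_limit * L ^ Suc j * corr (z * lf ^ (m + Suc j)) b
          = child_mean b err + block_limit * L ^ j
            * (child_mean b (\<lambda>k. iexp (Re (y * prefix_sum b k)) * corr y (\<theta> b ! k)) - L * corr (y * lf) b)"
        unfolding y(3) by (simp add: algebra_simps)
      also have "norm \<dots> \<le> norm (child_mean b err) + norm (block_limit * L ^ j
            * (child_mean b (\<lambda>k. iexp (Re (y * prefix_sum b k)) * corr y (\<theta> b ! k)) - L * corr (y * lf) b))"
        by (rule norm_triangle_ineq)
      also have "\<dots> \<le> ((2 + c) * e' + real j * (c * C * cmod z ^ 3)) + c * 1 * (C * cmod z ^ 3)"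
      proof (rule add_mono)
        show "norm (child_mean b err) \<le> (2 + c) * e' + real j * (c * C * cmod z ^ 3)"
          unfolding err_def using Suc.IH
          by (intro child_mean_bound) (simp add: norm_mult y_def del: times_complex.sel)
        have "norm (child_mean b (\<lambda>k. iexp (Re (y * prefix_sum b k)) * corr y (\<theta> b ! k)) - L * corr (y * lf) b)
            \<le> C * cmod z ^ 3"
          using step[of y b] y z(2) d by simp
        then show "norm (block_limit * L ^ j
            * (child_mean b (\<lambda>k. iexp (Re (y * prefix_sum b k)) * corr y (\<theta> b ! k)) - L * corr (y * lf) b))
            \<le> c * 1 * (C * cmod z ^ 3)"
          unfolding norm_mult c_def[symmetric] using L1[of j] c0
          by (intro mult_mono) auto
      qed
      finally show ?case
        by (simp add: algebra_simps)
    qed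
    define j where "j = n - m"
    have nj: "n = m + j"
      using n by (simp add: j_def)
    have "norm (level_factor z ^ m - 1) \<le> e'"
      using d3(2)[of z] z(2) d by (simp add: dist_norm level_factor_def less_imp_le)
    then have L3: "norm (1 - L ^ m) \<le> e'"
      by (simp add: L_def norm_minus_commute)
    have "norm (block_limit * L ^ j * corr (z * lf ^ n) a - block_limit * L ^ n)
        = norm (block_limit * L ^ j * ((corr (z * lf ^ n) a - 1) + (1 - L ^ m)))"
      by (simp add: nj power_add algebra_simps)
    also have "\<dots> \<le> c * 1 * (e' + e')"
      unfolding norm_mult c_def[symmetric] using L1[of j] c0 e'(1) corr1[of n a] L3
      by (intro mult_mono order_trans[OF norm_triangle_ineq] add_mono) auto
    finally have "norm (block_mean n z a - block_limit * L ^ n)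
        \<le> (2 + c) * e' + real j * (c * C * cmod z ^ 3) + c * (e' + e')"
      using main[of j a] norm_triangle_ineq[of "block_mean n z a - block_limit * L ^ j * corr (z * lf ^ n) a"
          "block_limit * L ^ j * corr (z * lf ^ n) a - block_limit * L ^ n"]
      unfolding nj[symmetric] by simp
    also have "\<dots> = e + c * C * (real j * cmod z ^ 3)"
      using e'(2) by (simp add: algebra_simps)
    also have "\<dots> \<le> e + c * C * (real n * cmod z ^ 3)"
      using C c0 by (intro add_left_mono mult_left_mono mult_right_mono) (auto simp: j_def)
    finally show ?thesis
      by (simp add: L_def)
  qed
  then show ?thesis
    using d(1) C c0 by (intro exI[of _ m] exI[of _ d] exI[of _ "c * C"]) auto
qed

end

section \<open>Prefixes of a fixed point\<close>

context pf_substitution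
begin

lemma subst_seq_shift: "subst_seq \<theta> (w @- v) = inflate w @- subst_seq \<theta> v"
  by (induction w) (auto simp: subst_seq_def inflate_def subst_nonempty)

lemma subst_seq_power_shift: "(subst_seq \<theta> ^^ n) (w @- v) = (inflate ^^ n) w @- (subst_seq \<theta> ^^ n) v"
  by (induction n) (auto simp: subst_seq_shift)

lemma length_inflate_power: "length w \<le> length ((inflate ^^ n) w)"
proof (induction n)
  case (Suc n)
  have "length v \<le> length (inflate v)" for v
  proof (induction v)
    case (Cons a v)
    then show ?case
      using subst_nonempty[of a] by (cases "\<theta> a") (auto simp: inflate_def)
  qed simp
  then show ?case
    using Suc order_trans by (auto simp del: funpow.simps(2) simp: funpow.simps(2))
qed simp

text \<open>
  The prefix contains complete blocks of level \<open>n\<close>, followed by part of one more block.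
\<close>

lemma prefix_decomposition:
  assumes "u = (subst_seq \<theta> ^^ n) v"
  obtains w r where "stake N u = (inflate ^^ n) w @ r" "real (length r) \<le> sigma_inv * sigma_max * lam ^ n"
proof -
  define len where "len = (\<lambda>m. length ((inflate ^^ n) (stake m v)))"
  have "N < len (Suc N)"
    using length_inflate_power[of "stake (Suc N) v" n] by (simp add: len_def del: stake.simps)
  then obtain m where m: "N < len (Suc m)" "\<And>i. i \<le> m \<Longrightarrow> \<not> N < len i"
    using ex_least_nat_less[of "\<lambda>i. N < len i" "Suc N"] by (auto simp: len_def)
  let ?w = "(inflate ^^ n) (stake m v)" and ?b = "(inflate ^^ n) [v !! m]"
  have "u = (inflate ^^ n) (stake (Suc m) v) @- (subst_seq \<theta> ^^ n) (sdrop (Suc m) v)"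
    using assms subst_seq_power_shift[of n "stake (Suc m) v" "sdrop (Suc m) v"] by (simp only: stake_sdrop)
  also have "(inflate ^^ n) (stake (Suc m) v) = ?w @ ?b"
    unfolding stake_Suc by (rule inflate_power_append)
  finally have "stake N u = take N (?w @ ?b) @ stake (N - length (?w @ ?b)) ((subst_seq \<theta> ^^ n) (sdrop (Suc m) v))"
    by (simp only: stake_shift)
  moreover have "N < length (?w @ ?b)"
    using m(1) unfolding len_def stake_Suc inflate_power_append .
  moreover have "length ?w \<le> N"
    using m(2)[of m] by (simp add: len_def)
  ultimately have "stake N u = ?w @ take (N - length ?w) ?b"
    by simp
  moreover have "real (length (take (N - length ?w) ?b)) \<le> sigma_inv * sigma_max * lam ^ n"
  proof -
    have "real (length (take (N - length ?w) ?b)) \<le> real (length ?b)"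
      by simp
    also have "\<dots> \<le> sigma_inv * (lam ^ n * \<sigma> $ (v !! m))"
      using length_le_weight[of ?b] by (simp add: weight_inflate_power)
    also have "\<dots> \<le> sigma_inv * (lam ^ n * sigma_max)"
      using sigma_inv_pos lam_pos sigma_max by (intro mult_left_mono) auto
    finally show ?thesis
      by (simp add: mult_ac)
  qed
  ultimately show ?thesis
    using that by blast
qed

text \<open>
  A sequence fixed by the \<open>p\<close>-th power of the substitution is fixed by the power \<open>p * n \<ge> n\<close>, so it can be
  desubstituted \<open>n\<close> times.
\<close>

lemma fixed_point_desubstitution:
  assumes "subst_fixed_point \<theta> u"
  shows "\<exists>v. u = (subst_seq \<theta> ^^ n) v"
proof -
  obtain p where p: "p > 0" "(subst_seq \<theta> ^^ p) u = u"
    using assms by (auto simp: subst_fixed_point_def)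
  have "(subst_seq \<theta> ^^ (p * n)) u = u"
    by (induction n) (auto simp: funpow_add p(2))
  moreover have "p * n = n + (p * n - n)"
    using p(1) by (cases p) auto
  ultimately show ?thesis
    by (metis comp_apply funpow_add)
qed

end

context real_or_rotating_eigenfunction
begin

lemma norm_iexp_minus_1: "norm (iexp x - 1) \<le> \<bar>x\<bar>"
  using iexp_approx1[of x 0] by simp

lemma word_sum_bound: obtains F where "F \<ge> 0" "\<And>w. norm (word_sum f w) \<le> F * real (length w)"
proof -
  obtain F where F: "F \<ge> 0" "\<And>a. norm (f a) \<le> F"
    using finite_bound[of f] by blast
  have "norm (word_sum f w) \<le> F * real (length w)" for w
  proof (induction w)
    case (Cons a w)
    have "norm (word_sum f (a # w)) \<le> norm (f a) + norm (word_sum f w)"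
      by (simp add: norm_triangle_ineq)
    then show ?case
      using Cons F(2)[of a] by (simp add: algebra_simps)
  qed simp
  then show ?thesis
    using that F(1) by blast
qed

text \<open>
  Errors arise from the blocks themselves and from the phases between the blocks; the latter are at
  most \<open>|z|\<close> times the possible sums of \<open>f\<close> over prefixes of \<open>w\<close>.
\<close>

lemma inflated_word_estimate:
  assumes F: "F \<ge> 0" "\<And>w. norm (word_sum f w) \<le> F * real (length w)"
    and blocks: "\<And>a. norm (block_mean n z a - c) \<le> E"
  shows "norm (phase_sum f z ((inflate ^^ n) w) - c * of_real (lam ^ n * weight w))
     \<le> lam ^ n * weight w * (sigma_inv * (cmod z * (F * real (length w))) + E)"
proof -
  let ?e = "\<lambda>k. iexp (Re (z * lf ^ n * word_sum f (take k w)))"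
  have weight_nth: "(\<Sum>k<length w. \<sigma> $ (w ! k)) = weight w"
    by (simp add: weight_def sum_list_sum_nth atLeast0LessThan)
  have "phase_sum f z ((inflate ^^ n) w) - c * of_real (lam ^ n * weight w)
      = (\<Sum>k<length w. of_real (lam ^ n * \<sigma> $ (w ! k)) * ((?e k - 1) * block_mean n z (w ! k) + (block_mean n z (w ! k) - c)))"
    unfolding phase_sum_inflate_power[of z n w] phase_sum_block weight_nth[symmetric]
    by (simp add: sum_distrib_left sum_subtractf[symmetric] algebra_simps del: times_complex.sel)
  also have "norm \<dots> \<le> (\<Sum>k<length w. lam ^ n * \<sigma> $ (w ! k) * (sigma_inv * (cmod z * (F * real (length w))) + E))"
  proof (rule sum_norm_le)
    fix k assume "k \<in> {..<length w}"
    have "norm (?e k - 1) \<le> \<bar>Re (z * lf ^ n * word_sum f (take k w))\<bar>"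
      by (rule norm_iexp_minus_1)
    also have "\<dots> \<le> cmod (z * lf ^ n * word_sum f (take k w))"
      by (rule abs_Re_le_cmod)
    also have "\<dots> = cmod z * norm (word_sum f (take k w))"
      by (simp add: norm_mult norm_power norm_lf)
    also have "\<dots> \<le> cmod z * (F * real (length w))"
      by (intro mult_left_mono order_trans[OF F(2)] F(1)) auto
    finally have "norm ((?e k - 1) * block_mean n z (w ! k)) \<le> cmod z * (F * real (length w)) * sigma_inv"
      unfolding norm_mult using norm_block_mean F(1) by (intro mult_mono) auto
    then have "norm ((?e k - 1) * block_mean n z (w ! k) + (block_mean n z (w ! k) - c))
        \<le> sigma_inv * (cmod z * (F * real (length w))) + E"
      using blocks[of "w ! k"] by (intro order_trans[OF norm_triangle_ineq]) (simp add: mult_ac)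
    then show "norm (of_real (lam ^ n * \<sigma> $ (w ! k)) * ((?e k - 1) * block_mean n z (w ! k) + (block_mean n z (w ! k) - c)))
        \<le> lam ^ n * \<sigma> $ (w ! k) * (sigma_inv * (cmod z * (F * real (length w))) + E)"
      unfolding norm_mult[of "of_real _"] norm_of_real using lam_pos sigma_pos[of "w ! k"]
      by (simp add: abs_mult mult_left_mono)
  qed
  also have "\<dots> = lam ^ n * weight w * (sigma_inv * (cmod z * (F * real (length w))) + E)"
    by (simp add: weight_nth[symmetric] sum_distrib_left sum_distrib_right mult_ac)
  finally show ?thesis .
qed

text \<open>
  The sum over \<open>{1..N}\<close> and the sum over \<open>{0..<N}\<close> differ only in the terms at 0 and at \<open>N\<close>.
\<close>

lemma phase_sum_prefix: 
  "norm ((\<Sum>k\<in>{1..N}. iexp (Re (z * word_sum f (stake k u)))) - phase_sum f z (stake N u)) \<le> 2"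
proof -
  let ?e = "\<lambda>k. iexp (Re (z * word_sum f (stake k u)))"
  have "phase_sum f z (stake N u) = (\<Sum>k<N. ?e k)"
    by (simp add: phase_sum_def take_stake min_def del: times_complex.sel)
  moreover have "?e N + (\<Sum>k<N. ?e k) = ?e 0 + (\<Sum>k\<in>{1..N}. ?e k)"
  proof -
    have "(\<Sum>k<Suc N. ?e k) = ?e 0 + (\<Sum>k\<in>{1..N}. ?e k)"
      unfolding lessThan_Suc_atMost atMost_atLeast0 by (subst sum.atLeast_Suc_atMost) auto
    then show ?thesis
      by (simp add: add.commute del: times_complex.sel)
  qed
  ultimately have "(\<Sum>k\<in>{1..N}. ?e k) - phase_sum f z (stake N u) = ?e N - ?e 0"
    by (simp add: algebra_simps del: times_complex.sel)
  then show ?thesis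
    using norm_triangle_ineq4[of "?e N" "?e 0"] by (simp del: times_complex.sel)
qed

text \<open>
  The level \<open>n\<close> is chosen with \<open>lam\<^sup>n \<le> e1 N < lam\<^sup>n\<^sup>+\<^sup>1\<close>: the incomplete last block is then a small
  proportion of the prefix, while the number of complete blocks stays bounded as \<open>N\<close> grows, so the
  phases between them are negligible for small \<open>z\<close>. Comparing with frequency 0, where
  the sum is the length, eliminates the density \<open>block_limit\<close>.
\<close>

lemma prefix_mean_asymptotics:
  assumes u: "\<And>n. \<exists>v. u = (subst_seq \<theta> ^^ n) v" and "e > 0"
  shows "\<exists>C d j N0. C \<ge> 0 \<and> d > 0 \<and> j \<ge> 0 \<and>
     (\<forall>N\<ge>N0. \<forall>z. admissible z \<and> cmod z \<le> d \<longrightarrow>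
        (\<exists>n. \<bar>real n - log lam (real N)\<bar> \<le> j \<and>
          norm ((\<Sum>k\<in>{1..N}. iexp (Re (z * word_sum f (stake k u)))) / of_nat N - level_factor z ^ n)
            \<le> e + C * (cmod z + real n * cmod z ^ 3)))"
proof -
  obtain F where F: "F \<ge> 0" "\<And>w. norm (word_sum f w) \<le> F * real (length w)"
    using word_sum_bound by blast
  define K where "K = sigma_inv * sigma_max"
  have K: "K > 0"
    using sigma_inv_pos sigma_max_pos by (simp add: K_def)
  define e1 e2 where "e1 = e / (8 * K)" and "e2 = e / (8 * sigma_max)"
  have e12: "e1 > 0" "e2 > 0" "K * e1 = e / 8" "sigma_max * e2 = e / 8"
    using \<open>e > 0\<close> K sigma_max_pos by (auto simp: e1_def e2_def)
  obtain m d C where d: "d > 0" and C: "C \<ge> 0" and blocks: "\<And>n z a. n \<ge> m \<Longrightarrow> admissible z \<Longrightarrow> cmod z \<le> d \<Longrightarrow>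
      norm (block_mean n z a - block_limit * level_factor z ^ n) \<le> e2 + C * (real n * cmod z ^ 3)"
    using block_mean_asymptotics[OF e12(2)] by blast
  define N0 where "N0 = nat \<lceil>max (8 / e) (lam ^ Suc m / e1)\<rceil> + 1"
  define C' where "C' = sigma_max * (sigma_inv * (F * (K * lam / e1))) + sigma_max * C"
  define j where "j = \<bar>log lam e1\<bar> + 1"
  have "\<exists>n. \<bar>real n - log lam (real N)\<bar> \<le> j \<and>
          norm ((\<Sum>k\<in>{1..N}. iexp (Re (z * word_sum f (stake k u)))) / of_nat N - level_factor z ^ n)
            \<le> e + C' * (cmod z + real n * cmod z ^ 3)"
    if N: "N \<ge> N0" and z: "admissible z" "cmod z \<le> d" for N z
  proof -
    have N1: "real N \<ge> 8 / e" "real N \<ge> lam ^ Suc m / e1" and Npos: "N > 0"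
      using N unfolding N0_def by linarith+
    have big: "lam ^ Suc m \<le> e1 * real N"
      using N1(2) e12(1) by (simp add: pos_divide_le_eq mult.commute)
    have pos: "e1 * real N > 0"
      using e12(1) Npos by simp
    have loge: "log lam (e1 * real N) = log lam e1 + log lam (real N)"
      using e12(1) Npos by (simp add: log_mult)
    have "log lam (lam ^ Suc m) \<le> log lam (e1 * real N)"
      using big pos lam_gt_1 lam_pos by (subst log_le_cancel_iff) auto
    then have logm: "real (Suc m) \<le> log lam (e1 * real N)"
      using lam_gt_1 lam_pos by (simp add: log_nat_power del: power_Suc)
    define n where "n = nat \<lfloor>log lam (e1 * real N)\<rfloor>"
    have n: "real n \<le> log lam (e1 * real N)" "log lam (e1 * real N) < real n + 1"
      using logm unfolding n_def by linarith+
    have nm: "n \<ge> m"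
      using logm n by linarith
    have pow: "lam ^ n \<le> e1 * real N"
    proof -
      have "lam powr real n \<le> lam powr (log lam (e1 * real N))"
        using n(1) lam_gt_1 by (intro powr_mono) auto
      then show ?thesis
        using pos lam_gt_1 lam_pos by (simp add: powr_realpow)
    qed
    have pow': "e1 * real N \<le> lam * lam ^ n"
    proof -
      have "lam powr (log lam (e1 * real N)) \<le> lam powr (real (Suc n))"
        using n(2) lam_gt_1 by (intro powr_mono) auto
      then show ?thesis
        using pos lam_gt_1 lam_pos powr_realpow[of lam "Suc n"] by simp
    qed
    have close: "\<bar>real n - log lam (real N)\<bar> \<le> j"
      using n loge unfolding j_def by linarith
    obtain v where v: "u = (subst_seq \<theta> ^^ n) v"
      using u by blast
    obtain w r where wr: "stake N u = (inflate ^^ n) w @ r" "real (length r) \<le> sigma_inv * sigma_max * lam ^ n"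
      using prefix_decomposition[OF v] .
    let ?W = "(inflate ^^ n) w" and ?L = "level_factor z ^ n" and ?S = "phase_sum f z (stake N u)"
    have lenN: "length ?W + length r = N"
      using arg_cong[OF wr(1), of length] by simp
    have wW: "lam ^ n * weight w \<le> sigma_max * real N"
    proof -
      have "lam ^ n * weight w = weight ?W"
        by (simp add: weight_inflate_power)
      also have "\<dots> \<le> sigma_max * real (length ?W)"
        by (rule weight_le_length)
      also have "\<dots> \<le> sigma_max * real N"
        using lenN sigma_max_pos by (intro mult_left_mono) auto
      finally show ?thesis .
    qed
    have lamn: "lam ^ n > 0"
      using lam_pos by simp
    have lenw: "real (length w) \<le> K * lam / e1"
    proof -
      have "lam ^ n * real (length w) \<le> lam ^ n * (sigma_inv * weight w)"
        using length_le_weight lamn by (intro mult_left_mono) auto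
      also have "\<dots> = sigma_inv * (lam ^ n * weight w)"
        by simp
      also have "\<dots> \<le> sigma_inv * (sigma_max * real N)"
        using wW sigma_inv_pos by (intro mult_left_mono) auto
      also have "\<dots> = K / e1 * (e1 * real N)"
        using e12(1) by (simp add: K_def)
      also have "\<dots> \<le> K / e1 * (lam * lam ^ n)"
        using pow' K e12(1) by (intro mult_left_mono) auto
      finally have "lam ^ n * real (length w) \<le> lam ^ n * (K * lam / e1)"
        by (simp add: mult_ac)
      then show ?thesis
        using lamn by (rule mult_left_le_imp_le)
    qed
    have adm0: "admissible 0"
      by (simp add: admissible_def)
    define E where "E = C * (real n * cmod z ^ 3)"
    have E0: "E \<ge> 0"
      using C by (simp add: E_def)
    define G where "G = sigma_inv * (F * (K * lam / e1))"
    have "norm (phase_sum f z ?W - block_limit * ?L * of_real (lam ^ n * weight w))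
        \<le> lam ^ n * weight w * (sigma_inv * (cmod z * (F * real (length w))) + (e2 + E))"
      using blocks[OF nm z] unfolding E_def by (intro inflated_word_estimate[OF F])
    also have "\<dots> \<le> lam ^ n * weight w * (G * cmod z + (e2 + E))"
    proof -
      have "sigma_inv * (cmod z * (F * real (length w))) \<le> sigma_inv * (cmod z * (F * (K * lam / e1)))"
        using lenw sigma_inv_pos F(1) by (intro mult_left_mono) auto
      then show ?thesis
        using lamn weight_nonneg[of w] by (intro mult_left_mono) (auto simp: G_def mult_ac)
    qed
    finally have A: "norm (phase_sum f z ?W - block_limit * ?L * of_real (lam ^ n * weight w))
        \<le> lam ^ n * weight w * (G * cmod z + (e2 + E))" .
    have lf0: "level_factor 0 = 1"
      by (simp add: level_factor_def)
    have "norm (phase_sum f 0 ?W - block_limit * of_real (lam ^ n * weight w))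
        \<le> lam ^ n * weight w * (sigma_inv * (cmod 0 * (F * real (length w))) + e2)"
      using blocks[OF nm adm0] d by (intro inflated_word_estimate[OF F]) (simp add: lf0)
    then have B: "norm (of_nat (length ?W) - block_limit * of_real (lam ^ n * weight w)) \<le> lam ^ n * weight w * e2"
      by (simp add: phase_sum_0)
    have L1: "norm ?L \<le> 1"
      unfolding norm_power using norm_level_factor by (simp add: power_le_one)
    have "norm (phase_sum f z ?W - ?L * of_nat (length ?W))
        = norm ((phase_sum f z ?W - block_limit * ?L * of_real (lam ^ n * weight w))
              - ?L * (of_nat (length ?W) - block_limit * of_real (lam ^ n * weight w)))"
      by (simp add: algebra_simps)
    also have "\<dots> \<le> lam ^ n * weight w * (G * cmod z + (e2 + E)) + 1 * (lam ^ n * weight w * e2)"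
    proof (rule order_trans[OF norm_triangle_ineq4 add_mono[OF A]])
      show "norm (?L * (of_nat (length ?W) - block_limit * of_real (lam ^ n * weight w))) \<le> 1 * (lam ^ n * weight w * e2)"
        unfolding norm_mult[of ?L] using B L1 by (intro mult_mono) auto
    qed
    also have "\<dots> = lam ^ n * weight w * (G * cmod z + E + 2 * e2)"
      by (simp add: algebra_simps)
    also have "\<dots> \<le> sigma_max * real N * (G * cmod z + E + 2 * e2)"
      using wW E0 e12 sigma_inv_pos F(1) K lam_pos by (intro mult_right_mono) (auto simp: G_def)
    finally have main: "norm (phase_sum f z ?W - ?L * of_nat (length ?W)) \<le> sigma_max * real N * (G * cmod z + E + 2 * e2)" .
    have lr: "real (length r) \<le> e / 8 * real N"
    proof -
      have "real (length r) \<le> K * (e1 * real N)"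
        using wr(2) mult_left_mono[OF pow, of K] K by (simp add: K_def)
      then show ?thesis
        using e12(3) by (simp add: mult.assoc[symmetric])
    qed
    have "?S - ?L * of_nat N = (phase_sum f z ?W - ?L * of_nat (length ?W))
        + (iexp (Re (z * word_sum f ?W)) * phase_sum f z r - ?L * of_nat (length r))"
    proof -
      have "?S = phase_sum f z ?W + iexp (Re (z * word_sum f ?W)) * phase_sum f z r"
        unfolding wr(1) phase_sum_append ..
      moreover have "(of_nat N :: complex) = of_nat (length ?W) + of_nat (length r)"
        by (simp add: lenN flip: of_nat_add)
      ultimately show ?thesis
        by (simp only: algebra_simps)
    qed
    also have "norm \<dots> \<le> sigma_max * real N * (G * cmod z + E + 2 * e2) + (real (length r) + real (length r))"
    proof (intro order_trans[OF norm_triangle_ineq] add_mono main)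
      have "norm (iexp (Re (z * word_sum f ?W)) * phase_sum f z r) \<le> real (length r)"
        using norm_phase_sum[of f z r] by (simp add: norm_mult del: times_complex.sel)
      moreover have "norm (?L * of_nat (length r)) \<le> real (length r)"
        using mult_right_mono[OF L1, of "real (length r)"] by (simp add: norm_mult)
      ultimately show "norm (iexp (Re (z * word_sum f ?W)) * phase_sum f z r - ?L * of_nat (length r))
          \<le> real (length r) + real (length r)"
        by (intro order_trans[OF norm_triangle_ineq4] add_mono)
    qed
    finally have S: "norm (?S - ?L * of_nat N) \<le> sigma_max * real N * (G * cmod z + E + 2 * e2) + 2 * (e / 8 * real N)"
      using lr by linarith
    have two: "2 \<le> e / 4 * real N"
      using N1(1) \<open>e > 0\<close> by (simp add: pos_divide_le_eq mult.commute)
    let ?T = "\<Sum>k\<in>{1..N}. iexp (Re (z * word_sum f (stake k u)))"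
    have "norm (?T - ?L * of_nat N) \<le> norm (?T - ?S) + norm (?S - ?L * of_nat N)"
      using norm_triangle_ineq[of "?T - ?S" "?S - ?L * of_nat N"] by simp
    also have "\<dots> \<le> e / 4 * real N + (sigma_max * real N * (G * cmod z + E + 2 * e2) + 2 * (e / 8 * real N))"
      using phase_sum_prefix[where N = N and z = z and u = u] two S by linarith
    also have "\<dots> = (e / 2 + sigma_max * (G * cmod z + E) + 2 * (sigma_max * e2)) * real N"
      by (simp add: algebra_simps)
    also have "\<dots> \<le> (e + sigma_max * (G * cmod z + E)) * real N"
      using e12(4) \<open>e > 0\<close> by (intro mult_right_mono) auto
    finally have T: "norm (?T - ?L * of_nat N) \<le> (e + sigma_max * (G * cmod z + E)) * real N" .
    have "norm (?T / of_nat N - ?L) = norm (?T - ?L * of_nat N) / real N"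
    proof -
      have "?T / of_nat N - ?L = (?T - ?L * of_nat N) / of_nat N"
        using Npos by (simp add: diff_divide_distrib)
      then show ?thesis
        by (simp add: norm_divide)
    qed
    also have "\<dots> \<le> e + sigma_max * (G * cmod z + E)"
      using T Npos by (simp add: pos_divide_le_eq)
    also have "\<dots> \<le> e + C' * (cmod z + real n * cmod z ^ 3)"
    proof -
      have "0 \<le> sigma_max * C * cmod z" "0 \<le> sigma_max * G * (real n * cmod z ^ 3)"
        using sigma_max_pos C sigma_inv_pos F(1) K e12(1) lam_pos by (auto simp: G_def)
      moreover have "C' = sigma_max * G + sigma_max * C"
        by (simp add: C'_def G_def)
      ultimately show ?thesis
        by (simp add: E_def algebra_simps)
    qed
    finally show ?thesis
      using close by blast
  qed
  moreover have "C' \<ge> 0"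
    using sigma_max_pos C sigma_inv_pos F(1) K e12(1) lam_pos by (auto simp: C'_def)
  ultimately show ?thesis
    using d by (intro exI[of _ C'] exI[of _ d] exI[of _ j] exI[of _ N0]) (auto simp: j_def)
qed

lemma exp_neg_lipschitz:
  fixes x y :: real
  assumes "x \<le> 0" "y \<le> 0"
  shows "\<bar>exp x - exp y\<bar> \<le> \<bar>x - y\<bar>"
proof -
  have *: "exp b - exp a \<le> b - a" if "a \<le> b" "b \<le> 0" for a b :: real
  proof -
    have "exp b - exp a = exp b * (1 - exp (a - b))"
      by (simp add: algebra_simps exp_diff)
    also have "\<dots> \<le> 1 * (b - a)"
    proof (rule mult_mono)
      show "1 - exp (a - b) \<le> b - a"
        using exp_ge_add_one_self[of "a - b"] by linarith
    qed (use that in auto)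
    finally show ?thesis by simp
  qed
  show ?thesis
    using *[of x y] *[of y x] assms by (cases "x \<le> y") auto
qed

text \<open>
  With \<open>L = log\<^sub>\<lambda> N\<close> and \<open>x = L\<^sup>-\<^sup>1\<^sup>/\<^sup>2\<close> the frequency is \<open>x z\<close>, and the number of levels is \<open>L\<close> up to a bounded
  error \<open>j\<close>. All error terms other than the prescribed \<open>e / 2\<close> are collected in \<open>h x\<close>, which tends
  to 0 with \<open>x\<close>.
\<close>

theorem prefix_characteristic_limit:
  assumes u: "\<And>n. \<exists>v. u = (subst_seq \<theta> ^^ n) v" and z: "admissible z"
  shows "(\<lambda>N. (\<Sum>k\<in>{1..N}. iexp (Re (z * ((word_sum f (stake k u) - of_real (log lam (real N)) * drift_per_level)
              / of_real (sqrt (log lam (real N))))))) / of_nat N)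
         \<longlonglongrightarrow> of_real (exp (- rate * (cmod z)\<^sup>2))"
proof (rule LIMSEQ_I)
  fix e :: real assume "e > 0"
  define q where "q = (\<lambda>N. 1 / sqrt (log lam (real N)))"
  have q0: "q \<longlonglongrightarrow> 0"
    unfolding q_def using lam_gt_1 by real_asymp
  obtain C d j N0 where C: "C \<ge> 0" and d: "d > 0" and j: "j \<ge> 0" and approx:
     "\<And>N z. N \<ge> N0 \<Longrightarrow> admissible z \<Longrightarrow> cmod z \<le> d \<Longrightarrow>
        \<exists>n. \<bar>real n - log lam (real N)\<bar> \<le> j \<and>
          norm ((\<Sum>k\<in>{1..N}. iexp (Re (z * word_sum f (stake k u)))) / of_nat N - level_factor z ^ n)
            \<le> e / 2 + C * (cmod z + real n * cmod z ^ 3)"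
    using prefix_mean_asymptotics[OF u, of "e / 2"] \<open>e > 0\<close> by (metis half_gt_zero)
  define h where "h = (\<lambda>x. C * (cmod z * x + (1 + j * x\<^sup>2) * cmod z ^ 3 * x)
      + (j * cmod z * cmod drift_per_level * x + rate * (cmod z)\<^sup>2 * j * x\<^sup>2))"
  have "isCont h 0"
    unfolding h_def by (intro continuous_intros)
  then have "(\<lambda>N. h (q N)) \<longlonglongrightarrow> h 0"
    using q0 by (rule isCont_tendsto_compose)
  then have h0: "(\<lambda>N. h (q N)) \<longlonglongrightarrow> 0"
    by (simp add: h_def)
  have ev1: "\<forall>\<^sub>F N in sequentially. h (q N) < e / 2"
    by (rule order_tendstoD(2)[OF h0]) (use \<open>e > 0\<close> in simp)
  have "(\<lambda>N. cmod z * q N) \<longlonglongrightarrow> 0"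
    using q0 by (rule tendsto_mult_right_zero)
  then have ev2: "\<forall>\<^sub>F N in sequentially. cmod z * q N < d"
    using order_tendstoD(2) d by blast
  have ev3: "\<forall>\<^sub>F N in sequentially. log lam (real N) > 0"
    using lam_gt_1 by real_asymp
  have "\<forall>\<^sub>F N in sequentially. norm ((\<Sum>k\<in>{1..N}. iexp (Re (z * ((word_sum f (stake k u)
            - of_real (log lam (real N)) * drift_per_level) / of_real (sqrt (log lam (real N))))))) / of_nat N
          - of_real (exp (- rate * (cmod z)\<^sup>2))) < e"
    using ev1 ev2 ev3 eventually_ge_at_top[of N0]
  proof eventually_elim
    case (elim N)
    define L x y where "L = log lam (real N)" and "x = q N" and "y = of_real x * z"
    have L: "L > 0" and x: "x > 0" "x\<^sup>2 * L = 1" "x = 1 / sqrt L"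
      using elim(3) by (auto simp: L_def x_def q_def power_divide)
    have y: "admissible y" "cmod y = x * cmod z"
      using z x(1) by (auto simp: admissible_def y_def norm_mult intro: Reals_mult)
    obtain n where n: "\<bar>real n - L\<bar> \<le> j" and A:
      "norm ((\<Sum>k\<in>{1..N}. iexp (Re (y * word_sum f (stake k u)))) / of_nat N - level_factor y ^ n)
            \<le> e / 2 + C * (cmod y + real n * cmod y ^ 3)"
      using approx[OF elim(4) y(1)] elim(2) by (auto simp: y(2) x_def L_def mult.commute)
    define t where "t = Re (y * drift_per_level)"
    have t: "\<bar>t\<bar> \<le> x * cmod z * cmod drift_per_level"
      unfolding t_def using abs_Re_le_cmod[of "y * drift_per_level"] by (simp add: norm_mult y(2))
    have summand: "iexp (Re (z * ((word_sum f (stake k u) - of_real L * drift_per_level) / of_real (sqrt L))))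
        = iexp (- L * t) * iexp (Re (y * word_sum f (stake k u)))" for k
    proof -
      have re_scale: "Re (of_real (- L) * v) = - L * Re v" for v
        by simp
      have "z * ((word_sum f (stake k u) - of_real L * drift_per_level) / of_real (sqrt L))
          = of_real (- L) * (y * drift_per_level) + y * word_sum f (stake k u)"
        by (simp add: y_def x(3) diff_divide_distrib right_diff_distrib mult_ac)
      then have "Re (z * ((word_sum f (stake k u) - of_real L * drift_per_level) / of_real (sqrt L)))
          = - L * t + Re (y * word_sum f (stake k u))"
        by (simp only: plus_complex.sel t_def re_scale)
      then show ?thesis
        by (simp only: iexp_add)
    qed
    have power: "level_factor y ^ n = iexp (real n * t) * of_real (exp (- rate * (cmod y)\<^sup>2 * real n))"
    proof -
      have "iexp t ^ n = iexp (real n * t)"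
        by (simp add: exp_of_nat_mult[symmetric] algebra_simps)
      then show ?thesis
        by (simp add: level_factor_def t_def[symmetric] power_mult_distrib exp_of_nat_mult[symmetric]
            mult_ac del: times_complex.sel flip: of_real_power exp_of_real)
    qed
    let ?A = "(\<Sum>k\<in>{1..N}. iexp (Re (y * word_sum f (stake k u)))) / of_nat N"
    let ?r = "exp (- rate * (cmod y)\<^sup>2 * real n)" and ?r' = "exp (- rate * (cmod z)\<^sup>2)"
    have "(\<Sum>k\<in>{1..N}. iexp (Re (z * ((word_sum f (stake k u) - of_real L * drift_per_level) / of_real (sqrt L))))) / of_nat N
          - of_real ?r' = iexp (- L * t) * (?A - level_factor y ^ n)
            + ((iexp ((real n - L) * t) - 1) * of_real ?r + of_real (?r - ?r'))"
    proof -
      have "iexp (- L * t) * level_factor y ^ n = iexp ((real n - L) * t) * of_real ?r"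
        unfolding power mult.assoc[symmetric] iexp_add[symmetric] by (simp add: algebra_simps)
      then show ?thesis
        unfolding summand sum_distrib_left[symmetric] by (simp add: algebra_simps)
    qed
    also have "norm \<dots> \<le> norm (?A - level_factor y ^ n) + (\<bar>(real n - L) * t\<bar> * 1 + \<bar>?r - ?r'\<bar>)"
    proof (intro order_trans[OF norm_triangle_ineq] add_mono)
      show "norm (iexp (- L * t) * (?A - level_factor y ^ n)) \<le> norm (?A - level_factor y ^ n)"
        by (simp only: norm_mult norm_exp_i_times mult_1)
      have "?r \<le> 1"
        using rate_nonneg by simp
      then show "norm ((iexp ((real n - L) * t) - 1) * of_real ?r) \<le> \<bar>(real n - L) * t\<bar> * 1"
        unfolding norm_mult by (intro mult_mono norm_iexp_minus_1) auto
    qed (simp only: norm_of_real order_refl)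
    also have "\<dots> \<le> (e / 2 + C * (cmod z * x + (1 + j * x\<^sup>2) * cmod z ^ 3 * x))
        + (j * cmod z * cmod drift_per_level * x + rate * (cmod z)\<^sup>2 * j * x\<^sup>2)"
    proof (intro add_mono)
      have "real n * x\<^sup>2 \<le> (L + j) * x\<^sup>2"
        using n by (intro mult_right_mono) auto
      also have "\<dots> = 1 + j * x\<^sup>2"
        using x(2) by (simp add: algebra_simps)
      finally have "real n * x\<^sup>2 * (cmod z ^ 3 * x) \<le> (1 + j * x\<^sup>2) * (cmod z ^ 3 * x)"
        using x(1) by (intro mult_right_mono) auto
      then have "cmod y + real n * cmod y ^ 3 \<le> cmod z * x + (1 + j * x\<^sup>2) * cmod z ^ 3 * x"
        unfolding y(2) by (simp add: power_mult_distrib power2_eq_square power3_eq_cube mult_ac)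
      then have "C * (cmod y + real n * cmod y ^ 3) \<le> C * (cmod z * x + (1 + j * x\<^sup>2) * cmod z ^ 3 * x)"
        using C by (rule mult_left_mono)
      then show "norm (?A - level_factor y ^ n) \<le> e / 2 + C * (cmod z * x + (1 + j * x\<^sup>2) * cmod z ^ 3 * x)"
        using A by linarith
      have "\<bar>(real n - L) * t\<bar> \<le> j * (x * cmod z * cmod drift_per_level)"
        unfolding abs_mult using n t j by (intro mult_mono) auto
      then show "\<bar>(real n - L) * t\<bar> * 1 \<le> j * cmod z * cmod drift_per_level * x"
        by (simp add: mult_ac)
      have "\<bar>?r - ?r'\<bar> \<le> \<bar>- rate * (cmod y)\<^sup>2 * real n - - rate * (cmod z)\<^sup>2\<bar>"
        using rate_nonneg by (intro exp_neg_lipschitz) auto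
      also have "- rate * (cmod y)\<^sup>2 * real n - - rate * (cmod z)\<^sup>2 = rate * (cmod z)\<^sup>2 * (x\<^sup>2 * L - x\<^sup>2 * real n)"
        unfolding x(2) y(2) by (simp add: power_mult_distrib algebra_simps)
      also have "\<bar>\<dots>\<bar> = rate * (cmod z)\<^sup>2 * x\<^sup>2 * \<bar>real n - L\<bar>"
        using rate_nonneg by (simp add: right_diff_distrib[symmetric] abs_mult abs_minus_commute)
      also have "\<dots> \<le> rate * (cmod z)\<^sup>2 * x\<^sup>2 * j"
        using n rate_nonneg by (intro mult_left_mono) auto
      finally show "\<bar>?r - ?r'\<bar> \<le> rate * (cmod z)\<^sup>2 * j * x\<^sup>2"
        by (simp add: mult_ac)
    qed
    also have "\<dots> = e / 2 + h x"
      by (simp add: h_def)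
    also have "\<dots> < e"
      using elim(1) by (simp add: x_def)
    finally show ?case
      unfolding L_def .
  qed
  then show "\<exists>no. \<forall>N\<ge>no. norm ((\<Sum>k\<in>{1..N}. iexp (Re (z * ((word_sum f (stake k u)
            - of_real (log lam (real N)) * drift_per_level) / of_real (sqrt (log lam (real N))))))) / of_nat N
          - of_real (exp (- rate * (cmod z)\<^sup>2))) < e"
    by (simp only: eventually_sequentially)
qed

end

section \<open>Time reversal and the asymptotic variance\<close>

context pf_substitution
begin

abbreviation letter_at :: "'a \<times> nat \<Rightarrow> 'a" where
  "letter_at x \<equiv> \<theta> (fst x) ! (snd x - 1)"

definition pair_mean :: "('a \<Rightarrow> nat \<Rightarrow> complex) \<Rightarrow> complex" where
  "pair_mean h = stat_mean (\<lambda>a. child_mean a (h a))"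

definition state_mean :: "('a \<times> nat \<Rightarrow> complex) \<Rightarrow> complex" where
  "state_mean F = (\<Sum>x\<in>chain_states \<theta>. of_real (chain_law \<theta> lam \<rho> \<sigma> x) * F x)"

definition trans_mean :: "('a \<times> nat \<Rightarrow> complex) \<Rightarrow> 'a \<times> nat \<Rightarrow> complex" where
  "trans_mean F x = (\<Sum>y\<in>chain_states \<theta>. of_real (chain_trans \<theta> lam \<rho> x y) * F y)"

lemma chain_states_eq: "chain_states \<theta> = (\<lambda>(a, k). (a, Suc k)) ` (SIGMA a:UNIV. {..<length (\<theta> a)})"
proof -
  have "(a, j) \<in> (\<lambda>(a, k). (a, Suc k)) ` (SIGMA a:UNIV. {..<length (\<theta> a)})"
    if "1 \<le> j" "j \<le> length (\<theta> a)" for a j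
    using that by (intro image_eqI[of _ _ "(a, j - 1)"]) auto
  then show ?thesis
    by (auto simp: chain_states_def)
qed

lemma finite_chain_states: "finite (chain_states \<theta>)"
  unfolding chain_states_eq by auto

lemma sum_chain_states:
  "(\<Sum>x\<in>chain_states \<theta>. F x) = (\<Sum>a\<in>UNIV. \<Sum>k<length (\<theta> a). F (a, Suc k))"
proof -
  have "(\<Sum>x\<in>chain_states \<theta>. F x) = (\<Sum>p\<in>(SIGMA a:UNIV. {..<length (\<theta> a)}). F (case p of (a, k) \<Rightarrow> (a, Suc k)))"
    unfolding chain_states_eq by (subst sum.reindex) (auto simp: inj_on_def)
  also have "\<dots> = (\<Sum>a\<in>UNIV. \<Sum>k<length (\<theta> a). F (a, Suc k))"
    by (subst sum.Sigma) (auto intro!: sum.cong)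
  finally show ?thesis .
qed

lemma chain_law_eq: "chain_law \<theta> lam \<rho> \<sigma> (a, Suc k) = \<sigma> $ a * \<rho> $ a * child_prob a k"
  using sigma_pos[of a] by (simp add: chain_law_def sigma_hat_def rho_hat_def child_prob_def)

lemma state_mean_eq: "state_mean F = pair_mean (\<lambda>a k. F (a, Suc k))"
  unfolding state_mean_def sum_chain_states pair_mean_def stat_mean_def child_mean_def chain_law_eq
  by (simp add: sum_distrib_left mult_ac)

text \<open>
  The transition matrix \<open>chain_trans\<close> climbs from a letter to its parents. Its adjoint with respect to
  the stationary law descends: it averages over the children of the letter at the current position.
\<close>

lemma time_reversal:
  "state_mean (\<lambda>x. H x * trans_mean F x)
     = state_mean (\<lambda>y. child_mean (letter_at y) (\<lambda>j. H (letter_at y, Suc j)) * F y)"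
proof -
  let ?S = "chain_states \<theta>" and ?m = "\<lambda>x. complex_of_real (chain_law \<theta> lam \<rho> \<sigma> x)"
    and ?p = "\<lambda>x y. complex_of_real (chain_trans \<theta> lam \<rho> x y)"
  have "(\<Sum>x\<in>?S. ?m x * ?p x y * H x) = ?m y * child_mean (letter_at y) (\<lambda>j. H (letter_at y, Suc j))" for y
  proof -
    have "?m (a, Suc k) * ?p (a, Suc k) y = (if a = letter_at y then ?m y * of_real (child_prob a k) else 0)" for a k
    proof (cases "a = letter_at y")
      case True
      have "chain_law \<theta> lam \<rho> \<sigma> (a, Suc k) * chain_trans \<theta> lam \<rho> (a, Suc k) y = chain_law \<theta> lam \<rho> \<sigma> y * child_prob a k"
        using True sigma_pos[of a] rho_pos[of a] lam_pos
        by (simp add: chain_law_eq chain_trans_def chain_law_def sigma_hat_def rho_hat_def split_beta child_prob_def)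
      then show ?thesis
        using True by (simp flip: of_real_mult)
    qed (simp add: chain_trans_def)
    then have "(\<Sum>x\<in>?S. ?m x * ?p x y * H x)
        = (\<Sum>a\<in>UNIV. \<Sum>k<length (\<theta> a). if a = letter_at y then ?m y * of_real (child_prob a k) * H (a, Suc k) else 0)"
      unfolding sum_chain_states by (intro sum.cong refl) simp
    also have "\<dots> = (\<Sum>a\<in>UNIV. if a = letter_at y then (\<Sum>k<length (\<theta> a). ?m y * of_real (child_prob a k) * H (a, Suc k)) else 0)"
      by (intro sum.cong refl) auto
    also have "\<dots> = ?m y * child_mean (letter_at y) (\<lambda>j. H (letter_at y, Suc j))"
      by (simp add: child_mean_def sum_distrib_left mult_ac)
    finally show ?thesis .
  qed
  then have "state_mean (\<lambda>y. child_mean (letter_at y) (\<lambda>j. H (letter_at y, Suc j)) * F y)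
      = (\<Sum>y\<in>?S. (\<Sum>x\<in>?S. ?m x * ?p x y * H x) * F y)"
    unfolding state_mean_def by (simp add: mult.assoc)
  also have "\<dots> = (\<Sum>x\<in>?S. \<Sum>y\<in>?S. ?m x * ?p x y * H x * F y)"
    unfolding sum_distrib_right by (rule sum.swap)
  also have "\<dots> = state_mean (\<lambda>x. H x * trans_mean F x)"
    by (simp add: state_mean_def trans_mean_def sum_distrib_left mult_ac)
  finally show ?thesis by simp
qed

lemma state_mean_trans_power:
  "state_mean (\<lambda>x. H x * (trans_mean ^^ Suc n) F x)
     = pair_mean (\<lambda>a k. (step_mean ^^ n) (\<lambda>b. child_mean b (\<lambda>j. H (b, Suc j))) (\<theta> a ! k) * F (a, Suc k))"
proof (induction n arbitrary: H)
  case 0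
  then show ?case
    by (simp add: time_reversal) (simp add: state_mean_eq)
next
  case (Suc n)
  let ?E = "\<lambda>b. child_mean b (\<lambda>j. H (b, Suc j))"
  have "state_mean (\<lambda>x. H x * (trans_mean ^^ Suc (Suc n)) F x)
      = state_mean (\<lambda>y. ?E (letter_at y) * (trans_mean ^^ Suc n) F y)"
    unfolding funpow.simps(2)[of "Suc n"] o_def time_reversal ..
  also have "\<dots> = pair_mean (\<lambda>a k. (step_mean ^^ n) (step_mean ?E) (\<theta> a ! k) * F (a, Suc k))"
    unfolding Suc.IH[of "\<lambda>y. ?E (letter_at y)"] by (simp add: step_mean_def[abs_def])
  finally show ?case
    by (simp add: funpow_swap1)
qed

end

locale stationary_chain = pf_substitution \<theta> lam \<rho> \<sigma>
  for \<theta> :: "'a::finite \<Rightarrow> 'a list" and lam :: real and \<rho> \<sigma> :: "real^'a" +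
  fixes P :: "'w measure" and X :: "nat \<Rightarrow> 'w \<Rightarrow> 'a \<times> nat"
  assumes chain: "markov_chain P (chain_states \<theta>) (chain_law \<theta> lam \<rho> \<sigma>) (chain_trans \<theta> lam \<rho>) X"
begin

abbreviation S :: "('a \<times> nat) set" where "S \<equiv> chain_states \<theta>"

sublocale prob_space P
  using chain by (simp add: markov_chain_def)

lemma X_in_S: "n \<ge> 1 \<Longrightarrow> \<omega> \<in> space P \<Longrightarrow> X n \<omega> \<in> S"
  using chain by (auto simp: markov_chain_def measurable_def)

lemma X_eq_sets: "n \<ge> 1 \<Longrightarrow> {\<omega> \<in> space P. X n \<omega> = x} \<in> sets P"
proof (cases "x \<in> S")
  case True
  assume "n \<ge> 1"
  then have "X n \<in> measurable P (count_space S)"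
    using chain by (simp add: markov_chain_def)
  then have "X n -` {x} \<inter> space P \<in> sets P"
    using True by (intro measurable_sets) auto
  moreover have "X n -` {x} \<inter> space P = {\<omega> \<in> space P. X n \<omega> = x}"
    by auto
  ultimately show ?thesis by simp
next
  case False
  assume "n \<ge> 1"
  then have "{\<omega> \<in> space P. X n \<omega> = x} = {}"
    using X_in_S False by auto
  then show ?thesis
    by (simp only: sets.empty_sets)
qed

definition path_event :: "nat \<Rightarrow> (nat \<Rightarrow> 'a \<times> nat) \<Rightarrow> 'w set" where
  "path_event n x = {\<omega> \<in> space P. \<forall>i\<in>{1..n}. X i \<omega> = x i}"

lemma path_event_sets [measurable]: "path_event n x \<in> sets P"
  unfolding path_event_def by (intro sets.sets_Collect_finite_All X_eq_sets) auto

lemma integral_indicator_scaleR: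
  "A \<in> sets P \<Longrightarrow> (CLINT \<omega>|P. indicat_real A \<omega> *\<^sub>R c) = prob A *\<^sub>R (c :: complex)"
  by (subst integral_scaleR_left)
     (auto simp: integrable_indicator_iff emeasure_eq_measure sets.Int_space_eq2 dest: sets.sets_into_space intro!: arg_cong[of _ _ prob])

lemma integrable_indicator_scaleR:
  "A \<in> sets P \<Longrightarrow> integrable P (\<lambda>\<omega>. indicat_real A \<omega> *\<^sub>R (c :: complex))"
  by (intro integrable_scaleR_left) (auto simp: integrable_indicator_iff emeasure_eq_measure)

lemma prob_path_step:
  assumes "n \<ge> 1" and x: "\<And>i. i \<in> {1..n} \<Longrightarrow> x i \<in> S" and y: "y \<in> S"
  shows "prob (path_event n x \<inter> {\<omega> \<in> space P. X (Suc n) \<omega> = y})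
    = prob (path_event n x) * chain_trans \<theta> lam \<rho> (x n) y"
proof (cases "prob (path_event n x) = 0")
  case True
  have "prob (path_event n x \<inter> {\<omega> \<in> space P. X (Suc n) \<omega> = y}) \<le> prob (path_event n x)"
    by (rule finite_measure_mono) auto
  then show ?thesis
    using True by (simp add: measure_le_0_iff)
next
  case False
  then have "\<P>(\<omega> in P. X (Suc n) \<omega> = y \<bar> \<forall>i\<in>{1..n}. X i \<omega> = x i) = chain_trans \<theta> lam \<rho> (x n) y"
    using chain assms unfolding markov_chain_def path_event_def by blast
  moreover have "{\<omega> \<in> space P. X (Suc n) \<omega> = y \<and> (\<forall>i\<in>{1..n}. X i \<omega> = x i)}
      = path_event n x \<inter> {\<omega> \<in> space P. X (Suc n) \<omega> = y}"
    by (auto simp: path_event_def)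
  ultimately show ?thesis
    using False unfolding cond_prob_def path_event_def[symmetric] by (simp add: field_simps)
qed

text \<open>
  The path events of length \<open>n\<close> partition the space. This turns integrals over the chain into
  finite sums over paths, for which the Markov property is stated.
\<close>

lemma path_decomposition:
  assumes "n \<ge> 1" and "\<omega> \<in> space P"
  shows "(\<Sum>x\<in>(\<Pi>\<^sub>E i\<in>{1..n}. S). indicat_real (path_event n x) \<omega> *\<^sub>R \<Phi> x)
    = (\<Phi> (restrict (\<lambda>i. X i \<omega>) {1..n}) :: complex)"
proof -
  let ?r = "restrict (\<lambda>i. X i \<omega>) {1..n}"
  have r: "?r \<in> (\<Pi>\<^sub>E i\<in>{1..n}. S)"
    using X_in_S assms by auto
  have "indicat_real (path_event n x) \<omega> = (if x = ?r then 1 else 0)" if "x \<in> (\<Pi>\<^sub>E i\<in>{1..n}. S)" for x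
  proof -
    have "\<omega> \<in> path_event n x \<longleftrightarrow> x = ?r"
    proof
      assume "\<omega> \<in> path_event n x"
      then show "x = ?r"
        using that by (intro PiE_ext[OF that r]) (auto simp: path_event_def)
    qed (use assms in \<open>auto simp: path_event_def\<close>)
    then show ?thesis
      by (simp add: indicator_def)
  qed
  then have "(\<Sum>x\<in>(\<Pi>\<^sub>E i\<in>{1..n}. S). indicat_real (path_event n x) \<omega> *\<^sub>R \<Phi> x)
      = (\<Sum>x\<in>(\<Pi>\<^sub>E i\<in>{1..n}. S). if x = ?r then \<Phi> x else 0)"
    by (intro sum.cong) auto
  also have "\<dots> = \<Phi> ?r"
    using r finite_chain_states by (simp add: finite_PiE)
  finally show ?thesis .
qed

text \<open>
  Conditioning on the path up to time \<open>n\<close> replaces \<open>F\<close> at the next state by its mean under the transition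
  matrix, while \<open>X 1\<close> is determined by the path.
\<close>

lemma chain_one_step:
  assumes "n \<ge> 1"
  shows "(CLINT \<omega>|P. H (X 1 \<omega>) * F (X (Suc n) \<omega>)) = (CLINT \<omega>|P. H (X 1 \<omega>) * trans_mean F (X n \<omega>))"
proof -
  let ?\<Pi> = "\<Pi>\<^sub>E i\<in>{1..n}. S" and ?B = "\<lambda>y. {\<omega> \<in> space P. X (Suc n) \<omega> = y}"
  have B: "?B y \<in> sets P" for y
    by (rule X_eq_sets) simp
  have "(CLINT \<omega>|P. H (X 1 \<omega>) * F (X (Suc n) \<omega>))
      = (CLINT \<omega>|P. (\<Sum>x\<in>?\<Pi>. \<Sum>y\<in>S. indicat_real (path_event n x \<inter> ?B y) \<omega> *\<^sub>R (H (x 1) * F y)))"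
  proof (rule Bochner_Integration.integral_cong[OF refl])
    fix \<omega> assume \<omega>: "\<omega> \<in> space P"
    have "(\<Sum>y\<in>S. indicat_real (path_event n x \<inter> ?B y) \<omega> *\<^sub>R (H (x 1) * F y))
        = indicat_real (path_event n x) \<omega> *\<^sub>R (H (x 1) * F (X (Suc n) \<omega>))" for x
    proof -
      have "(\<Sum>y\<in>S. indicat_real (path_event n x \<inter> ?B y) \<omega> *\<^sub>R (H (x 1) * F y))
          = (\<Sum>y\<in>S. if y = X (Suc n) \<omega> then indicat_real (path_event n x) \<omega> *\<^sub>R (H (x 1) * F y) else 0)"
        using \<omega> by (intro sum.cong) (auto simp: indicator_def)
      then show ?thesis
        using X_in_S[of "Suc n" \<omega>] \<omega> finite_chain_states by simp
    qed
    then show "H (X 1 \<omega>) * F (X (Suc n) \<omega>)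
        = (\<Sum>x\<in>?\<Pi>. \<Sum>y\<in>S. indicat_real (path_event n x \<inter> ?B y) \<omega> *\<^sub>R (H (x 1) * F y))"
      using path_decomposition[OF assms \<omega>, of "\<lambda>x. H (x 1) * F (X (Suc n) \<omega>)"] assms by simp
  qed
  also have "\<dots> = (\<Sum>x\<in>?\<Pi>. \<Sum>y\<in>S. prob (path_event n x \<inter> ?B y) *\<^sub>R (H (x 1) * F y))"
    using B by (simp only: Bochner_Integration.integral_sum integrable_indicator_scaleR integral_indicator_scaleR
        path_event_sets sets.Int Bochner_Integration.integrable_sum)
  also have "\<dots> = (\<Sum>x\<in>?\<Pi>. \<Sum>y\<in>S. (prob (path_event n x) * chain_trans \<theta> lam \<rho> (x n) y) *\<^sub>R (H (x 1) * F y))"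
    using assms by (intro sum.cong refl) (subst prob_path_step; auto)
  also have "\<dots> = (\<Sum>x\<in>?\<Pi>. prob (path_event n x) *\<^sub>R (H (x 1) * trans_mean F (x n)))"
    by (simp add: trans_mean_def scaleR_conv_of_real sum_distrib_left mult_ac)
  also have "\<dots> = (CLINT \<omega>|P. (\<Sum>x\<in>?\<Pi>. indicat_real (path_event n x) \<omega> *\<^sub>R (H (x 1) * trans_mean F (x n))))"
    by (simp only: Bochner_Integration.integral_sum integrable_indicator_scaleR integral_indicator_scaleR path_event_sets)
  also have "\<dots> = (CLINT \<omega>|P. H (X 1 \<omega>) * trans_mean F (X n \<omega>))"
  proof (rule Bochner_Integration.integral_cong[OF refl])
    fix \<omega> assume \<omega>: "\<omega> \<in> space P"
    show "(\<Sum>x\<in>?\<Pi>. indicat_real (path_event n x) \<omega> *\<^sub>R (H (x 1) * trans_mean F (x n)))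
        = H (X 1 \<omega>) * trans_mean F (X n \<omega>)"
      using path_decomposition[OF assms \<omega>, of "\<lambda>x. H (x 1) * trans_mean F (x n)"] assms by simp
  qed
  finally show ?thesis .
qed

lemma chain_initial: "(CLINT \<omega>|P. F (X 1 \<omega>)) = state_mean F"
proof -
  have "(CLINT \<omega>|P. F (X 1 \<omega>)) = (CLINT \<omega>|P. (\<Sum>x\<in>S. indicat_real {\<omega> \<in> space P. X 1 \<omega> = x} \<omega> *\<^sub>R F x))"
  proof (rule Bochner_Integration.integral_cong[OF refl])
    fix \<omega> assume \<omega>: "\<omega> \<in> space P"
    have "(\<Sum>x\<in>S. indicat_real {\<omega> \<in> space P. X 1 \<omega> = x} \<omega> *\<^sub>R F x) = (\<Sum>x\<in>S. if x = X 1 \<omega> then F x else 0)"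
      using \<omega> by (intro sum.cong) (auto simp: indicator_def)
    then show "F (X 1 \<omega>) = (\<Sum>x\<in>S. indicat_real {\<omega> \<in> space P. X 1 \<omega> = x} \<omega> *\<^sub>R F x)"
      using X_in_S[of 1 \<omega>] \<omega> finite_chain_states by simp
  qed
  also have "\<dots> = (\<Sum>x\<in>S. prob {\<omega> \<in> space P. X 1 \<omega> = x} *\<^sub>R F x)"
    by (simp only: Bochner_Integration.integral_sum integrable_indicator_scaleR integral_indicator_scaleR
        X_eq_sets order_refl)
  also have "\<dots> = state_mean F"
    using chain by (simp add: state_mean_def markov_chain_def scaleR_conv_of_real)
  finally show ?thesis .
qed

lemma chain_correlation:
  "(CLINT \<omega>|P. H (X 1 \<omega>) * F (X (Suc n) \<omega>)) = state_mean (\<lambda>x. H x * (trans_mean ^^ n) F x)"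
proof (induction n arbitrary: F)
  case 0
  then show ?case
    using chain_initial[of "\<lambda>x. H x * F x"] by simp
next
  case (Suc n)
  have "(CLINT \<omega>|P. H (X 1 \<omega>) * F (X (Suc (Suc n)) \<omega>)) = (CLINT \<omega>|P. H (X 1 \<omega>) * trans_mean F (X (Suc n) \<omega>))"
    by (rule chain_one_step) simp
  also have "\<dots> = state_mean (\<lambda>x. H x * (trans_mean ^^ n) (trans_mean F) x)"
    by (rule Suc.IH)
  finally show ?case
    by (simp only: funpow_Suc_right o_apply)
qed

lemma integrable_chain_correlation:
  assumes "n \<ge> 1" "m \<ge> 1"
  shows "integrable P (\<lambda>\<omega>. H (X n \<omega>) * F (X m \<omega>) :: complex)"
proof -
  have m: "(\<lambda>\<omega>. G (X k \<omega>)) \<in> borel_measurable P" if "k \<ge> 1" for G :: "'a \<times> nat \<Rightarrow> complex" and k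
  proof (rule measurable_compose[of "X k" P "count_space S"])
    show "X k \<in> measurable P (count_space S)"
      using chain that by (simp add: markov_chain_def)
  qed simp
  have bnd: "norm (G x) \<le> (\<Sum>y\<in>S. norm (G y))" if "x \<in> S" for G :: "'a \<times> nat \<Rightarrow> complex" and x
    using that finite_chain_states by (intro member_le_sum) auto
  show ?thesis
    using assms by (intro integrable_const_bound[of _ "(\<Sum>y\<in>S. norm (H y)) * (\<Sum>y\<in>S. norm (F y))"]
        borel_measurable_times m AE_I2) (auto simp: norm_mult X_in_S intro!: mult_mono bnd sum_nonneg)
qed

end

context pf_substitution
begin

lemma pair_mean_add: "pair_mean (\<lambda>a k. h a k + h' a k) = pair_mean h + pair_mean h'"
  by (simp add: pair_mean_def child_mean_add stat_mean_add)

lemma pair_mean_cmult: "pair_mean (\<lambda>a k. c * h a k) = c * pair_mean h"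
  by (simp add: pair_mean_def child_mean_cmult stat_mean_cmult)

lemma pair_mean_cnj: "pair_mean (\<lambda>a k. cnj (h a k)) = cnj (pair_mean h)"
proof -
  have "child_mean a (\<lambda>k. cnj (h a k)) = cnj (child_mean a (h a))" for a
    by (simp add: child_mean_def)
  then show ?thesis
    by (simp add: pair_mean_def stat_mean_cnj)
qed

lemma pair_mean_parent: "pair_mean (\<lambda>a k. \<psi> a) = stat_mean \<psi>"
  by (simp add: pair_mean_def)

lemma pair_mean_child: "pair_mean (\<lambda>a k. \<psi> (\<theta> a ! k)) = stat_mean \<psi>"
  using stat_mean_step[of \<psi>] by (simp add: pair_mean_def step_mean_def[abs_def])

lemma pair_mean_sums:
  assumes "\<And>a k. (\<lambda>n. h n a k) sums s a k"
  shows "(\<lambda>n. pair_mean (h n)) sums pair_mean s"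
  unfolding pair_mean_def stat_mean_def child_mean_def
  by (intro sums_sum sums_mult assms)

end

context real_or_rotating_eigenfunction
begin

lemma drift_eq: "drift \<theta> lam \<rho> \<sigma> f = mean_drift"
proof -
  have "drift \<theta> lam \<rho> \<sigma> f = state_mean (\<lambda>(a, j). word_sum f (take (j - 1) (\<theta> a)))"
    unfolding drift_def state_mean_def by (intro sum.cong) auto
  then show ?thesis
    by (simp add: state_mean_eq pair_mean_def mean_drift_def)
qed

lemma asym_var_pair_mean: "of_real asym_var = pair_mean (\<lambda>a k. xi a k * cnj (xi a k))"
  unfolding asym_var_def pair_mean_def stat_mean_def child_mean_def complex_norm_square[symmetric]
  by simp

text \<open>
  The function \<open>xi + eta\<close> equals the centred summand plus the rotated \<open>eta\<close> of the child. Taking second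
  moments of both sides, \<open>xi\<close> is orthogonal to functions of the parent, and by stationarity the
  second moment of \<open>eta\<close> is the same for parent and child and cancels.
\<close>

lemma asym_var_green_kubo:
  "asym_var = Re (pair_mean (\<lambda>a k. (prefix_sum a k - mean_drift) * cnj (prefix_sum a k - mean_drift)))
     + 2 * Re (pair_mean (\<lambda>a k. cnj lf * eta (\<theta> a ! k) * cnj (prefix_sum a k - mean_drift)))"
proof -
  define g where "g = (\<lambda>a k. prefix_sum a k - mean_drift)"
  define c where "c = (\<lambda>a k. cnj lf * eta (\<theta> a ! k))"
  have decomp: "xi a k + eta a = g a k + c a k" for a k
    by (simp add: xi_def g_def c_def)
  have cross: "pair_mean (\<lambda>a k. cnj (eta a) * xi a k) = 0"
    by (simp add: pair_mean_def child_mean_cmult child_mean_xi)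
  have cross': "pair_mean (\<lambda>a k. eta a * cnj (xi a k)) = 0"
    using pair_mean_cnj[of "\<lambda>a k. cnj (eta a) * xi a k"] by (simp add: cross)
  have cc: "pair_mean (\<lambda>a k. c a k * cnj (c a k)) = stat_mean (\<lambda>b. eta b * cnj (eta b))"
  proof -
    have "c a k * cnj (c a k) = eta (\<theta> a ! k) * cnj (eta (\<theta> a ! k))" for a k
      using lf_cnj by (simp add: c_def algebra_simps)
    then show ?thesis
      using pair_mean_child[of "\<lambda>b. eta b * cnj (eta b)"] by simp
  qed
  have "pair_mean (\<lambda>a k. xi a k * cnj (xi a k)) + stat_mean (\<lambda>b. eta b * cnj (eta b))
      = pair_mean (\<lambda>a k. xi a k * cnj (xi a k)) + pair_mean (\<lambda>a k. cnj (eta a) * xi a k)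
        + pair_mean (\<lambda>a k. eta a * cnj (xi a k)) + pair_mean (\<lambda>a k. eta a * cnj (eta a))"
    by (simp add: cross cross' pair_mean_parent)
  also have "\<dots> = pair_mean (\<lambda>a k. (xi a k + eta a) * cnj (xi a k + eta a))"
    by (simp only: pair_mean_add[symmetric]) (simp add: algebra_simps)
  also have "\<dots> = pair_mean (\<lambda>a k. g a k * cnj (g a k)) + pair_mean (\<lambda>a k. c a k * cnj (g a k))
        + pair_mean (\<lambda>a k. cnj (c a k * cnj (g a k))) + pair_mean (\<lambda>a k. c a k * cnj (c a k))"
    unfolding decomp by (simp only: pair_mean_add[symmetric]) (simp add: algebra_simps)
  finally have "of_real asym_var = pair_mean (\<lambda>a k. g a k * cnj (g a k)) + pair_mean (\<lambda>a k. c a k * cnj (g a k))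
        + cnj (pair_mean (\<lambda>a k. c a k * cnj (g a k)))"
    unfolding cc pair_mean_cnj asym_var_pair_mean by simp
  then have "Re (of_real asym_var) = Re (pair_mean (\<lambda>a k. g a k * cnj (g a k)) + pair_mean (\<lambda>a k. c a k * cnj (g a k))
        + cnj (pair_mean (\<lambda>a k. c a k * cnj (g a k))))"
    by (simp only:)
  then show ?thesis
    by (simp add: g_def c_def)
qed

text \<open>
  The covariance at distance \<open>n + 1\<close>, read downwards, pairs the summand with the mean of the summand
  \<open>n + 1\<close> levels further down; summed with the rotations \<open>cnj lf\<^sup>n\<^sup>+\<^sup>1\<close>, these means add up to
  \<open>cnj lf * eta\<close> at the child.
\<close>

lemma asymptotic_variance_eq:
  assumes "markov_chain P (chain_states \<theta>) (chain_law \<theta> lam \<rho> \<sigma>) (chain_trans \<theta> lam \<rho>) X"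
  shows "asymptotic_variance P X (centered_prefix_sum \<theta> lam \<rho> \<sigma> f) lf = asym_var"
proof -
  interpret chain: stationary_chain \<theta> lam \<rho> \<sigma> P X
    by unfold_locales (fact assms)
  define g where "g = centered_prefix_sum \<theta> lam \<rho> \<sigma> f"
  have g: "g (a, Suc k) = prefix_sum a k - mean_drift" for a k
    by (simp add: g_def centered_prefix_sum_def drift_eq)
  have Eg: "child_mean b (\<lambda>j. g (b, Suc j)) = mean_prefix b" for b
    by (simp add: g mean_prefix_def child_mean_diff)
  have "(LINT \<omega>|P. (cmod (g (X 1 \<omega>)))\<^sup>2) = (LINT \<omega>|P. Re (g (X 1 \<omega>) * cnj (g (X 1 \<omega>))))"
    by (simp add: complex_norm_square[symmetric] del: times_complex.sel)
  also have "\<dots> = Re (CLINT \<omega>|P. g (X 1 \<omega>) * cnj (g (X 1 \<omega>)))"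
    using chain.integrable_chain_correlation[of 1 1 g "\<lambda>x. cnj (g x)"] by (intro integral_Re) simp
  also have "\<dots> = Re (pair_mean (\<lambda>a k. (prefix_sum a k - mean_drift) * cnj (prefix_sum a k - mean_drift)))"
    using chain.chain_correlation[of g "\<lambda>x. cnj (g x)" 0] by (simp add: state_mean_eq g del: times_complex.sel)
  finally have first: "(LINT \<omega>|P. (cmod (g (X 1 \<omega>)))\<^sup>2)
      = Re (pair_mean (\<lambda>a k. (prefix_sum a k - mean_drift) * cnj (prefix_sum a k - mean_drift)))" .
  define T where "T = (\<lambda>n. pair_mean (\<lambda>a k. cnj lf ^ n * (step_mean ^^ n) mean_prefix (\<theta> a ! k) * (cnj lf * cnj (prefix_sum a k - mean_drift))))"
  have correlation: "2 * (LINT \<omega>|P. Re (cnj lf ^ (n + 1) * g (X 1 \<omega>) * cnj (g (X (n + 2) \<omega>)))) = 2 * Re (T n)" for n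
  proof -
    have "(LINT \<omega>|P. Re (cnj lf ^ (n + 1) * g (X 1 \<omega>) * cnj (g (X (n + 2) \<omega>))))
        = Re (CLINT \<omega>|P. (cnj lf ^ (n + 1) * g (X 1 \<omega>)) * cnj (g (X (n + 2) \<omega>)))"
      using chain.integrable_chain_correlation[of 1 "n + 2" "\<lambda>x. cnj lf ^ (n + 1) * g x" "\<lambda>x. cnj (g x)"]
      by (intro integral_Re) simp
    also have "(CLINT \<omega>|P. (cnj lf ^ (n + 1) * g (X 1 \<omega>)) * cnj (g (X (n + 2) \<omega>)))
        = cnj lf ^ (n + 1) * (CLINT \<omega>|P. g (X 1 \<omega>) * cnj (g (X (Suc (Suc n)) \<omega>)))"
      by (simp add: mult.assoc)
    also have "\<dots> = T n"
      unfolding chain.chain_correlation[of g "\<lambda>x. cnj (g x)" "Suc n"] state_mean_trans_power Eg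
      unfolding T_def pair_mean_cmult[symmetric] g by (simp add: mult_ac)
    finally show ?thesis by simp
  qed
  have "T sums pair_mean (\<lambda>a k. eta (\<theta> a ! k) * (cnj lf * cnj (prefix_sum a k - mean_drift)))"
    unfolding T_def eta_def poisson_series_def using stat_mean_mean_prefix norm_lf
    by (intro pair_mean_sums sums_mult2 summable_sums summable_poisson_series) auto
  then have "(\<lambda>n. Re (T n)) sums Re (pair_mean (\<lambda>a k. eta (\<theta> a ! k) * (cnj lf * cnj (prefix_sum a k - mean_drift))))"
    by (rule sums_Re)
  then have "(\<lambda>n. 2 * Re (T n)) sums (2 * Re (pair_mean (\<lambda>a k. eta (\<theta> a ! k) * (cnj lf * cnj (prefix_sum a k - mean_drift)))))"
    by (rule sums_mult)
  also have "(\<lambda>a k. eta (\<theta> a ! k) * (cnj lf * cnj (prefix_sum a k - mean_drift))) = (\<lambda>a k. cnj lf * eta (\<theta> a ! k) * cnj (prefix_sum a k - mean_drift))"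
    by (simp add: fun_eq_iff mult_ac)
  finally have "(\<Sum>n. 2 * Re (T n)) = 2 * Re (pair_mean (\<lambda>a k. cnj lf * eta (\<theta> a ! k) * cnj (prefix_sum a k - mean_drift)))"
    by (rule sums_unique[symmetric])
  then show ?thesis
    unfolding asymptotic_variance_def g_def[symmetric] first correlation asym_var_green_kubo by simp
qed

end

section \<open>The limit theorem\<close>

context real_or_rotating_eigenfunction
begin

theorem prefix_sums_converge:
  assumes "subst_fixed_point \<theta> u"
  shows "weakly_converges
      (\<lambda>N. uniform_law N (\<lambda>k. (word_sum f (stake k u) - of_real (log lam (real N)) * drift_per_level)
                                 / of_real (sqrt (log lam (real N)))))
      (limit_law lf asym_var)"
proof (rule weakly_converges_if_cchar_converges)
  let ?Y = "\<lambda>N k. (word_sum f (stake k u) - of_real (log lam (real N)) * drift_per_level) / of_real (sqrt (log lam (real N)))"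
  have desub: "\<exists>v. u = (subst_seq \<theta> ^^ n) v" for n
    using assms by (rule fixed_point_desubstitution)
  fix z
  \<comment> \<open>If \<open>lf\<close> is real, so are all values, and the imaginary part of the frequency is irrelevant.\<close>
  define z' where "z' = (if lf \<in> \<real> then of_real (Re z) else z)"
  have "Re (z * ?Y N k) = Re (z' * ?Y N k)" for N k
  proof (cases "lf \<in> \<real>")
    case True
    have "drift_per_level \<in> \<real>"
      using mean_drift_real[OF True] by (simp add: drift_per_level_def)
    then have "?Y N k \<in> \<real>"
      using word_sum_real[OF True] by (intro Reals_divide Reals_diff Reals_mult) auto
    then obtain y where y: "?Y N k = of_real y"
      by (rule Reals_cases)
    show ?thesis
      unfolding y by (simp add: z'_def True)
  qed (simp add: z'_def)
  moreover have "(\<lambda>N. (\<Sum>k\<in>{1..N}. iexp (Re (z' * ?Y N k))) / of_nat N) \<longlonglongrightarrow> of_real (exp (- rate * (cmod z')\<^sup>2))"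
    by (rule prefix_characteristic_limit[OF desub]) (simp add: admissible_def z'_def)
  moreover have "cchar (limit_law lf asym_var) z = of_real (exp (- rate * (cmod z')\<^sup>2))"
  proof (cases "lf \<in> \<real>")
    case True
    then show ?thesis
      unfolding cchar_limit_law_real[OF asym_var_nonneg True] exp_of_real by (simp add: z'_def rate_def)
  next
    case False
    then show ?thesis
      unfolding cchar_limit_law_nonreal[OF asym_var_nonneg False] exp_of_real by (simp add: z'_def rate_def)
  qed
  ultimately have "(\<lambda>N. (\<Sum>k\<in>{1..N}. iexp (Re (z * ?Y N k))) / of_nat N) \<longlonglongrightarrow> cchar (limit_law lf asym_var) z"
    by (simp only:)
  moreover have "\<forall>\<^sub>F N in sequentially. (\<Sum>k\<in>{1..N}. iexp (Re (z * ?Y N k))) / of_nat N = cchar (uniform_law N (?Y N)) z"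
    using eventually_ge_at_top[of 1] by eventually_elim (rule cchar_uniform_law[symmetric])
  ultimately show "(\<lambda>N. cchar (uniform_law N (?Y N)) z) \<longlonglongrightarrow> cchar (limit_law lf asym_var) z"
    by (rule Lim_transform_eventually)
qed (simp_all add: prob_space_uniform_law limit_law_prob_space asym_var_nonneg)

end

theorem theorem3p3:
  fixes \<theta> :: "'a::finite \<Rightarrow> 'a list"
    and u :: "'a stream"
    and f :: "'a \<Rightarrow> complex"
    and lam :: real and lamf :: complex
    and \<rho> \<sigma> :: "real^'a"
    and P :: "'w measure"
    and X :: "nat \<Rightarrow> 'w \<Rightarrow> 'a \<times> nat"
  defines "M \<equiv> subst_matrix \<theta>"
    and "D \<equiv> drift \<theta> lam \<rho> \<sigma> f"
    and "V \<equiv> asymptotic_variance P X (centered_prefix_sum \<theta> lam \<rho> \<sigma> f) lamf"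
  assumes "primitive_subst \<theta>"
    and "perron_frobenius_eigenvalue M lam" and "lam > 1"
    and "subst_fixed_point \<theta> u"
    and "left_eigenfunction M f lamf" and "cmod lamf = 1"
    and "\<not> coboundary u f"
    and "lamf \<in> \<real> \<Longrightarrow> \<forall>a. f a \<in> \<real>"
    and "\<forall>a. \<rho> $ a > 0" and "M *v \<rho> = lam *s \<rho>"
    and "\<forall>a. \<sigma> $ a > 0" and "\<sigma> v* M = lam *s \<sigma>"
    and "(\<Sum>a\<in>UNIV. \<sigma> $ a * \<rho> $ a) = 1"
    and "markov_chain P (chain_states \<theta>) (chain_law \<theta> lam \<rho> \<sigma>) (chain_trans \<theta> lam \<rho>) X"
  shows "(lamf \<noteq> 1 \<longrightarrow>
            weakly_converges
              (\<lambda>N. uniform_law N (\<lambda>k. word_sum f (stake k u) / complex_of_real (sqrt (log lam (real N)))))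
              (limit_law lamf V)) \<and>
         (lamf = 1 \<longrightarrow>
            weakly_converges
              (\<lambda>N. uniform_law N (\<lambda>k. (word_sum f (stake k u) - complex_of_real (log lam (real N)) * D)
                                        / complex_of_real (sqrt (log lam (real N)))))
              (limit_law lamf V))"
proof -
  have eigen: "word_sum f (\<theta> b) = lamf * f b" for b
  proof -
    have "(\<Sum>a\<in>UNIV. f a * complex_of_real (M $ a $ b)) = lamf * f b"
      using assms(8) by (simp add: left_eigenfunction_def)
    then show ?thesis
      by (simp add: word_sum_def sum_list_map_count_list M_def subst_matrix_def mult.commute)
  qed
  interpret real_or_rotating_eigenfunction \<theta> lam \<rho> \<sigma> f lamf
    using assms eigen by unfold_locales (auto simp: M_def)
  have V: "V = asym_var"
    unfolding V_def using assms(17) by (rule asymptotic_variance_eq)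
  have D_eq: "D = mean_drift"
    unfolding D_def drift_eq ..
  note conv = prefix_sums_converge[OF assms(7), folded V, unfolded drift_per_level_def]
  show ?thesis
  proof (intro conjI impI)
    assume "lamf \<noteq> 1"
    then show "weakly_converges
        (\<lambda>N. uniform_law N (\<lambda>k. word_sum f (stake k u) / complex_of_real (sqrt (log lam (real N)))))
        (limit_law lamf V)"
      using conv by simp
  next
    assume one: "lamf = 1"
    show "weakly_converges
        (\<lambda>N. uniform_law N (\<lambda>k. (word_sum f (stake k u) - complex_of_real (log lam (real N)) * D)
                                  / complex_of_real (sqrt (log lam (real N)))))
        (limit_law lamf V)"
      using conv unfolding D_eq if_P[OF one] .
  qed
qed

end
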